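(* Let $k$ be a field of characteristic zero, let $Q$ be a finite connected quiver, and let $A=kQ/\langle Z\rangle$ be a finite-dimensional monomial algebra. The following assertions are equivalent: 1. $HH_1(A)=0$. 2. Every non trivial circuit of $Q$ contains a zero cycle and, whenever $C$ is a circuit such that $(Q_1\odot B)_C\neq\emptyset\neq (Z\odot B)_C$, there is exactly one pair $(\xi,\beta)\in (Z\odot B)_C$ such that the cycle $\xi\beta$ contains no zero relation (no subpath belonging to $Z$) apart from $\xi$.
   Context: Quiver: vertices $Q_0$, arrows $Q_1$, source and terminal maps $s,t:Q_1\to Q_0$. A path of length $l\ge 1$ is a sequence $a_l\cdots a_1$ of arrows with $t(a_i)=s(a_{i+1})$; its source is $s(a_1)$, its terminal vertex is $t(a_l)$. Vertices are the (trivial) paths of length $0$. A cycle is a path whose source and terminal vertex coincide. The product in $kQ$ is concatenation. $Z$ is a set of paths of length at least two, minimal for the subpath order (no strict subpath of an element of $Z$ is in $Z$), and $A=kQ/\langle Z\rangle$. $B$ is the set of paths (including vertices) containing no path of $Z$ as a subpath; it is identified with a $k$-basis of $A$. A zero path (zero cycle) is a path (cycle) containing a path of $Z$. $HH_1(A)=H_1(A,A)$ is the first Hochschild homology group $\mathrm{Tor}_1(A,A)$ over $A$-$A$-bimodules. For sets of paths $X,Y$: $X\odot Y=\{(\alpha,\beta)\in X\times Y: t(\beta)=s(\alpha),\ t(\alpha)=s(\beta)\}$. A circuit is an equivalence class of cycles under the equivalence relation generated by rotation $a_n\cdots a_1\sim a_1a_n\cdots a_2$ ($a_i$ arrows); it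 is trivial if it corresponds to a vertex. For a circuit $C$, $(X\odot Y)_C=\{(\alpha,\beta)\in X\odot Y:\alpha\beta\in C\}$. Subpaths are counted as occurrences: "apart from $\xi$" means apart from the occurrence of $\xi$ as the final part of $\xi\beta$. *)

theory Defs
  imports
    "Graph_Theory.Digraph_Component"
    "HOL-Algebra.Embedded_Algebras"
    "HOL-Algebra.QuotRing"
    "HOL-Algebra.Free_Abelian_Groups"
begin

section \<open>Paths and circuits of a quiver\<close>

text \<open>
  A quiver is a \<^typ>\<open>('v, 'a) pre_digraph\<close>: the source map is \<^const>\<open>tail\<close>, the terminal map
  is \<^const>\<open>head\<close>. The path $a_l \cdots a_1$ is the pair
  \<open>(s(a\<^sub>1), [a\<^sub>1, \<dots>, a\<^sub>l])\<close>, its arrows listed in the order in which they are traversed; the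
  vertex \<open>v\<close>, as a path of length 0, is \<open>(v, [])\<close>.
\<close>

type_synonym ('v, 'a) qpath = "'v \<times> 'a list"

definition paths :: "('v, 'a) pre_digraph \<Rightarrow> ('v, 'a) qpath set" where
  "paths Q = {(u, p). \<exists>v. pre_digraph.awalk Q u p v}"

definition psource :: "('v, 'a) qpath \<Rightarrow> 'v" where
  "psource \<gamma> = fst \<gamma>"

definition ptarget :: "('v, 'a) pre_digraph \<Rightarrow> ('v, 'a) qpath \<Rightarrow> 'v" where
  "ptarget Q \<gamma> = pre_digraph.awlast Q (fst \<gamma>) (snd \<gamma>)"

definition plength :: "('v, 'a) qpath \<Rightarrow> nat" where
  "plength \<gamma> = length (snd \<gamma>)"

definition composable :: "('v, 'a) pre_digraph \<Rightarrow> ('v, 'a) qpath \<Rightarrow> ('v, 'a) qpath \<Rightarrow> bool" where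
  "composable Q \<alpha> \<beta> \<longleftrightarrow> ptarget Q \<beta> = psource \<alpha>"

text \<open>The concatenation $\alpha\beta$ traverses \<open>\<beta>\<close> first.\<close>

definition pcomp :: "('v, 'a) qpath \<Rightarrow> ('v, 'a) qpath \<Rightarrow> ('v, 'a) qpath" where
  "pcomp \<alpha> \<beta> = (fst \<beta>, snd \<beta> @ snd \<alpha>)"

text \<open>
  An occurrence of \<open>\<zeta>\<close> as a subpath of \<open>\<gamma>\<close> is a factorization $\gamma = \delta\zeta\varepsilon$.
\<close>

definition occurrence ::
  "('v, 'a) pre_digraph \<Rightarrow> ('v, 'a) qpath \<Rightarrow> ('v, 'a) qpath \<Rightarrow> ('v, 'a) qpath \<Rightarrow> ('v, 'a) qpath \<Rightarrow> bool"
where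
  "occurrence Q \<delta> \<zeta> \<epsilon> \<gamma> \<longleftrightarrow> \<delta> \<in> paths Q \<and> \<zeta> \<in> paths Q \<and> \<epsilon> \<in> paths Q \<and>
     composable Q \<delta> \<zeta> \<and> composable Q \<zeta> \<epsilon> \<and> \<gamma> = pcomp \<delta> (pcomp \<zeta> \<epsilon>)"

definition subpath :: "('v, 'a) pre_digraph \<Rightarrow> ('v, 'a) qpath \<Rightarrow> ('v, 'a) qpath \<Rightarrow> bool" where
  "subpath Q \<zeta> \<gamma> \<longleftrightarrow> (\<exists>\<delta> \<epsilon>. occurrence Q \<delta> \<zeta> \<epsilon> \<gamma>)"

definition arrow_paths :: "('v, 'a) pre_digraph \<Rightarrow> ('v, 'a) qpath set" where
  "arrow_paths Q = {(tail Q a, [a]) | a. a \<in> arcs Q}"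

definition zero_path :: "('v, 'a) pre_digraph \<Rightarrow> ('v, 'a) qpath set \<Rightarrow> ('v, 'a) qpath \<Rightarrow> bool" where
  "zero_path Q Z \<gamma> \<longleftrightarrow> \<gamma> \<in> paths Q \<and> (\<exists>\<zeta>\<in>Z. subpath Q \<zeta> \<gamma>)"

definition basis_paths :: "('v, 'a) pre_digraph \<Rightarrow> ('v, 'a) qpath set \<Rightarrow> ('v, 'a) qpath set" where
  "basis_paths Q Z = {\<gamma> \<in> paths Q. \<not> zero_path Q Z \<gamma>}"

definition monomial_relations :: "('v, 'a) pre_digraph \<Rightarrow> ('v, 'a) qpath set \<Rightarrow> bool" where
  "monomial_relations Q Z \<longleftrightarrow>
     Z \<subseteq> paths Q \<and> (\<forall>\<zeta>\<in>Z. plength \<zeta> \<ge> 2) \<and> (\<forall>\<zeta>\<in>Z. \<forall>\<zeta>'\<in>Z. subpath Q \<zeta>' \<zeta> \<longrightarrow> \<zeta>' = \<zeta>)"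

definition cycles :: "('v, 'a) pre_digraph \<Rightarrow> ('v, 'a) qpath set" where
  "cycles Q = {\<gamma> \<in> paths Q. ptarget Q \<gamma> = psource \<gamma>}"

text \<open>$a_n \cdots a_1 \mapsto a_1 a_n \cdots a_2$\<close>

definition rotation :: "('v, 'a) pre_digraph \<Rightarrow> ('v, 'a) qpath \<Rightarrow> ('v, 'a) qpath \<Rightarrow> bool" where
  "rotation Q \<gamma> \<gamma>' \<longleftrightarrow> \<gamma> \<in> cycles Q \<and> (\<exists>a p. snd \<gamma> = a # p \<and> \<gamma>' = (head Q a, p @ [a]))"

definition circuits :: "('v, 'a) pre_digraph \<Rightarrow> ('v, 'a) qpath set set" where
  "circuits Q = cycles Q // {(\<gamma>, \<gamma>') \<in> cycles Q \<times> cycles Q. equivclp (rotation Q) \<gamma> \<gamma>'}"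

definition trivial_circuit :: "('v, 'a) pre_digraph \<Rightarrow> ('v, 'a) qpath set \<Rightarrow> bool" where
  "trivial_circuit Q C \<longleftrightarrow> (\<exists>v\<in>verts Q. C = {(v, [])})"

text \<open>The set $(X \odot Y)_C$.\<close>

definition odot ::
  "('v, 'a) pre_digraph \<Rightarrow> ('v, 'a) qpath set \<Rightarrow> ('v, 'a) qpath set \<Rightarrow> (('v, 'a) qpath \<times> ('v, 'a) qpath) set"
where
  "odot Q X Y = {(\<alpha>, \<beta>) \<in> X \<times> Y. ptarget Q \<beta> = psource \<alpha> \<and> ptarget Q \<alpha> = psource \<beta>}"

definition odot_at ::
  "('v, 'a) pre_digraph \<Rightarrow> ('v, 'a) qpath set \<Rightarrow> ('v, 'a) qpath set \<Rightarrow> ('v, 'a) qpath set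
    \<Rightarrow> (('v, 'a) qpath \<times> ('v, 'a) qpath) set"
where
  "odot_at Q X Y C = {(\<alpha>, \<beta>) \<in> odot Q X Y. pcomp \<alpha> \<beta> \<in> C}"

text \<open>
  The condition \<open>\<zeta> = \<xi> \<and> \<epsilon> = \<beta>\<close> singles out the occurrence of \<open>\<xi>\<close> as the final part of
  $\xi\beta$; an occurrence of \<open>\<xi>\<close> at another position counts as a further zero relation.
\<close>

definition no_other_zero_relation ::
  "('v, 'a) pre_digraph \<Rightarrow> ('v, 'a) qpath set \<Rightarrow> ('v, 'a) qpath \<Rightarrow> ('v, 'a) qpath \<Rightarrow> bool"
where
  "no_other_zero_relation Q Z \<xi> \<beta> \<longleftrightarrow>
     (\<forall>\<delta> \<zeta> \<epsilon>. \<zeta> \<in> Z \<longrightarrow> occurrence Q \<delta> \<zeta> \<epsilon> (pcomp \<xi> \<beta>) \<longrightarrow> \<zeta> = \<xi> \<and> \<epsilon> = \<beta>)"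


section \<open>The path algebra and its monomial quotients\<close>

definition scalar :: "('v, 'a) pre_digraph \<Rightarrow> 'k \<Rightarrow> (('v, 'a) qpath \<Rightarrow>\<^sub>0 'k::field)" where
  "scalar Q c = (\<Sum>v\<in>verts Q. Poly_Mapping.single (v, []) c)"

definition path_algebra :: "('v, 'a) pre_digraph \<Rightarrow> (('v, 'a) qpath \<Rightarrow>\<^sub>0 'k::field) ring" where
  "path_algebra Q =
     \<lparr>carrier = {f. Poly_Mapping.keys f \<subseteq> paths Q},
      monoid.mult = (\<lambda>f g. \<Sum>\<alpha>\<in>Poly_Mapping.keys f. \<Sum>\<beta>\<in>Poly_Mapping.keys g.
        if composable Q \<alpha> \<beta>
        then Poly_Mapping.single (pcomp \<alpha> \<beta>) (Poly_Mapping.lookup f \<alpha> * Poly_Mapping.lookup g \<beta>)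
        else 0),
      monoid.one = scalar Q 1,
      ring.zero = 0,
      ring.add = (+)\<rparr>"

definition monomial_ideal ::
  "('v, 'a) pre_digraph \<Rightarrow> ('v, 'a) qpath set \<Rightarrow> (('v, 'a) qpath \<Rightarrow>\<^sub>0 'k::field) set"
where
  "monomial_ideal Q Z = genideal (path_algebra Q) ((\<lambda>\<zeta>. Poly_Mapping.single \<zeta> 1) ` Z)"

definition monomial_algebra ::
  "('v, 'a) pre_digraph \<Rightarrow> ('v, 'a) qpath set \<Rightarrow> (('v, 'a) qpath \<Rightarrow>\<^sub>0 'k::field) set ring"
where
  "monomial_algebra Q Z = path_algebra Q Quot monomial_ideal Q Z"

text \<open>The image of \<open>k\<close> in the algebra \<open>kQ/\<langle>Z\<rangle>\<close>, through which it is a \<open>k\<close>-algebra.\<close>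

definition base_field ::
  "('v, 'a) pre_digraph \<Rightarrow> ('v, 'a) qpath set \<Rightarrow> (('v, 'a) qpath \<Rightarrow>\<^sub>0 'k::field) set set"
where
  "base_field Q Z = range (\<lambda>c. monomial_ideal Q Z +>\<^bsub>path_algebra Q\<^esub> scalar Q c)"


section \<open>Hochschild homology\<close>

text \<open>
  Let \<open>R\<close> be a ring and \<open>K\<close> a central subfield. The Hochschild homology of the \<open>K\<close>-algebra \<open>R\<close> is
  $\mathrm{Tor}_n(R,R)$ over $R$-$R$-bimodules, that is, the homology of $R \otimes_{R^e} P_\bullet$
  where $P_\bullet$ is the bar resolution of $R$ by projective bimodules: $P_n = R^{\otimes_K (n+2)}$ with
  $d(y_0 \otimes \cdots \otimes y_{n+1}) =
   \sum_{i=0}^{n} (-1)^i\, y_0 \otimes \cdots \otimes y_i y_{i+1} \otimes \cdots \otimes y_{n+1}$.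

  The group $R \otimes_{R^e} P_n$ is presented as the quotient of the free abelian group on the lists
  \<open>[x, y\<^sub>0, \<dots>, y\<^sub>n\<^sub>+\<^sub>1]\<close>, which stand for $x \otimes (y_0 \otimes \cdots \otimes y_{n+1})$, by the
  relations below: additivity in each entry; \<open>K\<close>-balancedness of the tensor products inside $P_n$; and
  balancedness over $R^e$ between \<open>x\<close> and $P_n$, i.e. $bxa \otimes p = x \otimes apb$, split into its
  left and its right part.
\<close>

definition bar_generators :: "('r, 'm) ring_scheme \<Rightarrow> nat \<Rightarrow> 'r list set" where
  "bar_generators R n = {xs. length xs = n + 3 \<and> set xs \<subseteq> carrier R}"

abbreviation bar_free :: "('r, 'm) ring_scheme \<Rightarrow> nat \<Rightarrow> ('r list \<Rightarrow>\<^sub>0 int) monoid" where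
  "bar_free R n \<equiv> free_Abelian_group (bar_generators R n)"

inductive_set bar_relators :: "('r, 'm) ring_scheme \<Rightarrow> 'r set \<Rightarrow> nat \<Rightarrow> ('r list \<Rightarrow>\<^sub>0 int) set"
  for R (structure) and K n
where
  additive: "\<lbrakk>xs \<in> bar_generators R n; i < n + 3; a \<in> carrier R; b \<in> carrier R\<rbrakk> \<Longrightarrow>
     frag_of (xs[i := a \<oplus> b]) - frag_of (xs[i := a]) - frag_of (xs[i := b]) \<in> bar_relators R K n"
| balanced: "\<lbrakk>xs \<in> bar_generators R n; 1 \<le> i; i + 1 < n + 3; c \<in> K\<rbrakk> \<Longrightarrow>
     frag_of (xs[i := xs ! i \<otimes> c]) - frag_of (xs[i + 1 := c \<otimes> xs ! (i + 1)]) \<in> bar_relators R K n"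
| left: "\<lbrakk>xs \<in> bar_generators R n; a \<in> carrier R\<rbrakk> \<Longrightarrow>
     frag_of (xs[0 := xs ! 0 \<otimes> a]) - frag_of (xs[1 := a \<otimes> xs ! 1]) \<in> bar_relators R K n"
| right: "\<lbrakk>xs \<in> bar_generators R n; b \<in> carrier R\<rbrakk> \<Longrightarrow>
     frag_of (xs[0 := b \<otimes> xs ! 0]) - frag_of (xs[n + 2 := xs ! (n + 2) \<otimes> b]) \<in> bar_relators R K n"

definition merge_at :: "('r, 'm) ring_scheme \<Rightarrow> nat \<Rightarrow> 'r list \<Rightarrow> 'r list" where
  "merge_at R j xs = take j xs @ (xs ! j \<otimes>\<^bsub>R\<^esub> xs ! (j + 1)) # drop (j + 2) xs"

text \<open>The entry \<open>y\<^sub>i\<close> sits at position \<open>i + 1\<close>.\<close>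

definition bar_differential ::
  "('r, 'm) ring_scheme \<Rightarrow> nat \<Rightarrow> ('r list \<Rightarrow>\<^sub>0 int) \<Rightarrow> ('r list \<Rightarrow>\<^sub>0 int)"
where
  "bar_differential R n =
     frag_extend (\<lambda>xs. \<Sum>i\<le>n. frag_cmul ((- 1) ^ i) (frag_of (merge_at R (i + 1) xs)))"

text \<open>
  Cycles and boundaries are taken in the free abelian group: those elements that represent a cycle,
  respectively a boundary, of the quotient complex.
\<close>

definition bar_cycles :: "('r, 'm) ring_scheme \<Rightarrow> 'r set \<Rightarrow> nat \<Rightarrow> ('r list \<Rightarrow>\<^sub>0 int) set" where
  "bar_cycles R K n = {z \<in> carrier (bar_free R n). n = 0 \<or>
     bar_differential R n z \<in> generate (bar_free R (n - 1)) (bar_relators R K (n - 1))}"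

definition bar_boundaries :: "('r, 'm) ring_scheme \<Rightarrow> 'r set \<Rightarrow> nat \<Rightarrow> ('r list \<Rightarrow>\<^sub>0 int) set" where
  "bar_boundaries R K n = generate (bar_free R n)
     (bar_relators R K n \<union> bar_differential R (n + 1) ` carrier (bar_free R (n + 1)))"

definition hochschild_homology ::
  "nat \<Rightarrow> ('r, 'm) ring_scheme \<Rightarrow> 'r set \<Rightarrow> ('r list \<Rightarrow>\<^sub>0 int) set monoid"
where
  "hochschild_homology n R K =
     subgroup_generated (bar_free R n) (bar_cycles R K n) Mod bar_boundaries R K n"

end

theory Submission
  imports Defs "HOL-Library.Sublist"
begin

text \<open>
  Modulo boundaries, Hochschild 1-chains reduce by the Leibniz rule to the pairs $(a, \beta)$ of
  $Q_1 \odot B$; such a pair is read as the cyclic word of $a\beta$, starting with \<open>a\<close>. The only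
  remaining relations say that, for $\zeta \in Z$ and a cycle $\zeta\eta$, the sum of the pairs
  obtained by cutting $\zeta\eta$ at the arrows of $\zeta$ vanishes.

  On a circuit \<open>C\<close> view a pair as an edge from the cycle $a\beta$ to its rotation $\beta a$, both
  regarded as vertices and deleted when they are zero. The differential is the boundary map of this
  graph. If \<open>C\<close> contains no zero cycle, the sum of all edges is a nonzero class. Otherwise the
  1-cycles are spanned by the connected components, and since every occurrence of a relation on \<open>C\<close>
  meets every edge, the relations only identify a nonzero multiple (characteristic zero) of the sum
  of all edges with zero. Hence the circuit contributes nothing exactly when there is at most one
  component. A component has exactly one last edge, that is an edge $(a, \beta)$ with $\beta \in B$
  and $\beta a$ zero, and writing $\beta a = \xi\beta'$ identifies these last edges with the pairs
  $(\xi, \beta') \in Z \odot B$ without further zero relation.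
\<close>

section \<open>Hochschild homology in degree one\<close>

text \<open>The homology group is a quotient of subgroups of free abelian groups on lists of cosets,
  so nothing in it is linear over the field: a scalar lives inside an entry of a generator, and
  chains are tested by additive maps into the field. For vanishing, a cycle is reduced modulo
  boundaries to a normal form. The coboundary of the coefficient of a nonzero path kills cycles and
  boundaries alike, hence also the normal form; this makes the coefficients of consecutive edges of
  a circuit equal. For non-vanishing, a weight on the edges is extended to a derivation of the path
  algebra into its dual. It descends to the quotient once it ignores the edges with zero remainder
  and its weights add up to zero along every relation. A word that is a proper power has fewer
  distinct rotations than letters. Cutting a word of length n at its n positions meets every
  distinct edge n / r times, where r is the number of distinct rotations; this is the multiple
  mentioned above. It is never computed: summing over positions and rotations at the same time
  leaves only a division by n or by r.\<close>

definition frag_eval :: "('x \<Rightarrow> 'k::field) \<Rightarrow> ('x \<Rightarrow>\<^sub>0 int) \<Rightarrow> 'k" where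
  "frag_eval g z = (\<Sum>x\<in>Poly_Mapping.keys z. of_int (Poly_Mapping.lookup z x) * g x)"

lemma frag_eval_superset:
  assumes "finite A" "Poly_Mapping.keys z \<subseteq> A"
  shows "frag_eval g z = (\<Sum>x\<in>A. of_int (Poly_Mapping.lookup z x) * g x)"
  unfolding frag_eval_def using assms
  by (intro sum.mono_neutral_left) (auto simp: in_keys_iff)

lemma frag_eval_0 [simp]: "frag_eval g 0 = 0"
  by (simp add: frag_eval_def)

lemma frag_eval_of [simp]: "frag_eval g (frag_of x) = g x"
  by (simp add: frag_eval_def)

lemma frag_eval_add: "frag_eval g (a + b) = frag_eval g a + frag_eval g b"
proof -
  let ?A = "Poly_Mapping.keys a \<union> Poly_Mapping.keys b"
  have "Poly_Mapping.keys (a + b) \<subseteq> ?A"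
    by (rule Poly_Mapping.keys_add)
  then show ?thesis
    by (simp add: frag_eval_superset[of ?A] lookup_add distrib_right sum.distrib)
qed

lemma frag_eval_uminus: "frag_eval g (- a) = - frag_eval g a"
  using frag_eval_add[of g a "- a"] by (simp add: eq_neg_iff_add_eq_0 add.commute)

lemma frag_eval_diff: "frag_eval g (a - b) = frag_eval g a - frag_eval g b"
  using frag_eval_add[of g a "- b"] by (simp add: frag_eval_uminus)

lemma frag_eval_sum: "frag_eval g (\<Sum>i\<in>I. f i) = (\<Sum>i\<in>I. frag_eval g (f i))"
  by (induction I rule: infinite_finite_induct) (auto simp: frag_eval_add)

section \<open>Subgroups of a free abelian group given by generators\<close>

context
  fixes S :: "'x set" and X :: "('x \<Rightarrow>\<^sub>0 int) set"
  assumes X: "X \<subseteq> carrier (free_Abelian_group S)"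
begin

lemma generate_free_zero: "0 \<in> generate (free_Abelian_group S) X"
  using generate.one[of "free_Abelian_group S" X] by simp

lemma generate_free_add:
  assumes "a \<in> generate (free_Abelian_group S) X" "b \<in> generate (free_Abelian_group S) X"
  shows "a + b \<in> generate (free_Abelian_group S) X"
  using generate.eng[OF assms] by simp

lemma generate_free_uminus:
  assumes "a \<in> generate (free_Abelian_group S) X"
  shows "- a \<in> generate (free_Abelian_group S) X"
proof -
  interpret group "free_Abelian_group S" by simp
  have "a \<in> carrier (free_Abelian_group S)"
    using generate_in_carrier[OF X assms] .
  then show ?thesis
    using generate_m_inv_closed[OF X assms] by simp
qed

lemma generate_free_diff:
  assumes "a \<in> generate (free_Abelian_group S) X" "b \<in> generate (free_Abelian_group S) X"
  shows "a - b \<in> generate (free_Abelian_group S) X"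
  using generate_free_add[OF assms(1) generate_free_uminus[OF assms(2)]] by simp

lemma generate_free_sum:
  assumes "\<And>i. i \<in> I \<Longrightarrow> f i \<in> generate (free_Abelian_group S) X"
  shows "(\<Sum>i\<in>I. f i) \<in> generate (free_Abelian_group S) X"
  using assms
  by (induction I rule: infinite_finite_induct) (auto intro: generate_free_zero generate_free_add)

lemma frag_eval_generate:
  assumes "\<And>x. x \<in> X \<Longrightarrow> frag_eval g x = 0" and "z \<in> generate (free_Abelian_group S) X"
  shows "frag_eval g z = 0"
  using assms(2)
proof induction
  case (inv h)
  then have "inv\<^bsub>free_Abelian_group S\<^esub> h = - h"
    using X by auto
  with inv show ?case
    by (simp add: assms frag_eval_uminus)
qed (auto simp: assms frag_eval_add)

end

lemma bar_generators_update:
  "xs \<in> bar_generators R n \<Longrightarrow> a \<in> carrier R \<Longrightarrow> xs[i := a] \<in> bar_generators R n"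
  using set_update_subset_insert[of xs i a] by (auto simp: bar_generators_def)

lemma bar_generators_nth:
  "xs \<in> bar_generators R n \<Longrightarrow> i < n + 3 \<Longrightarrow> xs ! i \<in> carrier R"
  by (force simp: bar_generators_def)

lemma frag_diff_carrier:
  "a \<in> carrier (free_Abelian_group S) \<Longrightarrow> b \<in> carrier (free_Abelian_group S) \<Longrightarrow>
   a - b \<in> carrier (free_Abelian_group S)"
  using keys_diff[of a b] by (auto simp: carrier_free_Abelian_group_iff)

section \<open>The bar complex over central scalars in low degrees\<close>

locale central_pair = ring R for R (structure) +
  fixes K
  assumes K_carrier: "K \<subseteq> carrier R"
    and K_central: "c \<in> K \<Longrightarrow> x \<in> carrier R \<Longrightarrow> c \<otimes> x = x \<otimes> c"
begin

lemma bar_relators_carrier: "bar_relators R K n \<subseteq> carrier (bar_free R n)"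
proof
  fix r assume "r \<in> bar_relators R K n"
  then show "r \<in> carrier (bar_free R n)"
  proof induction
    case (additive xs i a b)
    then show ?case
      by (intro frag_diff_carrier) (auto simp: bar_generators_update)
  next
    case (balanced xs i c)
    then show ?case
      using K_carrier bar_generators_nth[of xs R n i] bar_generators_nth[of xs R n "i + 1"]
      by (intro frag_diff_carrier) (auto intro!: bar_generators_update)
  next
    case (left xs a)
    then show ?case
      using bar_generators_nth[of xs R n 0] bar_generators_nth[of xs R n 1]
      by (intro frag_diff_carrier) (auto intro!: bar_generators_update)
  next
    case (right xs b)
    then show ?case
      using bar_generators_nth[of xs R n 0] bar_generators_nth[of xs R n "n + 2"]
      by (intro frag_diff_carrier) (auto intro!: bar_generators_update)
  qed
qed

lemma merge_at_generators:
  assumes "xs \<in> bar_generators R (Suc n)" "i \<le> Suc n"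
  shows "merge_at R (i + 1) xs \<in> bar_generators R n"
proof -
  have "xs ! (i + 1) \<in> carrier R" "xs ! (i + 2) \<in> carrier R"
    using assms by (auto intro!: bar_generators_nth[of xs R "Suc n"])
  then show ?thesis
    using assms by (auto simp: merge_at_def bar_generators_def dest: in_set_takeD in_set_dropD)
qed

lemma bar_differential_carrier:
  assumes "z \<in> carrier (bar_free R (Suc n))"
  shows "bar_differential R (Suc n) z \<in> carrier (bar_free R n)"
proof -
  have "Poly_Mapping.keys (\<Sum>i\<le>Suc n. frag_cmul ((- 1) ^ i) (frag_of (merge_at R (i + 1) xs)))
        \<subseteq> bar_generators R n" if "xs \<in> bar_generators R (Suc n)" for xs
    using that merge_at_generators[OF that]
    by (intro order_trans[OF keys_sum]) (auto simp del: One_nat_def)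
  moreover have "Poly_Mapping.keys z \<subseteq> bar_generators R (Suc n)"
    using assms by (simp add: carrier_free_Abelian_group_iff)
  ultimately have "Poly_Mapping.keys (bar_differential R (Suc n) z) \<subseteq> bar_generators R n"
    unfolding bar_differential_def by (intro order_trans[OF keys_frag_extend]) blast
  then show ?thesis
    by (simp add: carrier_free_Abelian_group_iff)
qed

abbreviation bnd where "bnd \<equiv> bar_boundaries R K (Suc 0)"

lemma bar_boundaries_gens:
  "bar_relators R K (Suc 0) \<union> bar_differential R (Suc 0 + 1) ` carrier (bar_free R (Suc 0 + 1))
   \<subseteq> carrier (bar_free R (Suc 0))"
  using bar_relators_carrier[of "Suc 0"] bar_differential_carrier[of _ "Suc 0"] by auto

lemmas bnd_zero = generate_free_zero[OF bar_boundaries_gens, folded bar_boundaries_def]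
lemmas bnd_add = generate_free_add[OF bar_boundaries_gens, folded bar_boundaries_def]
lemmas bnd_uminus = generate_free_uminus[OF bar_boundaries_gens, folded bar_boundaries_def]
lemmas bnd_diff = generate_free_diff[OF bar_boundaries_gens, folded bar_boundaries_def]
lemmas bnd_sum = generate_free_sum[OF bar_boundaries_gens, folded bar_boundaries_def]

lemma bnd_relator: "r \<in> bar_relators R K (Suc 0) \<Longrightarrow> r \<in> bnd"
  unfolding bar_boundaries_def by (rule generate.incl) blast

lemma bnd_differential: "w \<in> carrier (bar_free R 2) \<Longrightarrow> bar_differential R 2 w \<in> bnd"
  unfolding bar_boundaries_def by (rule generate.incl) (auto simp: numeral_2_eq_2)

lemma bar_differential_1:
  "bar_differential R (Suc 0) (frag_of [x, y, z, w]) = frag_of [x, y \<otimes> z, w] - frag_of [x, y, z \<otimes> w]"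
  by (simp add: bar_differential_def merge_at_def numeral_2_eq_2 eval_nat_numeral)

lemma bar_differential_2:
  "bar_differential R 2 (frag_of [x, y, z, w, v]) =
   frag_of [x, y \<otimes> z, w, v] - frag_of [x, y, z \<otimes> w, v] + frag_of [x, y, z, w \<otimes> v]"
  by (simp add: bar_differential_def merge_at_def numeral_2_eq_2 eval_nat_numeral)

text \<open>The set \<open>bnd\<close> is closed under sums and differences, so a coset equals
  \<open>bnd\<close> exactly when its representative lies in \<open>bnd\<close>. Triviality of the
  quotient is thereby an inclusion between two sets of chains, the form in which both directions of
  the theorem are proved.\<close>

lemma trivial_hochschild_iff:
  "trivial_group (hochschild_homology (Suc 0) R K) \<longleftrightarrow> bar_cycles R K (Suc 0) \<subseteq> bnd"
proof -
  let ?F = "bar_free R (Suc 0)" and ?Z = "bar_cycles R K (Suc 0)"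
  let ?G = "subgroup_generated ?F ?Z"
  have H: "hochschild_homology (Suc 0) R K = ?G Mod bnd"
    by (simp add: hochschild_homology_def)
  have Z: "?Z \<subseteq> carrier ?F"
    by (auto simp: bar_cycles_def)
  have cG: "carrier ?G = generate ?F ?Z"
    using Z by (simp add: carrier_subgroup_generated Int_absorb1)
  have coset: "bnd #>\<^bsub>?G\<^esub> a = (\<lambda>h. h + a) ` bnd" for a
    by (auto simp: r_coset_def)
  have self: "bnd #>\<^bsub>?G\<^esub> a = bnd \<longleftrightarrow> a \<in> bnd" for a
  proof
    assume "bnd #>\<^bsub>?G\<^esub> a = bnd"
    then show "a \<in> bnd"
      using bnd_zero unfolding coset by force
  next
    assume a: "a \<in> bnd"
    have "x \<in> (\<lambda>h. h + a) ` bnd" if "x \<in> bnd" for x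
      using bnd_diff[OF that a] by (intro image_eqI[of _ _ "x - a"]) auto
    then show "bnd #>\<^bsub>?G\<^esub> a = bnd"
      using a by (auto simp: coset intro: bnd_add)
  qed
  show ?thesis
  proof
    assume "trivial_group (hochschild_homology (Suc 0) R K)"
    then have "rcosets\<^bsub>?G\<^esub> bnd = {bnd}"
      by (simp add: trivial_group_def H FactGroup_def)
    then have "bnd #>\<^bsub>?G\<^esub> a = bnd" if "a \<in> carrier ?G" for a
      using that by (auto simp: RCOSETS_def)
    then have "carrier ?G \<subseteq> bnd"
      using self by blast
    moreover have "?Z \<subseteq> carrier ?G"
      unfolding cG by (auto intro: generate.incl)
    ultimately show "?Z \<subseteq> bnd"
      by blast
  next
    assume sub: "?Z \<subseteq> bnd"
    have "carrier ?G \<subseteq> bnd"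
    proof
      fix x assume "x \<in> carrier ?G"
      then have "x \<in> generate ?F ?Z"
        by (simp add: cG)
      then show "x \<in> bnd"
      proof induction
        case one
        then show ?case by (simp add: bnd_zero)
      next
        case (incl h)
        then show ?case using sub by blast
      next
        case (inv h)
        then show ?case using sub Z bnd_uminus[of h] by (auto simp: subset_iff)
      next
        case (eng h1 h2)
        then show ?case by (simp add: bnd_add)
      qed
    qed
    moreover have "0 \<in> carrier ?G"
      using generate.one[of ?F ?Z] by (simp add: cG)
    ultimately have cos: "rcosets\<^bsub>?G\<^esub> bnd = {bnd}"
      using self unfolding RCOSETS_def by blast
    have mult: "bnd <#>\<^bsub>?G\<^esub> bnd = bnd"
    proof
      show "bnd <#>\<^bsub>?G\<^esub> bnd \<subseteq> bnd"
        by (auto simp: set_mult_def intro: bnd_add)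
      show "bnd \<subseteq> bnd <#>\<^bsub>?G\<^esub> bnd"
        using bnd_zero by (force simp: set_mult_def)
    qed
    have "group (?G Mod bnd)"
      by (rule groupI) (auto simp: FactGroup_def cos mult)
    then show "trivial_group (hochschild_homology (Suc 0) R K)"
      by (simp add: trivial_group_def H FactGroup_def cos)
  qed
qed

text \<open>The element x \<otimes> (1 \<otimes> y \<otimes> 1), that is, the Hochschild chain x
  \<otimes> y with both outer bimodule factors normalised to one.\<close>

definition chain :: "'a \<Rightarrow> 'a \<Rightarrow> 'a list \<Rightarrow>\<^sub>0 int" where
  "chain x y = frag_of [x, \<one>, y, \<one>]"

lemma chain_carrier: "x \<in> carrier R \<Longrightarrow> y \<in> carrier R \<Longrightarrow> chain x y \<in> carrier (bar_free R (Suc 0))"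
  by (simp add: chain_def bar_generators_def)

lemma chain_add_left:
  assumes "x \<in> carrier R" "x' \<in> carrier R" "y \<in> carrier R"
  shows "chain (x \<oplus> x') y - chain x y - chain x' y \<in> bnd"
  using bar_relators.additive[of "[x, \<one>, y, \<one>]" R "Suc 0" 0 x x' K] assms
  by (intro bnd_relator) (simp add: chain_def bar_generators_def)

lemma chain_add_right:
  assumes "x \<in> carrier R" "y \<in> carrier R" "y' \<in> carrier R"
  shows "chain x (y \<oplus> y') - chain x y - chain x y' \<in> bnd"
  using bar_relators.additive[of "[x, \<one>, y, \<one>]" R "Suc 0" 2 y y' K] assms
  by (intro bnd_relator) (simp add: chain_def bar_generators_def eval_nat_numeral)

text \<open>The scalar travels in two moves: from \<open>x\<close> to the outer factor by
  balancedness over the enveloping algebra, then on to \<open>y\<close> by balancedness inside the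
  bar term. It leaves \<open>x\<close> on the right, and centrality puts it on the left.\<close>

lemma chain_balanced:
  assumes "c \<in> K" "x \<in> carrier R" "y \<in> carrier R"
  shows "chain (c \<otimes> x) y - chain x (c \<otimes> y) \<in> bnd"
proof -
  have c: "c \<in> carrier R"
    using assms K_carrier by auto
  have "frag_of [x \<otimes> c, \<one>, y, \<one>] - frag_of [x, c, y, \<one>] \<in> bnd"
    using bar_relators.left[of "[x, \<one>, y, \<one>]" R "Suc 0" c K] assms c
    by (intro bnd_relator) (simp add: bar_generators_def)
  moreover have "frag_of [x, c, y, \<one>] - frag_of [x, \<one>, c \<otimes> y, \<one>] \<in> bnd"
    using bar_relators.balanced[of "[x, \<one>, y, \<one>]" R "Suc 0" 1 c K] assms c
    by (intro bnd_relator) (simp add: bar_generators_def eval_nat_numeral)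
  ultimately show ?thesis
    using bnd_add K_central[OF assms(1,2)] by (fastforce simp: chain_def)
qed

text \<open>Up to sign this is the Hochschild boundary of x \<otimes> y \<otimes> z. The bar
  differential leaves \<open>y\<close> and \<open>z\<close> in the outer factors of two of its
  terms; the left and right relators move them over to \<open>x\<close>.\<close>

lemma chain_leibniz:
  assumes "x \<in> carrier R" "y \<in> carrier R" "z \<in> carrier R"
  shows "chain x (y \<otimes> z) - chain (z \<otimes> x) y - chain (x \<otimes> y) z \<in> bnd"
proof -
  have d: "frag_of [x, y, z, \<one>] - frag_of [x, \<one>, y \<otimes> z, \<one>] + frag_of [x, \<one>, y, z] \<in> bnd"
    using bnd_differential[of "frag_of [x, \<one>, y, z, \<one>]"] assms
    by (simp add: bar_differential_2 bar_generators_def)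
  have l: "frag_of [x \<otimes> y, \<one>, z, \<one>] - frag_of [x, y, z, \<one>] \<in> bnd"
    using bar_relators.left[of "[x, \<one>, z, \<one>]" R "Suc 0" y K] assms
    by (intro bnd_relator) (simp add: bar_generators_def)
  have r: "frag_of [z \<otimes> x, \<one>, y, \<one>] - frag_of [x, \<one>, y, z] \<in> bnd"
    using bar_relators.right[of "[x, \<one>, y, \<one>]" R "Suc 0" z K] assms
    by (intro bnd_relator) (simp add: bar_generators_def eval_nat_numeral)
  have "- (frag_of [x, y, z, \<one>] - frag_of [x, \<one>, y \<otimes> z, \<one>] + frag_of [x, \<one>, y, z])
      - (frag_of [x \<otimes> y, \<one>, z, \<one>] - frag_of [x, y, z, \<one>])
      - (frag_of [z \<otimes> x, \<one>, y, \<one>] - frag_of [x, \<one>, y, z]) \<in> bnd"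
    by (intro bnd_diff bnd_uminus d l r)
  then show ?thesis
    by (simp add: chain_def algebra_simps)
qed

text \<open>The identification of x \<otimes> (y \<otimes> z \<otimes> w) with wxy \<otimes> z: both
  outer factors act on the bimodule entry \<open>x\<close>. The same formula is built into
  \<open>cochain\<close>.\<close>

lemma generator_chain:
  assumes "x \<in> carrier R" "y \<in> carrier R" "z \<in> carrier R" "w \<in> carrier R"
  shows "frag_of [x, y, z, w] - chain (w \<otimes> x \<otimes> y) z \<in> bnd"
proof -
  have l: "frag_of [(w \<otimes> x) \<otimes> y, \<one>, z, \<one>] - frag_of [w \<otimes> x, y, z, \<one>] \<in> bnd"
    using bar_relators.left[of "[w \<otimes> x, \<one>, z, \<one>]" R "Suc 0" y K] assms
    by (intro bnd_relator) (simp add: bar_generators_def)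
  have r: "frag_of [w \<otimes> x, y, z, \<one>] - frag_of [x, y, z, w] \<in> bnd"
    using bar_relators.right[of "[x, y, z, \<one>]" R "Suc 0" w K] assms
    by (intro bnd_relator) (simp add: bar_generators_def eval_nat_numeral)
  have "- (frag_of [(w \<otimes> x) \<otimes> y, \<one>, z, \<one>] - frag_of [w \<otimes> x, y, z, \<one>])
      - (frag_of [w \<otimes> x, y, z, \<one>] - frag_of [x, y, z, w]) \<in> bnd"
    by (intro bnd_diff bnd_uminus l r)
  then show ?thesis
    by (simp add: chain_def algebra_simps)
qed

lemma list4: "length xs = 4 \<Longrightarrow> \<exists>x y z w. xs = [x, y, z, w]"
  by (auto simp: eval_nat_numeral length_Suc_conv)

lemma bar_generators_1:
  assumes "xs \<in> bar_generators R (Suc 0)"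
  obtains x y z w where "xs = [x, y, z, w]" "x \<in> carrier R" "y \<in> carrier R" "z \<in> carrier R" "w \<in> carrier R"
  using assms list4[of xs] by (auto simp: bar_generators_def)

lemma bar_generators_0:
  assumes "xs \<in> bar_generators R 0"
  obtains x y z where "xs = [x, y, z]" "x \<in> carrier R" "y \<in> carrier R" "z \<in> carrier R"
  using assms by (auto simp: bar_generators_def eval_nat_numeral length_Suc_conv)

lemma bar_generators_2:
  assumes "xs \<in> bar_generators R 2"
  obtains x y z w v where "xs = [x, y, z, w, v]" "x \<in> carrier R" "y \<in> carrier R" "z \<in> carrier R" "w \<in> carrier R"
    "v \<in> carrier R"
  using assms by (auto simp: bar_generators_def eval_nat_numeral length_Suc_conv)

definition cochain :: "('a \<Rightarrow> 'a \<Rightarrow> 'k::field) \<Rightarrow> ('a list \<Rightarrow>\<^sub>0 int) \<Rightarrow> 'k" where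
  "cochain \<Phi> = frag_eval (\<lambda>xs. \<Phi> (xs ! 3 \<otimes> xs ! 0 \<otimes> xs ! 1) (xs ! 2))"

lemma cochain_chain: "x \<in> carrier R \<Longrightarrow> cochain \<Phi> (chain x y) = \<Phi> x y"
  by (simp add: cochain_def chain_def eval_nat_numeral)

text \<open>The hypotheses say that y \<mapsto> \<Phi>(-, y) is a derivation of the ring into its
  dual. The first three kill the relators; the last one, applied to
  \<open>v \<otimes> x \<otimes> y\<close>, \<open>z\<close> and \<open>w\<close>, is the value on
  the differential of a degree two generator.\<close>

lemma cochain_bnd:
  fixes \<Phi> :: "'a \<Rightarrow> 'a \<Rightarrow> 'k::field"
  assumes addl: "\<And>x x' y. \<lbrakk>x \<in> carrier R; x' \<in> carrier R; y \<in> carrier R\<rbrakk> \<Longrightarrow> \<Phi> (x \<oplus> x') y = \<Phi> x y + \<Phi> x' y"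
    and addr: "\<And>x y y'. \<lbrakk>x \<in> carrier R; y \<in> carrier R; y' \<in> carrier R\<rbrakk> \<Longrightarrow> \<Phi> x (y \<oplus> y') = \<Phi> x y + \<Phi> x y'"
    and bal: "\<And>c x y. \<lbrakk>c \<in> K; x \<in> carrier R; y \<in> carrier R\<rbrakk> \<Longrightarrow> \<Phi> (c \<otimes> x) y = \<Phi> x (c \<otimes> y)"
    and coc: "\<And>x y z. \<lbrakk>x \<in> carrier R; y \<in> carrier R; z \<in> carrier R\<rbrakk> \<Longrightarrow>
               \<Phi> x (y \<otimes> z) = \<Phi> (z \<otimes> x) y + \<Phi> (x \<otimes> y) z"
    and z: "z \<in> bnd"
  shows "cochain \<Phi> z = 0"
proof -
  let ?g = "\<lambda>xs. \<Phi> (xs ! 3 \<otimes> xs ! 0 \<otimes> xs ! 1) (xs ! 2)"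
  have g: "?g [x, y, z, w] = \<Phi> (w \<otimes> x \<otimes> y) z" for x y z w
    by (simp add: eval_nat_numeral)
  have rel: "frag_eval ?g r = 0" if "r \<in> bar_relators R K (Suc 0)" for r
    using that
  proof cases
    case (additive xs i a b)
    obtain x y z w where xs: "xs = [x, y, z, w]" "x \<in> carrier R" "y \<in> carrier R" "z \<in> carrier R" "w \<in> carrier R"
      using additive(2) by (rule bar_generators_1)
    consider "i = 0" | "i = 1" | "i = 2" | "i = 3"
      using additive(3) by linarith
    then show ?thesis
      using additive(4,5) xs(2-)
      by cases (simp_all add: additive(1) xs(1) frag_eval_diff eval_nat_numeral addl addr r_distr l_distr)
  next
    case (balanced xs i c)
    obtain x y z w where xs: "xs = [x, y, z, w]" "x \<in> carrier R" "y \<in> carrier R" "z \<in> carrier R" "w \<in> carrier R"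
      using balanced(2) by (rule bar_generators_1)
    have c: "c \<in> carrier R"
      using balanced K_carrier by auto
    consider "i = 1" | "i = 2"
      using balanced(3,4) by linarith
    then show ?thesis
    proof cases
      case 1
      have "w \<otimes> x \<otimes> (y \<otimes> c) = c \<otimes> (w \<otimes> x \<otimes> y)"
        using K_central[OF balanced(5), of "w \<otimes> x \<otimes> y"] xs c by (simp add: m_assoc)
      then show ?thesis
        using 1 xs(2-) c balanced(5) bal[of c "w \<otimes> x \<otimes> y" z]
        by (simp add: balanced(1) xs(1) frag_eval_diff eval_nat_numeral)
    next
      case 2
      have "c \<otimes> w \<otimes> x \<otimes> y = c \<otimes> (w \<otimes> x \<otimes> y)" "z \<otimes> c = c \<otimes> z"
        using K_central[OF balanced(5), of z] xs c by (simp_all add: m_assoc)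
      then show ?thesis
        using 2 xs(2-) c balanced(5) bal[of c "w \<otimes> x \<otimes> y" z]
        by (simp add: balanced(1) xs(1) frag_eval_diff eval_nat_numeral)
    qed
  next
    case (left xs a)
    obtain x y z w where "xs = [x, y, z, w]" "x \<in> carrier R" "y \<in> carrier R" "z \<in> carrier R" "w \<in> carrier R"
      using left(2) by (rule bar_generators_1)
    then show ?thesis
      using left by (simp add: frag_eval_diff eval_nat_numeral m_assoc)
  next
    case (right xs a)
    obtain x y z w where "xs = [x, y, z, w]" "x \<in> carrier R" "y \<in> carrier R" "z \<in> carrier R" "w \<in> carrier R"
      using right(2) by (rule bar_generators_1)
    then show ?thesis
      using right by (simp add: frag_eval_diff eval_nat_numeral m_assoc)
  qed
  have dif: "frag_eval ?g (bar_differential R 2 w) = 0" if "w \<in> carrier (bar_free R 2)" for w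
  proof -
    have gen: "frag_eval ?g (bar_differential R 2 (frag_of xs)) = 0" if xs': "xs \<in> bar_generators R 2" for xs
    proof -
      obtain x y z w v where xs: "xs = [x, y, z, w, v]" "x \<in> carrier R" "y \<in> carrier R" "z \<in> carrier R"
        "w \<in> carrier R" "v \<in> carrier R"
        using xs' by (rule bar_generators_2)
      show ?thesis
        using xs(2-) coc[of "v \<otimes> x \<otimes> y" z w]
        by (simp add: xs(1) bar_differential_2 frag_eval_diff frag_eval_add g m_assoc)
    qed
    have "Poly_Mapping.keys w \<subseteq> bar_generators R 2"
      using that by (simp add: carrier_free_Abelian_group_iff)
    then show ?thesis
    proof (induction w rule: frag_induction[consumes 1, case_names zero one diff])
      case (diff a b)
      then show ?case
        by (simp add: bar_differential_def frag_extend_diff frag_eval_diff)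
    qed (use gen in \<open>simp_all add: bar_differential_def\<close>)
  qed
  have "frag_eval ?g z = 0"
  proof (rule frag_eval_generate[OF bar_boundaries_gens])
    show "z \<in> generate (bar_free R (Suc 0))
       (bar_relators R K (Suc 0) \<union> bar_differential R (Suc 0 + 1) ` carrier (bar_free R (Suc 0 + 1)))"
      using z by (simp add: bar_boundaries_def)
  qed (use rel dif in \<open>auto simp: numeral_2_eq_2\<close>)
  then show ?thesis
    by (simp add: cochain_def)
qed

text \<open>The function being evaluated is the coboundary of \<open>tr\<close>. Transported to
  degree zero by x \<otimes> (y \<otimes> z) \<mapsto> zxy, \<open>tr\<close> kills the relators,
  hence the differential of a cycle, and its value on the differential of x \<otimes> y is tr(xy) -
  tr(yx).\<close>

lemma cochain_cycle:
  fixes tr :: "'a \<Rightarrow> 'k::field"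
  assumes add: "\<And>x x'. \<lbrakk>x \<in> carrier R; x' \<in> carrier R\<rbrakk> \<Longrightarrow> tr (x \<oplus> x') = tr x + tr x'"
    and z: "z \<in> bar_cycles R K (Suc 0)"
  shows "cochain (\<lambda>x y. tr (x \<otimes> y) - tr (y \<otimes> x)) z = 0"
proof -
  let ?g = "\<lambda>xs. tr (xs ! 2 \<otimes> xs ! 0 \<otimes> xs ! 1)"
  have g: "?g [x, y, z] = tr (z \<otimes> x \<otimes> y)" for x y z
    by (simp add: eval_nat_numeral)
  have rel: "frag_eval ?g r = 0" if "r \<in> bar_relators R K 0" for r
    using that
  proof cases
    case (additive xs i a b)
    obtain x y z where xs: "xs = [x, y, z]" "x \<in> carrier R" "y \<in> carrier R" "z \<in> carrier R"
      using additive(2) by (rule bar_generators_0)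
    consider "i = 0" | "i = 1" | "i = 2"
      using additive(3) by linarith
    then show ?thesis
      using additive(4,5) xs(2-)
      by cases (simp_all add: additive(1) xs(1) frag_eval_diff eval_nat_numeral add r_distr l_distr)
  next
    case (balanced xs i c)
    obtain x y z where xs: "xs = [x, y, z]" "x \<in> carrier R" "y \<in> carrier R" "z \<in> carrier R"
      using balanced(2) by (rule bar_generators_0)
    have c: "c \<in> carrier R" and i: "i = 1"
      using balanced K_carrier by auto
    have "z \<otimes> x \<otimes> (y \<otimes> c) = c \<otimes> z \<otimes> x \<otimes> y"
      using K_central[OF balanced(5), of "z \<otimes> x \<otimes> y"] xs c by (simp add: m_assoc)
    then show ?thesis
      using i xs(2-) c by (simp add: balanced(1) xs(1) frag_eval_diff eval_nat_numeral)
  next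
    case (left xs a)
    obtain x y z where "xs = [x, y, z]" "x \<in> carrier R" "y \<in> carrier R" "z \<in> carrier R"
      using left(2) by (rule bar_generators_0)
    then show ?thesis
      using left by (simp add: frag_eval_diff eval_nat_numeral m_assoc)
  next
    case (right xs a)
    obtain x y z where "xs = [x, y, z]" "x \<in> carrier R" "y \<in> carrier R" "z \<in> carrier R"
      using right(2) by (rule bar_generators_0)
    then show ?thesis
      using right by (simp add: frag_eval_diff eval_nat_numeral m_assoc)
  qed
  have z': "Poly_Mapping.keys z \<subseteq> bar_generators R (Suc 0)"
    and dz: "bar_differential R (Suc 0) z \<in> generate (bar_free R 0) (bar_relators R K 0)"
    using z by (auto simp: bar_cycles_def carrier_free_Abelian_group_iff)
  have "frag_eval ?g (bar_differential R (Suc 0) z) = 0"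
    using frag_eval_generate[OF bar_relators_carrier rel dz] .
  moreover have "frag_eval ?g (bar_differential R (Suc 0) z) = cochain (\<lambda>x y. tr (x \<otimes> y) - tr (y \<otimes> x)) z"
    using z'
  proof (induction z rule: frag_induction)
    case (one xs)
    then obtain x y z w where "xs = [x, y, z, w]" "x \<in> carrier R" "y \<in> carrier R" "z \<in> carrier R" "w \<in> carrier R"
      by (rule bar_generators_1)
    then show ?case
      by (simp add: cochain_def bar_differential_1 frag_eval_diff) (simp add: eval_nat_numeral m_assoc)
  qed (simp_all add: bar_differential_def cochain_def frag_extend_diff frag_eval_diff)
  ultimately show ?thesis
    by simp
qed

text \<open>A coboundary is a cocycle: xyz - yzx = (zxy - yzx) + (xyz - zxy). Together with
  \<open>cochain_cycle\<close> this allows a cycle to be replaced by any congruent chain before it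
  is tested.\<close>

lemma trace_cocycle:
  fixes tr :: "'a \<Rightarrow> 'k::field"
  assumes add: "\<And>x x'. \<lbrakk>x \<in> carrier R; x' \<in> carrier R\<rbrakk> \<Longrightarrow> tr (x \<oplus> x') = tr x + tr x'"
    and z: "z \<in> bnd"
  shows "cochain (\<lambda>x y. tr (x \<otimes> y) - tr (y \<otimes> x)) z = 0"
proof (rule cochain_bnd[OF _ _ _ _ z])
  fix c x y assume *: "c \<in> K" "x \<in> carrier R" "y \<in> carrier R"
  then have c: "c \<in> carrier R"
    using K_carrier by auto
  have "x \<otimes> (c \<otimes> y) = c \<otimes> x \<otimes> y" "y \<otimes> (c \<otimes> x) = c \<otimes> y \<otimes> x"
    using * c K_central[OF *(1), of x] K_central[OF *(1), of y] m_assoc[of x c y] m_assoc[of y c x]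
    by simp_all
  then show "tr (c \<otimes> x \<otimes> y) - tr (y \<otimes> (c \<otimes> x)) = tr (x \<otimes> (c \<otimes> y)) - tr (c \<otimes> y \<otimes> x)"
    using * c by (simp add: m_assoc)
qed (simp_all add: l_distr r_distr add m_assoc)

section \<open>Degree zero and the construction of cycles\<close>

definition point :: "'a \<Rightarrow> 'a list \<Rightarrow>\<^sub>0 int" where
  "point x = frag_of [x, \<one>, \<one>]"

abbreviation rel0 where "rel0 \<equiv> generate (bar_free R 0) (bar_relators R K 0)"

lemma rel0_relator: "r \<in> bar_relators R K 0 \<Longrightarrow> r \<in> rel0"
  by (rule generate.incl)

lemma point_zero: "point \<zero> \<in> rel0"
proof -
  have "frag_of [\<zero>, \<one>, \<one>] - frag_of [\<zero>, \<one>, \<one>] - frag_of [\<zero>, \<one>, \<one>] \<in> rel0"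
    using bar_relators.additive[of "[\<zero>, \<one>, \<one>]" R 0 0 \<zero> \<zero> K]
    by (intro rel0_relator) (simp add: bar_generators_def)
  then show ?thesis
    using generate_free_uminus[OF bar_relators_carrier, of "- point \<zero>"] by (simp add: point_def)
qed

text \<open>In degree zero both outer factors can be absorbed into the bimodule entry, which turns
  the differential of x \<otimes> y into the commutator xy - yx.\<close>

lemma differential_chain:
  assumes "x \<in> carrier R" "y \<in> carrier R"
  shows "bar_differential R (Suc 0) (chain x y) - (point (x \<otimes> y) - point (y \<otimes> x)) \<in> rel0"
proof -
  have l: "frag_of [x \<otimes> y, \<one>, \<one>] - frag_of [x, y, \<one>] \<in> rel0"
    using bar_relators.left[of "[x, \<one>, \<one>]" R 0 y K] assms
    by (intro rel0_relator) (simp add: bar_generators_def)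
  have r: "frag_of [y \<otimes> x, \<one>, \<one>] - frag_of [x, \<one>, y] \<in> rel0"
    using bar_relators.right[of "[x, \<one>, \<one>]" R 0 y K] assms
    by (intro rel0_relator) (simp add: bar_generators_def eval_nat_numeral)
  show ?thesis
    using generate_free_diff[OF bar_relators_carrier r l] assms
    by (simp add: chain_def point_def bar_differential_1 algebra_simps)
qed

lemma chain_sum_cycle:
  assumes I: "finite I" and xy: "\<And>i. i \<in> I \<Longrightarrow> x i \<in> carrier R \<and> y i \<in> carrier R"
    and pt: "(\<Sum>i\<in>I. point (x i \<otimes> y i) - point (y i \<otimes> x i)) \<in> rel0"
  shows "(\<Sum>i\<in>I. chain (x i) (y i)) \<in> bar_cycles R K (Suc 0)"
proof -
  have c: "(\<Sum>i\<in>I. chain (x i) (y i)) \<in> carrier (bar_free R (Suc 0))"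
    using xy chain_carrier
    by (auto simp: carrier_free_Abelian_group_iff intro!: order_trans[OF keys_sum])
  have "(\<Sum>i\<in>I. bar_differential R (Suc 0) (chain (x i) (y i)) - (point (x i \<otimes> y i) - point (y i \<otimes> x i))) \<in> rel0"
    using xy by (intro generate_free_sum[OF bar_relators_carrier] differential_chain) auto
  then have "(\<Sum>i\<in>I. bar_differential R (Suc 0) (chain (x i) (y i))) \<in> rel0"
    using generate_free_add[OF bar_relators_carrier _ pt] by (fastforce simp: sum_subtractf)
  moreover have "bar_differential R (Suc 0) (\<Sum>i\<in>I. chain (x i) (y i)) = (\<Sum>i\<in>I. bar_differential R (Suc 0) (chain (x i) (y i)))"
    using I by (simp add: bar_differential_def frag_extend_sum)
  ultimately show ?thesis
    using c by (simp add: bar_cycles_def)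
qed

end

section \<open>Finitely supported functions\<close>

lemma poly_mapping_expansion: "f = (\<Sum>k\<in>Poly_Mapping.keys f. Poly_Mapping.single k (Poly_Mapping.lookup f k))"
  by (rule poly_mapping_eqI) (simp add: lookup_sum lookup_single when_def not_in_keys_iff_lookup_eq_zero)

text \<open>Reduces identities between additive functions to multiples of single basis elements. The
  supports stay inside \<open>S\<close> in the additive step, so closure under products and the
  ideal properties can be proved by the same induction.\<close>

lemma poly_mapping_single_induct [consumes 1, case_names zero single add]:
  fixes f :: "'x \<Rightarrow>\<^sub>0 'y::comm_monoid_add"
  assumes "Poly_Mapping.keys f \<subseteq> S"
    and "P 0" and "\<And>k c. k \<in> S \<Longrightarrow> P (Poly_Mapping.single k c)"
    and add: "\<And>f g. \<lbrakk>Poly_Mapping.keys f \<subseteq> S; Poly_Mapping.keys g \<subseteq> S; P f; P g\<rbrakk> \<Longrightarrow> P (f + g)"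
  shows "P f"
proof -
  have "P (\<Sum>k\<in>A. Poly_Mapping.single k (h k)) \<and> Poly_Mapping.keys (\<Sum>k\<in>A. Poly_Mapping.single k (h k)) \<subseteq> S"
    if "finite A" "A \<subseteq> S" for A h
    using that
  proof (induction A rule: finite_induct)
    case (insert k A)
    have "Poly_Mapping.keys (Poly_Mapping.single k (h k) + (\<Sum>k\<in>A. Poly_Mapping.single k (h k))) \<subseteq> S"
      using insert by (intro order_trans[OF Poly_Mapping.keys_add]) auto
    with insert show ?case
      by (simp add: add assms(3))
  qed (simp add: assms)
  then show ?thesis
    using assms(1) by (subst poly_mapping_expansion) auto
qed

text \<open>The coefficients are passed to \<open>S\<close> instead of being multiplied outside, so
  the product of the path algebra and the field-valued pairing \<open>psi\<close> are instances of
  one biadditive extension.\<close>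

definition bilin ::
  "('i \<Rightarrow> 'j \<Rightarrow> 'k \<Rightarrow> 'k \<Rightarrow> 'c) \<Rightarrow> ('i \<Rightarrow>\<^sub>0 'k::ab_group_add) \<Rightarrow> ('j \<Rightarrow>\<^sub>0 'k) \<Rightarrow> 'c::ab_group_add"
where
  "bilin S f g = (\<Sum>\<alpha>\<in>Poly_Mapping.keys f. \<Sum>\<beta>\<in>Poly_Mapping.keys g.
     S \<alpha> \<beta> (Poly_Mapping.lookup f \<alpha>) (Poly_Mapping.lookup g \<beta>))"

context
  fixes S :: "'i \<Rightarrow> 'j \<Rightarrow> 'k::ab_group_add \<Rightarrow> 'k \<Rightarrow> 'c::ab_group_add"
  assumes S_left: "\<And>\<alpha> \<beta> a a' b. S \<alpha> \<beta> (a + a') b = S \<alpha> \<beta> a b + S \<alpha> \<beta> a' b"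
    and S_right: "\<And>\<alpha> \<beta> a b b'. S \<alpha> \<beta> a (b + b') = S \<alpha> \<beta> a b + S \<alpha> \<beta> a b'"
begin

lemma S_zero: "S \<alpha> \<beta> 0 b = 0" "S \<alpha> \<beta> a 0 = 0"
  using S_left[of \<alpha> \<beta> 0 0 b] S_right[of \<alpha> \<beta> a 0 0] by simp_all

lemma bilin_superset:
  assumes "finite A" "Poly_Mapping.keys f \<subseteq> A" "finite B" "Poly_Mapping.keys g \<subseteq> B"
  shows "bilin S f g = (\<Sum>\<alpha>\<in>A. \<Sum>\<beta>\<in>B. S \<alpha> \<beta> (Poly_Mapping.lookup f \<alpha>) (Poly_Mapping.lookup g \<beta>))"
proof -
  have "bilin S f g = (\<Sum>\<alpha>\<in>Poly_Mapping.keys f. \<Sum>\<beta>\<in>B. S \<alpha> \<beta> (Poly_Mapping.lookup f \<alpha>) (Poly_Mapping.lookup g \<beta>))"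
    unfolding bilin_def using assms
    by (intro sum.cong sum.mono_neutral_left) (auto simp: in_keys_iff S_zero)
  also have "\<dots> = (\<Sum>\<alpha>\<in>A. \<Sum>\<beta>\<in>B. S \<alpha> \<beta> (Poly_Mapping.lookup f \<alpha>) (Poly_Mapping.lookup g \<beta>))"
    using assms by (intro sum.mono_neutral_left) (auto simp: in_keys_iff S_zero)
  finally show ?thesis .
qed

lemma bilin_add_left: "bilin S (f + f') g = bilin S f g + bilin S f' g"
proof -
  let ?A = "Poly_Mapping.keys f \<union> Poly_Mapping.keys f'"
  have "Poly_Mapping.keys (f + f') \<subseteq> ?A"
    by (rule Poly_Mapping.keys_add)
  then show ?thesis
    by (simp add: bilin_superset[of ?A _ "Poly_Mapping.keys g"] lookup_add S_left sum.distrib)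
qed

lemma bilin_add_right: "bilin S f (g + g') = bilin S f g + bilin S f g'"
proof -
  let ?A = "Poly_Mapping.keys g \<union> Poly_Mapping.keys g'"
  have "Poly_Mapping.keys (g + g') \<subseteq> ?A"
    by (rule Poly_Mapping.keys_add)
  then show ?thesis
    by (simp add: bilin_superset[of "Poly_Mapping.keys f" _ ?A] lookup_add S_right sum.distrib)
qed

lemma bilin_zero: "bilin S 0 g = 0" "bilin S f 0 = 0"
  by (simp_all add: bilin_def)

lemma bilin_single: "bilin S (Poly_Mapping.single \<alpha> a) (Poly_Mapping.single \<beta> b) = S \<alpha> \<beta> a b"
  by (simp add: bilin_superset[of "{\<alpha>}" _ "{\<beta>}"])

end

section \<open>The path algebra\<close>

declare split_paired_Ex [simp del] split_paired_All [simp del]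

locale monomial_quiver = fin_digraph Q for Q :: "('v, 'a) pre_digraph" +
  fixes Z :: "('v, 'a) qpath set"
  assumes relations: "monomial_relations Q Z"
begin

lemma paths_iff: "(u, p) \<in> paths Q \<longleftrightarrow> u \<in> verts Q \<and> set p \<subseteq> arcs Q \<and> cas u p (awlast u p)"
  by (auto simp: paths_def awalk_def awlast_if_cas)

lemma psource_verts: "\<gamma> \<in> paths Q \<Longrightarrow> psource \<gamma> \<in> verts Q"
  by (cases \<gamma>) (simp add: paths_iff psource_def)

lemma ptarget_verts: "\<gamma> \<in> paths Q \<Longrightarrow> ptarget Q \<gamma> \<in> verts Q"
  by (cases \<gamma>) (auto simp: paths_iff ptarget_def intro: awlast_in_verts)

lemma vertex_path: "(v, []) \<in> paths Q \<longleftrightarrow> v \<in> verts Q"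
  by (simp add: paths_iff)

lemma psource_pcomp [simp]: "psource (pcomp \<alpha> \<beta>) = psource \<beta>"
  by (simp add: psource_def pcomp_def)

lemma ptarget_pcomp: "composable Q \<alpha> \<beta> \<Longrightarrow> ptarget Q (pcomp \<alpha> \<beta>) = ptarget Q \<alpha>"
  by (simp add: composable_def ptarget_def pcomp_def psource_def awlast_append)

lemma pcomp_paths:
  assumes "\<alpha> \<in> paths Q" "\<beta> \<in> paths Q" "composable Q \<alpha> \<beta>"
  shows "pcomp \<alpha> \<beta> \<in> paths Q"
  using assms
  by (cases \<alpha>; cases \<beta>) (auto simp: paths_iff composable_def ptarget_def psource_def pcomp_def awlast_append)

lemma pcomp_assoc: "pcomp (pcomp \<alpha> \<beta>) \<gamma> = pcomp \<alpha> (pcomp \<beta> \<gamma>)"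
  by (simp add: pcomp_def)

lemma composable_pcomp_left [simp]: "composable Q (pcomp \<alpha> \<beta>) \<gamma> \<longleftrightarrow> composable Q \<beta> \<gamma>"
  by (simp add: composable_def)

lemma composable_pcomp_right:
  "composable Q \<beta> \<gamma> \<Longrightarrow> composable Q \<alpha> (pcomp \<beta> \<gamma>) \<longleftrightarrow> composable Q \<alpha> \<beta>"
  by (simp add: composable_def ptarget_pcomp[unfolded composable_def])

lemma pcomp_vertex: "pcomp (v, []) \<gamma> = \<gamma>" "psource \<gamma> = v \<Longrightarrow> pcomp \<gamma> (v, []) = \<gamma>"
  by (auto simp: pcomp_def psource_def)

lemma composable_vertex:
  "composable Q (v, []) \<gamma> \<longleftrightarrow> ptarget Q \<gamma> = v" "composable Q \<gamma> (v, []) \<longleftrightarrow> psource \<gamma> = v"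
  by (auto simp: composable_def psource_def ptarget_def)

abbreviation PA :: "(('v, 'a) qpath \<Rightarrow>\<^sub>0 'k::field) ring" where
  "PA \<equiv> path_algebra Q"

abbreviation sg :: "('v, 'a) qpath \<Rightarrow> 'k \<Rightarrow> ('v, 'a) qpath \<Rightarrow>\<^sub>0 'k::field" where
  "sg \<equiv> Poly_Mapping.single"

definition pmul :: "(('v, 'a) qpath \<Rightarrow>\<^sub>0 'k) \<Rightarrow> (('v, 'a) qpath \<Rightarrow>\<^sub>0 'k) \<Rightarrow> (('v, 'a) qpath \<Rightarrow>\<^sub>0 'k::field)" where
  "pmul = bilin (\<lambda>\<alpha> \<beta> a b. if composable Q \<alpha> \<beta> then sg (pcomp \<alpha> \<beta>) (a * b) else 0)"

lemma PA_simps: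
  "carrier PA = {f. Poly_Mapping.keys f \<subseteq> paths Q}" "monoid.mult PA = pmul"
  "monoid.one PA = scalar Q 1" "ring.zero PA = 0" "ring.add PA = (+)"
  by (auto simp: path_algebra_def pmul_def bilin_def fun_eq_iff)

lemma
  fixes f g h :: "('v, 'a) qpath \<Rightarrow>\<^sub>0 'k::field"
  shows pmul_add_left: "pmul (f + g) h = pmul f h + pmul g h"
    and pmul_add_right: "pmul f (g + h) = pmul f g + pmul f h"
    and pmul_zero_left: "pmul 0 h = 0"
    and pmul_zero_right: "pmul h 0 = 0"
    and pmul_single: "pmul (sg \<alpha> a) (sg \<beta> b) = (if composable Q \<alpha> \<beta> then sg (pcomp \<alpha> \<beta>) (a * b) else (0 :: _ \<Rightarrow>\<^sub>0 'k))"
  unfolding pmul_def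
  by (simp_all add: bilin_add_left bilin_add_right bilin_zero bilin_single distrib_left distrib_right single_add)

lemma pmul_sum_left: "pmul (\<Sum>i\<in>I. f i) h = (\<Sum>i\<in>I. pmul (f i) h)"
  by (induction I rule: infinite_finite_induct) (auto simp: pmul_zero_left pmul_add_left)

lemma pmul_sum_right: "pmul h (\<Sum>i\<in>I. f i) = (\<Sum>i\<in>I. pmul h (f i))"
  by (induction I rule: infinite_finite_induct) (auto simp: pmul_zero_right pmul_add_right)

lemma pmul_closed:
  assumes "Poly_Mapping.keys f \<subseteq> paths Q" "Poly_Mapping.keys g \<subseteq> paths Q"
  shows "Poly_Mapping.keys (pmul f g) \<subseteq> paths Q"
  using assms(1)
proof (induction f rule: poly_mapping_single_induct)
  case (single \<alpha> a)
  show ?case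
    using assms(2)
  proof (induction g rule: poly_mapping_single_induct)
    case (single \<beta> b)
    with \<open>\<alpha> \<in> paths Q\<close> show ?case
      by (auto simp: pmul_single pcomp_paths split: if_splits)
  next
    case (add f g)
    then show ?case
      using Poly_Mapping.keys_add[of "pmul (sg \<alpha> a) f" "pmul (sg \<alpha> a) g"] by (auto simp: pmul_add_right)
  qed (simp add: pmul_zero_right)
next
  case (add f f')
  then show ?case
    using Poly_Mapping.keys_add[of "pmul f g" "pmul f' g"] by (auto simp: pmul_add_left)
qed (simp add: pmul_zero_left)

lemma pmul_assoc: "pmul (pmul f g) h = pmul f (pmul g h)"
proof -
  have "Poly_Mapping.keys f \<subseteq> UNIV" by simp
  then show ?thesis
  proof (induction f rule: poly_mapping_single_induct)
    case (single \<alpha> a)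
    have "Poly_Mapping.keys g \<subseteq> UNIV" by simp
    then show ?case
    proof (induction g rule: poly_mapping_single_induct)
      case (single \<beta> b)
      have "Poly_Mapping.keys h \<subseteq> UNIV" by simp
      then show ?case
      proof (induction h rule: poly_mapping_single_induct)
        case (single \<gamma> c)
        then show ?case
          by (simp add: pmul_single pmul_zero_left pmul_zero_right composable_pcomp_right pcomp_assoc mult.assoc)
      qed (simp_all add: pmul_zero_right pmul_add_right)
    qed (simp_all add: pmul_zero_left pmul_zero_right pmul_add_right pmul_add_left)
  qed (simp_all add: pmul_zero_left pmul_add_left)
qed

lemma scalar_closed: "Poly_Mapping.keys (scalar Q c) \<subseteq> paths Q"
  unfolding scalar_def by (rule order_trans[OF keys_sum]) (auto simp: vertex_path)

text \<open>A scalar is spread over all vertex idempotents; only the one at the terminal vertex (on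
  the left) or at the source (on the right) composes with the path.\<close>

lemma scalar_single:
  assumes "\<gamma> \<in> paths Q"
  shows "pmul (scalar Q c) (sg \<gamma> b) = sg \<gamma> (c * b)" "pmul (sg \<gamma> b) (scalar Q c) = sg \<gamma> (c * b)"
proof -
  have "pmul (scalar Q c) (sg \<gamma> b) = (\<Sum>v\<in>verts Q. if ptarget Q \<gamma> = v then sg \<gamma> (c * b) else 0)"
    by (simp add: scalar_def pmul_sum_left pmul_single composable_vertex pcomp_vertex cong: if_cong)
  then show "pmul (scalar Q c) (sg \<gamma> b) = sg \<gamma> (c * b)"
    using assms by (simp add: ptarget_verts)
  have "pmul (sg \<gamma> b) (scalar Q c) = (\<Sum>v\<in>verts Q. if psource \<gamma> = v then sg \<gamma> (c * b) else 0)"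
    by (auto simp: scalar_def pmul_sum_right pmul_single composable_vertex pcomp_vertex mult.commute intro!: sum.cong)
  then show "pmul (sg \<gamma> b) (scalar Q c) = sg \<gamma> (c * b)"
    using assms by (simp add: psource_verts)
qed

lemma scalar_central:
  assumes "Poly_Mapping.keys f \<subseteq> paths Q"
  shows "pmul (scalar Q c) f = pmul f (scalar Q c)"
  using assms
  by (induction f rule: poly_mapping_single_induct)
     (simp_all add: pmul_zero_left pmul_zero_right pmul_add_left pmul_add_right scalar_single)

lemma scalar_one:
  assumes "Poly_Mapping.keys f \<subseteq> paths Q"
  shows "pmul (scalar Q 1) f = f"
  using assms
  by (induction f rule: poly_mapping_single_induct)
     (simp_all add: pmul_zero_right pmul_add_right scalar_single)

lemma PA_ring: "ring (PA :: (('v, 'a) qpath \<Rightarrow>\<^sub>0 'k::field) ring)"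
proof (rule ringI)
  show "abelian_group (PA :: (('v, 'a) qpath \<Rightarrow>\<^sub>0 'k) ring)"
  proof (rule abelian_groupI)
    fix f g :: "('v, 'a) qpath \<Rightarrow>\<^sub>0 'k"
    assume "f \<in> carrier PA" "g \<in> carrier PA"
    then show "f \<oplus>\<^bsub>PA\<^esub> g \<in> carrier PA"
      using Poly_Mapping.keys_add[of f g] by (auto simp: PA_simps)
  next
    fix f :: "('v, 'a) qpath \<Rightarrow>\<^sub>0 'k"
    assume "f \<in> carrier PA"
    then show "\<exists>y\<in>carrier PA. y \<oplus>\<^bsub>PA\<^esub> f = \<zero>\<^bsub>PA\<^esub>"
      by (intro bexI[of _ "- f"]) (auto simp: PA_simps)
  qed (auto simp: PA_simps add_ac)
  show "Group.monoid (PA :: (('v, 'a) qpath \<Rightarrow>\<^sub>0 'k) ring)"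
    by (rule monoidI)
       (simp_all add: PA_simps pmul_closed scalar_closed pmul_assoc scalar_one flip: scalar_central)
qed (auto simp: PA_simps pmul_add_left pmul_add_right)

section \<open>The monomial quotient\<close>

lemma Z_paths: "\<zeta> \<in> Z \<Longrightarrow> \<zeta> \<in> paths Q"
  using relations by (auto simp: monomial_relations_def)

lemma Z_length: "\<zeta> \<in> Z \<Longrightarrow> length (snd \<zeta>) \<ge> 2"
  using relations by (auto simp: monomial_relations_def plength_def)

lemma occurrence_paths: "occurrence Q \<delta> \<zeta> \<epsilon> \<gamma> \<Longrightarrow> \<gamma> \<in> paths Q"
  by (simp add: occurrence_def pcomp_paths composable_pcomp_right)

lemma zero_path_iff:
  "zero_path Q Z \<gamma> \<longleftrightarrow> (\<exists>\<delta> \<zeta> \<epsilon>. \<zeta> \<in> Z \<and> occurrence Q \<delta> \<zeta> \<epsilon> \<gamma>)"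
  unfolding zero_path_def subpath_def using occurrence_paths by blast

lemma zero_path_self: "\<zeta> \<in> Z \<Longrightarrow> zero_path Q Z \<zeta>"
proof -
  assume "\<zeta> \<in> Z"
  then have "occurrence Q (ptarget Q \<zeta>, []) \<zeta> (psource \<zeta>, []) \<zeta>"
    using Z_paths[of \<zeta>]
    by (auto simp: occurrence_def vertex_path composable_vertex ptarget_verts psource_verts pcomp_vertex)
  with \<open>\<zeta> \<in> Z\<close> show ?thesis
    unfolding zero_path_iff by blast
qed

lemma zero_path_pcomp_left:
  assumes "zero_path Q Z \<alpha>" "\<beta> \<in> paths Q" "composable Q \<alpha> \<beta>"
  shows "zero_path Q Z (pcomp \<alpha> \<beta>)"
proof -
  obtain \<delta> \<zeta> \<epsilon> where z: "\<zeta> \<in> Z" "occurrence Q \<delta> \<zeta> \<epsilon> \<alpha>"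
    using assms(1) by (auto simp: zero_path_iff)
  then have "occurrence Q \<delta> \<zeta> (pcomp \<epsilon> \<beta>) (pcomp \<alpha> \<beta>)"
    using assms(2,3)
    by (auto simp: occurrence_def pcomp_assoc composable_pcomp_right intro: pcomp_paths)
  with z show ?thesis
    unfolding zero_path_iff by blast
qed

lemma zero_path_pcomp_right:
  assumes "zero_path Q Z \<beta>" "\<alpha> \<in> paths Q" "composable Q \<alpha> \<beta>"
  shows "zero_path Q Z (pcomp \<alpha> \<beta>)"
proof -
  obtain \<delta> \<zeta> \<epsilon> where z: "\<zeta> \<in> Z" "occurrence Q \<delta> \<zeta> \<epsilon> \<beta>"
    using assms(1) by (auto simp: zero_path_iff)
  then have "occurrence Q (pcomp \<alpha> \<delta>) \<zeta> \<epsilon> (pcomp \<alpha> \<beta>)"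
    using assms(2,3)
    by (auto simp: occurrence_def pcomp_assoc composable_pcomp_right intro: pcomp_paths)
  with z show ?thesis
    unfolding zero_path_iff by blast
qed

text \<open>The ideal generated by the relations, described by supports;
  \<open>monomial_ideal_eq\<close> justifies this. It makes equality in the quotient a statement
  about coefficients of nonzero paths.\<close>

definition J :: "(('v, 'a) qpath \<Rightarrow>\<^sub>0 'k::field) set" where
  "J = {f. Poly_Mapping.keys f \<subseteq> {\<gamma>. zero_path Q Z \<gamma>}}"

lemma J_paths: "f \<in> J \<Longrightarrow> Poly_Mapping.keys f \<subseteq> paths Q"
  by (auto simp: J_def zero_path_def)

lemma J_zero: "0 \<in> J"
  by (simp add: J_def)

lemma J_add: "f \<in> J \<Longrightarrow> g \<in> J \<Longrightarrow> f + g \<in> J"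
  using Poly_Mapping.keys_add[of f g] by (auto simp: J_def)

lemma J_uminus: "f \<in> J \<Longrightarrow> - f \<in> J"
  by (auto simp: J_def)

lemma J_diff: "f \<in> J \<Longrightarrow> g \<in> J \<Longrightarrow> f - g \<in> J"
  using J_add[of f "- g"] J_uminus[of g] by simp

lemma J_single: "zero_path Q Z \<gamma> \<Longrightarrow> sg \<gamma> c \<in> J"
  by (auto simp: J_def split: if_splits)

lemma J_pmul_left:
  assumes "f \<in> J" "Poly_Mapping.keys g \<subseteq> paths Q"
  shows "pmul f g \<in> J" "pmul g f \<in> J"
proof -
  have "Poly_Mapping.keys f \<subseteq> {\<gamma>. zero_path Q Z \<gamma>}"
    using assms(1) by (simp add: J_def)
  then have "pmul f g \<in> J \<and> pmul g f \<in> J"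
  proof (induction f rule: poly_mapping_single_induct)
    case (single \<alpha> a)
    show ?case
      using assms(2)
    proof (induction g rule: poly_mapping_single_induct)
      case (single \<beta> b)
      with \<open>\<alpha> \<in> {\<gamma>. zero_path Q Z \<gamma>}\<close> show ?case
        by (auto simp: pmul_single J_zero intro: J_single zero_path_pcomp_left zero_path_pcomp_right)
    qed (auto simp: pmul_zero_left pmul_zero_right pmul_add_left pmul_add_right J_zero intro: J_add)
  qed (auto simp: pmul_zero_left pmul_zero_right pmul_add_left pmul_add_right J_zero intro: J_add)
  then show "pmul f g \<in> J" "pmul g f \<in> J"
    by auto
qed

lemma J_ideal: "ideal (J :: (('v, 'a) qpath \<Rightarrow>\<^sub>0 'k::field) set) PA"
proof (rule idealI[OF PA_ring])
  interpret ring "PA :: (('v, 'a) qpath \<Rightarrow>\<^sub>0 'k) ring" by (rule PA_ring)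
  show "subgroup (J :: (('v, 'a) qpath \<Rightarrow>\<^sub>0 'k) set) (add_monoid PA)"
  proof (rule group.subgroupI[OF a_group])
    fix f :: "('v, 'a) qpath \<Rightarrow>\<^sub>0 'k" assume f: "f \<in> J"
    then have "inv\<^bsub>add_monoid PA\<^esub> f = - f"
      using J_paths[OF f] by (intro group.inv_equality[OF a_group]) (auto simp: PA_simps)
    with f show "inv\<^bsub>add_monoid PA\<^esub> f \<in> J"
      by (simp add: J_uminus)
  qed (use J_zero in \<open>auto simp: PA_simps J_add dest!: J_paths\<close>)
qed (auto simp: PA_simps J_pmul_left)

text \<open>Elements supported on zero paths form an ideal containing the generators, which gives
  one inclusion by minimality. Conversely a zero path factors as \<delta>\<zeta>\<epsilon> with
  \<zeta> a relation, so each of its multiples is a two-sided multiple of a generator.\<close>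

lemma monomial_ideal_eq: "(monomial_ideal Q Z :: (('v, 'a) qpath \<Rightarrow>\<^sub>0 'k::field) set) = J"
proof
  interpret R: ring "PA :: (('v, 'a) qpath \<Rightarrow>\<^sub>0 'k) ring" by (rule PA_ring)
  let ?G = "(\<lambda>\<zeta>. sg \<zeta> 1) ` Z :: (('v, 'a) qpath \<Rightarrow>\<^sub>0 'k) set"
  have G: "?G \<subseteq> carrier PA"
    by (auto simp: PA_simps Z_paths)
  interpret I: ideal "monomial_ideal Q Z" "PA :: (('v, 'a) qpath \<Rightarrow>\<^sub>0 'k) ring"
    unfolding monomial_ideal_def by (rule R.genideal_ideal[OF G])
  show "(monomial_ideal Q Z :: (('v, 'a) qpath \<Rightarrow>\<^sub>0 'k) set) \<subseteq> J"
    unfolding monomial_ideal_def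
    by (rule R.genideal_minimal[OF J_ideal]) (auto intro: J_single zero_path_self)
  show "J \<subseteq> (monomial_ideal Q Z :: (('v, 'a) qpath \<Rightarrow>\<^sub>0 'k) set)"
  proof
    fix f :: "('v, 'a) qpath \<Rightarrow>\<^sub>0 'k"
    assume "f \<in> J"
    then have "Poly_Mapping.keys f \<subseteq> {\<gamma>. zero_path Q Z \<gamma>}"
      by (simp add: J_def)
    then show "f \<in> monomial_ideal Q Z"
    proof (induction f rule: poly_mapping_single_induct)
      case zero
      then show ?case
        using I.zero_closed by (simp add: PA_simps)
    next
      case (single \<gamma> c)
      then obtain \<delta> \<zeta> \<epsilon> where z: "\<zeta> \<in> Z" "occurrence Q \<delta> \<zeta> \<epsilon> \<gamma>"
        by (auto simp: zero_path_iff)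
      have "sg \<zeta> (1 :: 'k) \<in> monomial_ideal Q Z"
        unfolding monomial_ideal_def by (rule subsetD[OF R.genideal_self[OF G]]) (rule imageI[OF z(1)])
      moreover have cl: "sg \<delta> c \<in> carrier PA" "sg \<epsilon> (1 :: 'k) \<in> carrier PA"
        using z(2) by (simp_all add: PA_simps occurrence_def)
      ultimately have "pmul (sg \<delta> c) (pmul (sg \<zeta> 1) (sg \<epsilon> 1)) \<in> monomial_ideal Q Z"
        using I.I_l_closed[OF I.I_r_closed[OF _ cl(2)] cl(1)] by (simp only: PA_simps)
      moreover have "pmul (sg \<delta> c) (pmul (sg \<zeta> 1) (sg \<epsilon> 1)) = sg \<gamma> c"
        using z by (auto simp: pmul_single occurrence_def composable_pcomp_right)
      ultimately show ?case
        by simp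
    next
      case (add f g)
      then show ?case
        using I.a_closed[of f g] by (simp add: PA_simps)
    qed
  qed
qed

section \<open>Classes and representatives in the quotient algebra\<close>

abbreviation MA :: "(('v, 'a) qpath \<Rightarrow>\<^sub>0 'k::field) set ring" where
  "MA \<equiv> monomial_algebra Q Z"

definition cls :: "(('v, 'a) qpath \<Rightarrow>\<^sub>0 'k::field) \<Rightarrow> (('v, 'a) qpath \<Rightarrow>\<^sub>0 'k) set" where
  "cls f = J +>\<^bsub>PA\<^esub> f"

lemma cls_eq: "cls f = (\<lambda>h. h + f) ` J"
  by (auto simp: cls_def a_r_coset_def' PA_simps)

lemma cls_eq_iff: "cls f = cls g \<longleftrightarrow> f - g \<in> J"
proof
  assume "cls f = cls g"
  moreover have "f \<in> cls f"
    using J_zero by (force simp: cls_eq)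
  ultimately show "f - g \<in> J"
    by (auto simp: cls_eq)
next
  assume fg: "f - g \<in> J"
  have "h + f \<in> cls g" "h + g \<in> cls f" if "h \<in> J" for h
    using image_eqI[OF _ J_add[OF that fg], of "h + f" "\<lambda>x. x + g"]
      image_eqI[OF _ J_diff[OF that fg], of "h + g" "\<lambda>x. x + f"]
    by (simp_all add: cls_eq)
  then show "cls f = cls g"
    by (auto simp: cls_eq[of f]  cls_eq[of g])
qed

lemma MA_ring: "ring MA"
  unfolding monomial_algebra_def monomial_ideal_eq using J_ideal by (rule ideal.quotient_is_ring)

lemma cls_hom: "(cls :: (('v, 'a) qpath \<Rightarrow>\<^sub>0 'k::field) \<Rightarrow> _) \<in> ring_hom PA MA"
proof -
  have "(cls :: (('v, 'a) qpath \<Rightarrow>\<^sub>0 'k) \<Rightarrow> _) = (+>\<^bsub>PA\<^esub>) J"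
    by (simp add: cls_def fun_eq_iff)
  then show ?thesis
    unfolding monomial_algebra_def monomial_ideal_eq using ideal.rcos_ring_hom[OF J_ideal] by (simp only:)
qed

lemma
  fixes f g :: "('v, 'a) qpath \<Rightarrow>\<^sub>0 'k::field"
  assumes "Poly_Mapping.keys f \<subseteq> paths Q"
  shows cls_closed: "cls f \<in> carrier MA"
    and cls_add: "Poly_Mapping.keys g \<subseteq> paths Q \<Longrightarrow> cls (f + g) = cls f \<oplus>\<^bsub>MA\<^esub> cls g"
    and cls_mult: "Poly_Mapping.keys g \<subseteq> paths Q \<Longrightarrow> cls (pmul f g) = cls f \<otimes>\<^bsub>MA\<^esub> cls g"
  using cls_hom assms
    ring_hom_closed[OF cls_hom, of f] ring_hom_add[OF cls_hom, of f g] ring_hom_mult[OF cls_hom, of f g]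
  by (auto simp: PA_simps)

lemma cls_zero: "cls 0 = \<zero>\<^bsub>MA\<^esub>"
  unfolding monomial_algebra_def monomial_ideal_eq FactRing_def
  by (auto simp: cls_eq)

lemma MA_carrierE:
  assumes "X \<in> carrier (MA :: (('v, 'a) qpath \<Rightarrow>\<^sub>0 'k::field) set ring)"
  obtains f where "X = cls f" "Poly_Mapping.keys f \<subseteq> paths Q"
  using assms unfolding monomial_algebra_def monomial_ideal_eq
  by (auto simp: FactRing_def A_RCOSETS_def' cls_def PA_simps)

definition rep :: "(('v, 'a) qpath \<Rightarrow>\<^sub>0 'k::field) set \<Rightarrow> (('v, 'a) qpath \<Rightarrow>\<^sub>0 'k)" where
  "rep X = (SOME f. Poly_Mapping.keys f \<subseteq> paths Q \<and> X = cls f)"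

lemma rep:
  assumes "X \<in> carrier (MA :: (('v, 'a) qpath \<Rightarrow>\<^sub>0 'k::field) set ring)"
  shows "Poly_Mapping.keys (rep X) \<subseteq> paths Q" "cls (rep X) = X"
proof -
  have "Poly_Mapping.keys (rep X) \<subseteq> paths Q \<and> X = cls (rep X)"
    unfolding rep_def by (rule someI_ex) (use assms in \<open>auto elim: MA_carrierE\<close>)
  then show "Poly_Mapping.keys (rep X) \<subseteq> paths Q" "cls (rep X) = X"
    by auto
qed

lemma rep_cls:
  assumes "Poly_Mapping.keys f \<subseteq> paths Q"
  shows "rep (cls f) - f \<in> J"
  using rep(2)[OF cls_closed[OF assms]] by (simp add: cls_eq_iff)

lemma base_field_eq: "base_field Q Z = range (\<lambda>c. cls (scalar Q c))"
  by (simp add: base_field_def monomial_ideal_eq cls_def)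

lemma central_pair_MA:
  "central_pair (MA :: (('v, 'a) qpath \<Rightarrow>\<^sub>0 'k::field) set ring) (base_field Q Z)"
proof (intro central_pair.intro central_pair_axioms.intro MA_ring)
  show "base_field Q Z \<subseteq> carrier (MA :: (('v, 'a) qpath \<Rightarrow>\<^sub>0 'k) set ring)"
    by (auto simp: base_field_eq intro!: cls_closed subsetD[OF scalar_closed])
  fix c x :: "(('v, 'a) qpath \<Rightarrow>\<^sub>0 'k) set"
  assume "c \<in> base_field Q Z" "x \<in> carrier MA"
  then show "c \<otimes>\<^bsub>MA\<^esub> x = x \<otimes>\<^bsub>MA\<^esub> c"
    by (auto simp: base_field_eq scalar_closed scalar_central simp flip: cls_mult elim!: MA_carrierE)
qed

end

section \<open>Rotations of a word\<close>

text \<open>Being a set, it forgets multiplicities: for a proper power, several indices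
  \<open>i\<close> give the same word. Sums over indices and sums over this set must therefore be
  kept apart.\<close>

definition rotations :: "'x list \<Rightarrow> 'x list set" where
  "rotations p = range (\<lambda>i. rotate i p)"

lemma rotations_self: "p \<in> rotations p"
  unfolding rotations_def by (rule range_eqI[of _ _ 0]) simp

lemma rotations_rotate: "r \<in> rotations p \<Longrightarrow> rotate i r \<in> rotations p"
  by (auto simp: rotations_def rotate_rotate)

lemma rotations_rotate1: "r \<in> rotations p \<Longrightarrow> rotate1 r \<in> rotations p"
  using rotations_rotate[of r p 1] by simp

lemma rotate_cancel: "i < length p \<Longrightarrow> rotate (length p - i) (rotate i p) = p"
  by (simp add: rotate_rotate)

lemma rotations_sym:
  assumes "r \<in> rotations p"
  shows "p \<in> rotations r"
proof (cases "p = []")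
  case True
  then show ?thesis
    using assms rotations_self by (auto simp: rotations_def)
next
  case False
  obtain i where i: "r = rotate i p"
    using assms by (auto simp: rotations_def)
  have "rotate (length p - i mod length p) r = p"
    using rotate_cancel[of "i mod length p" p] False by (simp add: i flip: rotate_conv_mod[of i p])
  then show ?thesis
    unfolding rotations_def by (intro range_eqI[of _ _ "length p - i mod length p"]) simp
qed

lemma rotations_trans: "r \<in> rotations p \<Longrightarrow> s \<in> rotations r \<Longrightarrow> s \<in> rotations p"
  by (auto simp: rotations_def rotate_rotate)

lemma rotations_eq: "r \<in> rotations p \<Longrightarrow> rotations r = rotations p"
  using rotations_trans rotations_sym by blast

lemma rotations_length: "r \<in> rotations p \<Longrightarrow> length r = length p"
  by (auto simp: rotations_def)

lemma rotations_finite: "finite (rotations p)"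
proof (cases "p = []")
  case False
  have "rotations p \<subseteq> (\<lambda>i. rotate i p) ` {..<length p}"
  proof
    fix r assume "r \<in> rotations p"
    then obtain i where "r = rotate (i mod length p) p"
      unfolding rotations_def using rotate_conv_mod[of _ p] by blast
    then show "r \<in> (\<lambda>i. rotate i p) ` {..<length p}"
      using False by auto
  qed
  then show ?thesis
    by (rule finite_subset) simp
qed (simp add: rotations_def)

lemma rotate_bij:
  "bij_betw (rotate i) (rotations p) (rotations p)"
proof -
  have "inj_on (rotate i) (rotations p)"
  proof
    fix r s assume *: "r \<in> rotations p" "s \<in> rotations p" "rotate i r = rotate i s"
    then have "length r = length s"
      by (simp add: rotations_length)
    moreover have "rotate (length r - i mod length r) (rotate i q) = q" if "length q = length r" for q
    proof (cases "q = []")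
      case False
      have "rotate i q = rotate (i mod length r) q"
        using rotate_conv_mod[of i q] that by simp
      moreover have "0 < length r"
        using that False by (metis length_greater_0_conv)
      ultimately show ?thesis
        using rotate_cancel[of "i mod length r" q] that by simp
    qed simp
    ultimately show "r = s"
      using *(3) by metis
  qed
  moreover have "rotate i ` rotations p \<subseteq> rotations p"
    by (auto simp: rotations_rotate)
  ultimately show ?thesis
    by (simp add: bij_betw_def endo_inj_surj rotations_finite)
qed

lemma rotate1_bij: "bij_betw rotate1 (rotations p) (rotations p)"
  using rotate_bij[of 1 p] by (simp add: rotate_def)

lemma sum_rotate:
  fixes g :: "'x list \<Rightarrow> 'b::comm_monoid_add"
  assumes "r \<in> rotations p"
  shows "(\<Sum>i<length p. g (rotate i r)) = (\<Sum>i<length p. g (rotate i p))"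
proof -
  have step: "(\<Sum>i<length s. g (rotate i (rotate1 s))) = (\<Sum>i<length s. g (rotate i s))" for s
  proof (cases "length s")
    case (Suc m)
    have "(\<Sum>i<Suc m. g (rotate i (rotate1 s))) = (\<Sum>i<m. g (rotate (Suc i) s)) + g (rotate (Suc m) s)"
      by (simp add: rotate1_rotate_swap)
    also have "rotate (Suc m) s = rotate 0 s"
      using rotate_length01 rotate_id[of "Suc m" s] Suc by simp
    also have "(\<Sum>i<m. g (rotate (Suc i) s)) + g (rotate 0 s) = (\<Sum>i<Suc m. g (rotate i s))"
      unfolding sum.lessThan_Suc_shift by (simp add: add.commute)
    finally show ?thesis
      using Suc by simp
  qed simp
  obtain j where "r = rotate j p"
    using assms by (auto simp: rotations_def)
  moreover have "(\<Sum>i<length p. g (rotate i (rotate j p))) = (\<Sum>i<length p. g (rotate i p))"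
  proof (induction j)
    case (Suc j)
    then show ?case
      using step[of "rotate j p"] by simp
  qed simp
  ultimately show ?thesis
    by simp
qed

text \<open>Double counting: for each fixed \<open>i\<close>, rotation by \<open>i\<close> permutes
  the orbit, and for each word of the orbit the sum over all \<open>i\<close> is the same. It
  relates the sum over positions to the sum over distinct rotations in any commutative monoid, where
  one cannot divide by the multiplicity.\<close>

lemma sum_rotations:
  fixes g :: "'x list \<Rightarrow> 'b::comm_monoid_add"
  assumes "r \<in> rotations p"
  shows "(\<Sum>i<length p. \<Sum>s\<in>rotations p. g s) = (\<Sum>s\<in>rotations p. \<Sum>i<length p. g (rotate i r))"
proof -
  have "(\<Sum>i<length p. \<Sum>s\<in>rotations p. g s) = (\<Sum>i<length p. \<Sum>s\<in>rotations p. g (rotate i s))"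
    by (intro sum.cong sum.reindex_bij_betw[symmetric] rotate_bij) simp
  also have "\<dots> = (\<Sum>s\<in>rotations p. \<Sum>i<length p. g (rotate i s))"
    by (rule sum.swap)
  also have "\<dots> = (\<Sum>s\<in>rotations p. \<Sum>i<length p. g (rotate i r))"
    by (rule sum.cong[OF refl]) (rule trans[OF sum_rotate sum_rotate[OF assms, symmetric]])
  finally show ?thesis .
qed

section \<open>Circuits and zero relations as words\<close>

context monomial_quiver
begin

text \<open>A nontrivial cycle is determined by its word, since its source is the tail of the first
  arrow. The combinatorics can thus be done on lists; \<open>lp\<close> restores the vertex.\<close>

definition cyclic_word :: "'a list \<Rightarrow> bool" where
  "cyclic_word p \<longleftrightarrow> p \<noteq> [] \<and> set p \<subseteq> arcs Q \<and> cas (tail Q (hd p)) p (tail Q (hd p))"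

definition lp :: "'a list \<Rightarrow> ('v, 'a) qpath" where
  "lp p = (tail Q (hd p), p)"

lemma snd_lp [simp]: "snd (lp p) = p"
  by (simp add: lp_def)

lemma lp_eq_iff [simp]: "lp p = lp q \<longleftrightarrow> p = q"
  by (auto simp: lp_def)

lemma closed_Cons: "cyclic_word (a # q) \<longleftrightarrow> a \<in> arcs Q \<and> set q \<subseteq> arcs Q \<and> cas (head Q a) q (tail Q a)"
  by (auto simp: cyclic_word_def)

lemma lp_rotate1:
  assumes "cyclic_word (a # q)"
  shows "lp (q @ [a]) = (head Q a, q @ [a])"
  using assms by (cases q) (auto simp: closed_Cons lp_def)

lemma closed_rotate1:
  assumes "cyclic_word p"
  shows "cyclic_word (rotate1 p)"
proof -
  obtain a q where p: "p = a # q"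
    using assms by (cases p) (auto simp: cyclic_word_def)
  have c: "a \<in> arcs Q" "set q \<subseteq> arcs Q" "cas (head Q a) q (tail Q a)"
    using assms by (auto simp: p closed_Cons)
  have "tail Q (hd (q @ [a])) = head Q a"
    using lp_rotate1[of a q] assms by (simp add: p lp_def)
  then show ?thesis
    using c awlast_if_cas[OF c(3)] by (simp add: p cyclic_word_def)
qed

lemma closed_rotate: "cyclic_word p \<Longrightarrow> cyclic_word (rotate i p)"
  by (induction i) (auto simp: closed_rotate1)

lemma closed_rotations: "cyclic_word p \<Longrightarrow> r \<in> rotations p \<Longrightarrow> cyclic_word r"
  by (auto simp: rotations_def closed_rotate)

lemma closed_path: "cyclic_word p \<Longrightarrow> lp p \<in> paths Q"
  unfolding lp_def paths_iff using awlast_if_cas[of "tail Q (hd p)" p "tail Q (hd p)"]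
  by (cases p) (auto simp: cyclic_word_def)

lemma cycles_iff: "\<gamma> \<in> cycles Q \<longleftrightarrow> (snd \<gamma> = [] \<and> fst \<gamma> \<in> verts Q) \<or> (cyclic_word (snd \<gamma>) \<and> \<gamma> = lp (snd \<gamma>))"
proof -
  obtain u p where \<gamma>: "\<gamma> = (u, p)"
    by (cases \<gamma>)
  show ?thesis
  proof (cases p)
    case Nil
    then show ?thesis
      by (auto simp: \<gamma> cycles_def vertex_path ptarget_def psource_def cyclic_word_def)
  next
    case (Cons a q)
    have "\<gamma> \<in> cycles Q \<longleftrightarrow> u \<in> verts Q \<and> set p \<subseteq> arcs Q \<and> cas u p (awlast u p) \<and> awlast u p = u"
      by (simp add: \<gamma> cycles_def paths_iff ptarget_def psource_def)
    also have "\<dots> \<longleftrightarrow> u \<in> verts Q \<and> set p \<subseteq> arcs Q \<and> cas u p u"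
      using awlast_if_cas[of u p u] by auto
    also have "\<dots> \<longleftrightarrow> cyclic_word p \<and> u = tail Q (hd p)"
      by (auto simp: Cons cyclic_word_def)
    finally show ?thesis
      by (auto simp: \<gamma> lp_def Cons)
  qed
qed

lemma rotation_iff:
  "rotation Q \<gamma> \<gamma>' \<longleftrightarrow> (\<exists>p. cyclic_word p \<and> \<gamma> = lp p \<and> \<gamma>' = lp (rotate1 p))"
proof
  assume r: "rotation Q \<gamma> \<gamma>'"
  then obtain a q where aq: "snd \<gamma> = a # q" "\<gamma>' = (head Q a, q @ [a])"
    by (auto simp: rotation_def)
  then have "cyclic_word (a # q) \<and> \<gamma> = lp (a # q)"
    using r by (auto simp: rotation_def cycles_iff)
  with aq lp_rotate1 show "\<exists>p. cyclic_word p \<and> \<gamma> = lp p \<and> \<gamma>' = lp (rotate1 p)"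
    by (metis rotate1.simps(2))
next
  assume "\<exists>p. cyclic_word p \<and> \<gamma> = lp p \<and> \<gamma>' = lp (rotate1 p)"
  then obtain p where p: "cyclic_word p" "\<gamma> = lp p" "\<gamma>' = lp (rotate1 p)"
    by blast
  then obtain a q where "p = a # q"
    by (cases p) (auto simp: cyclic_word_def)
  then show "rotation Q \<gamma> \<gamma>'"
    using p lp_rotate1[of a q] by (auto simp: rotation_def cycles_iff)
qed

text \<open>Orbits are closed under backward steps as well as forward ones, because undoing one
  rotation is itself a forward rotation by length minus one.\<close>

lemma equivclp_rotation_lp:
  assumes "cyclic_word p"
  shows "equivclp (rotation Q) (lp p) \<gamma> \<longleftrightarrow> \<gamma> \<in> lp ` rotations p"
proof
  assume "equivclp (rotation Q) (lp p) \<gamma>"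
  then show "\<gamma> \<in> lp ` rotations p"
  proof (induction rule: equivclp_induct)
    case base
    then show ?case
      by (simp add: rotations_self)
  next
    case (step y z)
    then obtain r where r: "r \<in> rotations p" "y = lp r"
      by blast
    from step(2) show ?case
    proof
      assume "rotation Q y z"
      then show ?thesis
        using r by (auto simp: rotation_iff rotations_rotate1)
    next
      assume "rotation Q z y"
      then obtain s where s: "cyclic_word s" "z = lp s" "y = lp (rotate1 s)"
        by (auto simp: rotation_iff)
      then have "rotate1 s = r"
        using r by simp
      then have "r \<in> rotations s"
        using rotations_rotate1[OF rotations_self] by blast
      then have "s \<in> rotations p"
        using r rotations_sym rotations_trans by blast
      then show ?thesis
        using s by blast
    qed
  qed
next
  assume "\<gamma> \<in> lp ` rotations p"
  then obtain i where "\<gamma> = lp (rotate i p)"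
    by (auto simp: rotations_def)
  moreover have "equivclp (rotation Q) (lp p) (lp (rotate i p))"
  proof (induction i)
    case (Suc i)
    have "rotation Q (lp (rotate i p)) (lp (rotate (Suc i) p))"
      unfolding rotation_iff by (intro exI[of _ "rotate i p"]) (simp add: assms closed_rotate)
    with Suc show ?case
      by (rule equivclp_into_equivclp[OF _ disjI1])
  qed simp
  ultimately show "equivclp (rotation Q) (lp p) \<gamma>"
    by simp
qed

lemma equivclp_rotation_vertex: "equivclp (rotation Q) (v, []) \<gamma> \<longleftrightarrow> \<gamma> = (v, [])"
proof
  assume "equivclp (rotation Q) (v, []) \<gamma>"
  then show "\<gamma> = (v, [])"
  proof (induction rule: equivclp_induct)
    case (step y z)
    have "\<not> rotation Q (v, []) z" "\<not> rotation Q z (v, [])"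
      by (auto simp: rotation_iff cyclic_word_def lp_def eq_commute[of "[]"])
    with step show ?case
      by blast
  qed simp
qed simp

lemma circuits_iff:
  "C \<in> circuits Q \<longleftrightarrow> (\<exists>v\<in>verts Q. C = {(v, [])}) \<or> (\<exists>p. cyclic_word p \<and> C = lp ` rotations p)"
proof -
  let ?R = "{(\<gamma>, \<gamma>') \<in> cycles Q \<times> cycles Q. equivclp (rotation Q) \<gamma> \<gamma>'}"
  have v: "?R `` {(v, [])} = {(v, [])}" if "v \<in> verts Q" for v
    using that by (auto simp: equivclp_rotation_vertex cycles_iff)
  have c: "?R `` {lp p} = lp ` rotations p" if "cyclic_word p" for p
    using that closed_rotations[OF that] by (auto simp: equivclp_rotation_lp cycles_iff)
  have "C \<in> circuits Q \<longleftrightarrow> (\<exists>\<gamma>\<in>cycles Q. C = ?R `` {\<gamma>})"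
    by (auto simp: circuits_def quotient_def)
  also have "\<dots> \<longleftrightarrow> (\<exists>v\<in>verts Q. C = {(v, [])}) \<or> (\<exists>p. cyclic_word p \<and> C = lp ` rotations p)"
  proof
    assume "\<exists>\<gamma>\<in>cycles Q. C = ?R `` {\<gamma>}"
    then obtain \<gamma> where \<gamma>: "\<gamma> \<in> cycles Q" "C = ?R `` {\<gamma>}"
      by blast
    from \<gamma>(1) consider "\<gamma> = (fst \<gamma>, [])" "fst \<gamma> \<in> verts Q" | "cyclic_word (snd \<gamma>)" "\<gamma> = lp (snd \<gamma>)"
      unfolding cycles_iff by (cases \<gamma>) auto
    then show "(\<exists>v\<in>verts Q. C = {(v, [])}) \<or> (\<exists>p. cyclic_word p \<and> C = lp ` rotations p)"
    proof cases
      case 1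
      then have "C = {(fst \<gamma>, [])}"
        using v[of "fst \<gamma>"] \<gamma>(2) by simp
      with 1 show ?thesis
        by blast
    next
      case 2
      then have "C = lp ` rotations (snd \<gamma>)"
        using c[of "snd \<gamma>"] \<gamma>(2) by simp
      with 2 show ?thesis
        by blast
    qed
  next
    assume "(\<exists>v\<in>verts Q. C = {(v, [])}) \<or> (\<exists>p. cyclic_word p \<and> C = lp ` rotations p)"
    then show "\<exists>\<gamma>\<in>cycles Q. C = ?R `` {\<gamma>}"
    proof
      assume "\<exists>v\<in>verts Q. C = {(v, [])}"
      then obtain v0 where "v0 \<in> verts Q" "C = {(v0, [])}"
        by blast
      then show ?thesis
        using v[of v0] by (intro bexI[of _ "(v0, [])"]) (auto simp: cycles_iff)
    next
      assume "\<exists>p. cyclic_word p \<and> C = lp ` rotations p"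
      then obtain p where "cyclic_word p" "C = lp ` rotations p"
        by blast
      then show ?thesis
        using c[of p] by (intro bexI[of _ "lp p"]) (auto simp: cycles_iff)
    qed
  qed
  finally show ?thesis .
qed

lemma occurrence_iff:
  "occurrence Q \<delta> \<zeta> \<epsilon> (u, w) \<longleftrightarrow>
     (u, w) \<in> paths Q \<and> w = snd \<epsilon> @ snd \<zeta> @ snd \<delta> \<and> fst \<epsilon> = u \<and>
     fst \<zeta> = awlast u (snd \<epsilon>) \<and> fst \<delta> = awlast u (snd \<epsilon> @ snd \<zeta>)"
proof
  assume o: "occurrence Q \<delta> \<zeta> \<epsilon> (u, w)"
  then show "(u, w) \<in> paths Q \<and> w = snd \<epsilon> @ snd \<zeta> @ snd \<delta> \<and> fst \<epsilon> = u \<and>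
     fst \<zeta> = awlast u (snd \<epsilon>) \<and> fst \<delta> = awlast u (snd \<epsilon> @ snd \<zeta>)"
    using occurrence_paths[OF o]
    by (auto simp: occurrence_def composable_def ptarget_def psource_def pcomp_def awlast_append)
next
  assume a: "(u, w) \<in> paths Q \<and> w = snd \<epsilon> @ snd \<zeta> @ snd \<delta> \<and> fst \<epsilon> = u \<and>
     fst \<zeta> = awlast u (snd \<epsilon>) \<and> fst \<delta> = awlast u (snd \<epsilon> @ snd \<zeta>)"
  obtain x y z where xyz: "\<epsilon> = (u, x)" "\<zeta> = (awlast u x, y)" "\<delta> = (awlast u (x @ y), z)"
    using a by (metis prod.collapse)
  have w: "u \<in> verts Q" "set (x @ y @ z) \<subseteq> arcs Q" "cas u (x @ y @ z) (awlast u w)" "w = x @ y @ z"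
    using a by (auto simp: xyz paths_iff)
  have "awlast u x \<in> verts Q" "awlast u (x @ y) \<in> verts Q"
    using w by (auto intro!: awlast_in_verts)
  then show "occurrence Q \<delta> \<zeta> \<epsilon> (u, w)"
    using w
    by (auto simp: xyz occurrence_def composable_def ptarget_def psource_def pcomp_def awlast_append paths_iff)
qed

section \<open>Zero relations as sublists\<close>

definition relwords :: "'a list set" where
  "relwords = snd ` Z"

definition zerow :: "'a list \<Rightarrow> bool" where
  "zerow w \<longleftrightarrow> (\<exists>y\<in>relwords. sublist y w)"

lemma Z_iff: "\<zeta> \<in> Z \<longleftrightarrow> snd \<zeta> \<in> relwords \<and> \<zeta> = lp (snd \<zeta>)"
proof -
  have "\<zeta> = lp (snd \<zeta>)" if "\<zeta> \<in> Z" for \<zeta>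
    using Z_paths[OF that] Z_length[OF that]
    by (cases \<zeta>; cases "snd \<zeta>") (auto simp: paths_iff lp_def)
  note * = this
  show ?thesis
  proof
    assume "\<zeta> \<in> Z"
    then show "snd \<zeta> \<in> relwords \<and> \<zeta> = lp (snd \<zeta>)"
      using * by (simp add: relwords_def)
  next
    assume a: "snd \<zeta> \<in> relwords \<and> \<zeta> = lp (snd \<zeta>)"
    then obtain \<zeta>' where "\<zeta>' \<in> Z" "snd \<zeta>' = snd \<zeta>"
      by (auto simp: relwords_def simp del: prod.collapse)
    then show "\<zeta> \<in> Z"
      using a *[of \<zeta>'] by simp
  qed
qed

lemma relwords_lp: "y \<in> relwords \<Longrightarrow> lp y \<in> Z"
  by (simp add: Z_iff)

lemma relwords_length: "y \<in> relwords \<Longrightarrow> 2 \<le> length y"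
  using Z_length by (auto simp: relwords_def simp del: prod.collapse)

text \<open>A match of words is already a match of paths: a relation is nonempty, so in a path the
  vertex reached before the match must be the tail of the first arrow of the relation.\<close>

lemma zero_path_word: "zero_path Q Z (u, w) \<longleftrightarrow> (u, w) \<in> paths Q \<and> zerow w"
proof
  assume "zero_path Q Z (u, w)"
  then obtain \<delta> \<zeta> \<epsilon> where z: "\<zeta> \<in> Z" "occurrence Q \<delta> \<zeta> \<epsilon> (u, w)"
    by (auto simp: zero_path_iff)
  then have "snd \<zeta> \<in> relwords" "sublist (snd \<zeta>) w" "(u, w) \<in> paths Q"
    by (auto simp: occurrence_iff relwords_def)
  then show "(u, w) \<in> paths Q \<and> zerow w"
    unfolding zerow_def by blast
next
  assume a: "(u, w) \<in> paths Q \<and> zerow w"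
  then obtain x y z where y: "y \<in> relwords" "w = x @ y @ z"
    by (auto simp: zerow_def sublist_def)
  have "cas (awlast u x) y (awlast (awlast u x) y)"
    using a y by (auto simp: paths_iff)
  then have "awlast u x = tail Q (hd y)"
    using relwords_length[OF y(1)] by (cases y) auto
  then have "occurrence Q (awlast u (x @ y), z) (lp y) (u, x) (u, w)"
    using a y by (simp add: occurrence_iff lp_def)
  then show "zero_path Q Z (u, w)"
    unfolding zero_path_iff using relwords_lp[OF y(1)] by blast
qed

lemma basis_path_word: "(u, w) \<in> basis_paths Q Z \<longleftrightarrow> (u, w) \<in> paths Q \<and> \<not> zerow w"
  by (auto simp: basis_paths_def zero_path_word)

lemma zerow_mono: "zerow w \<Longrightarrow> sublist w w' \<Longrightarrow> zerow w'"
  unfolding zerow_def using sublist_order.order_trans by blast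

lemma zerow_append: "zerow x \<Longrightarrow> zerow (x @ y)" "zerow y \<Longrightarrow> zerow (x @ y)"
  by (auto elim: zerow_mono)

lemma zerow_relword: "y \<in> relwords \<Longrightarrow> zerow y"
  unfolding zerow_def by blast

lemma relwords_minimal:
  assumes "y \<in> relwords" "y' \<in> relwords" "sublist y' y"
  shows "y' = y"
proof -
  have "zero_path Q {lp y'} (lp y)"
  proof -
    obtain x z where y: "y = x @ y' @ z"
      using assms(3) by (auto simp: sublist_def)
    have p: "lp y \<in> paths Q"
      using assms(1) relwords_lp Z_paths by blast
    let ?u = "tail Q (hd y)"
    have "cas (awlast ?u x) y' (awlast (awlast ?u x) y')"
      using p y by (auto simp: lp_def paths_iff)
    then have "awlast ?u x = tail Q (hd y')"
      using relwords_length[OF assms(2)] by (cases y') auto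
    then have "occurrence Q (awlast ?u (x @ y'), z) (lp y') (?u, x) (lp y)"
      using p y by (simp add: occurrence_iff lp_def)
    then show ?thesis
      using p unfolding zero_path_def subpath_def by blast
  qed
  then have "subpath Q (lp y') (lp y)"
    by (simp add: zero_path_def)
  moreover have "\<forall>\<zeta>\<in>Z. \<forall>\<zeta>'\<in>Z. subpath Q \<zeta>' \<zeta> \<longrightarrow> \<zeta>' = \<zeta>"
    using relations by (simp add: monomial_relations_def)
  ultimately have "lp y' = lp y"
    using relwords_lp[OF assms(1)] relwords_lp[OF assms(2)] by blast
  then show ?thesis
    by simp
qed

text \<open>Lists are in traversal order. The edge \<open>a # q\<close> stands for the arrow
  \<open>a\<close> (its \<open>ap\<close>) and the remaining path \<open>q\<close> (its
  \<open>tp\<close>); it runs from the vertex \<open>lp (a # q)\<close> to the vertex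
  \<open>lp (q @ [a])\<close>.\<close>

definition tp :: "'a list \<Rightarrow> ('v, 'a) qpath" where
  "tp r = (head Q (hd r), tl r)"

definition ap :: "'a list \<Rightarrow> ('v, 'a) qpath" where
  "ap r = (tail Q (hd r), [hd r])"

lemma closedE:
  assumes "cyclic_word r"
  obtains a q where "r = a # q" "a \<in> arcs Q" "set q \<subseteq> arcs Q" "cas (head Q a) q (tail Q a)"
    "awlast (head Q a) q = tail Q a"
  using assms by (cases r) (auto simp: cyclic_word_def awlast_if_cas)

lemma
  assumes "cyclic_word r"
  shows tp_path: "tp r \<in> paths Q" and ap_path: "ap r \<in> paths Q"
    and ap_arrow: "ap r \<in> arrow_paths Q"
    and tp_ap: "composable Q (tp r) (ap r)" "pcomp (tp r) (ap r) = lp r"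
    and ap_tp: "composable Q (ap r) (tp r)" "pcomp (ap r) (tp r) = lp (rotate1 r)"
proof -
  obtain a q where r: "r = a # q" "a \<in> arcs Q" "set q \<subseteq> arcs Q" "cas (head Q a) q (tail Q a)"
    "awlast (head Q a) q = tail Q a"
    using assms by (rule closedE)
  have "lp (q @ [a]) = (head Q a, q @ [a])"
    using lp_rotate1 assms r(1) by simp
  then show "tp r \<in> paths Q" "ap r \<in> paths Q" "ap r \<in> arrow_paths Q"
    "composable Q (tp r) (ap r)" "pcomp (tp r) (ap r) = lp r"
    "composable Q (ap r) (tp r)" "pcomp (ap r) (tp r) = lp (rotate1 r)"
    using r by (auto simp: tp_def ap_def paths_iff arrow_paths_def composable_def pcomp_def lp_def
        ptarget_def psource_def)
qed

text \<open>An arrow \<open>a\<close> and a path \<open>q\<close> compose to the word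
  \<open>q @ [a]\<close>, whereas the corresponding edge is \<open>a # q\<close>. The two words
  differ by one rotation, so they lie in the same circuit.\<close>

lemma odot_arrow_iff:
  assumes "cyclic_word p"
  shows "odot_at Q (arrow_paths Q) (basis_paths Q Z) (lp ` rotations p) \<noteq> {} \<longleftrightarrow>
    (\<exists>e\<in>rotations p. \<not> zerow (tl e))"
proof
  assume "odot_at Q (arrow_paths Q) (basis_paths Q Z) (lp ` rotations p) \<noteq> {}"
  then obtain a u q where a: "a \<in> arcs Q" "(u, q) \<in> basis_paths Q Z"
    and r: "pcomp (tail Q a, [a]) (u, q) \<in> lp ` rotations p"
    by (auto simp: odot_at_def odot_def arrow_paths_def)
  then have "q @ [a] \<in> rotations p"
    by (auto simp: pcomp_def lp_def)
  moreover have "q @ [a] \<in> rotations (a # q)"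
    using rotations_rotate1[OF rotations_self, of "a # q"] by simp
  ultimately have "a # q \<in> rotations p"
    using rotations_sym rotations_trans by blast
  then show "\<exists>e\<in>rotations p. \<not> zerow (tl e)"
    using a by (force simp: basis_path_word)
next
  assume "\<exists>e\<in>rotations p. \<not> zerow (tl e)"
  then obtain e where e: "e \<in> rotations p" "\<not> zerow (tl e)"
    by blast
  have c: "cyclic_word e"
    using closed_rotations[OF assms e(1)] .
  have "tp e \<in> basis_paths Q Z"
    using tp_path[OF c] e(2) by (simp add: tp_def basis_path_word)
  then have "(ap e, tp e) \<in> odot_at Q (arrow_paths Q) (basis_paths Q Z) (lp ` rotations p)"
    using tp_ap[OF c] ap_tp[OF c] ap_arrow[OF c] rotations_rotate1[OF e(1)]
    by (auto simp: odot_at_def odot_def composable_def)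
  then show "odot_at Q (arrow_paths Q) (basis_paths Q Z) (lp ` rotations p) \<noteq> {}"
    by blast
qed

text \<open>The last edges: the remainder is nonzero, so the edge survives, while the vertex it
  leads to has been deleted.\<close>

definition ends :: "'a list \<Rightarrow> 'a list set" where
  "ends p = {e \<in> rotations p. \<not> zerow (tl e) \<and> zerow (rotate1 e)}"

lemma zerow_last:
  assumes "w = x @ y @ z" "y \<in> relwords" "\<not> zerow (butlast w)"
  shows "z = []"
proof (rule ccontr)
  assume "z \<noteq> []"
  then have "butlast w = x @ y @ butlast z"
    by (simp add: assms(1) butlast_append)
  then have "zerow (butlast w)"
    using zerow_relword[OF assms(2)] by (simp add: zerow_append)
  with assms(3) show False ..
qed

text \<open>Of two suffixes of one word, one is a suffix of the other, and minimality of the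
  relations makes them equal. This determines the pair (\<xi>, \<beta>) from the cycle that it
  composes to.\<close>

lemma relword_suffix_unique:
  assumes "x @ y = x' @ y'" "y \<in> relwords" "y' \<in> relwords"
  shows "x = x' \<and> y = y'"
proof -
  have "y = y'"
    using assms by (auto simp: append_eq_append_conv2 dest: relwords_minimal[of _ y] relwords_minimal[of _ y'])
  with assms(1) show ?thesis
    by simp
qed

definition unique_pairs :: "'a list \<Rightarrow> (('v, 'a) qpath \<times> ('v, 'a) qpath) set" where
  "unique_pairs p = {(\<xi>, \<beta>) \<in> odot_at Q Z (basis_paths Q Z) (lp ` rotations p). no_other_zero_relation Q Z \<xi> \<beta>}"

text \<open>If the word of \<xi>\<beta> were zero even without its last arrow, the relation found
  there would stop before the end of the word. It would be an occurrence other than the final \<xi>,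
  which is excluded.\<close>

lemma unique_pairs_ends:
  assumes p: "cyclic_word p" and pr: "(\<xi>, \<beta>) \<in> unique_pairs p"
  shows "\<exists>e\<in>ends p. rotate1 e = snd \<beta> @ snd \<xi>"
proof -
  let ?w = "snd \<beta> @ snd \<xi>"
  have \<xi>: "\<xi> \<in> Z" and \<beta>: "\<beta> \<in> basis_paths Q Z" and "pcomp \<xi> \<beta> \<in> lp ` rotations p"
    and no: "no_other_zero_relation Q Z \<xi> \<beta>"
    using pr by (auto simp: unique_pairs_def odot_at_def odot_def)
  then have w: "?w \<in> rotations p" "pcomp \<xi> \<beta> = lp ?w"
    by (auto simp: pcomp_def lp_def)
  have \<xi>': "snd \<xi> \<in> relwords"
    using \<xi> by (simp add: Z_iff)
  then have ne: "?w \<noteq> []"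
    using relwords_length[of "snd \<xi>"] by auto
  \<comment> \<open>The inverse of \<open>rotate1\<close>: the last arrow of \<xi> becomes the arrow
    of the edge, and its remainder is the word with that arrow removed.\<close>
  define e where "e = last ?w # butlast ?w"
  have re: "rotate1 e = ?w"
    using ne by (simp add: e_def)
  then have e: "e \<in> rotations p"
    using w(1) rotations_sym[OF rotations_rotate1[OF rotations_self[of e]]] rotations_trans by metis
  have "\<not> zerow (butlast ?w)"
  proof
    assume "zerow (butlast ?w)"
    then obtain x y z where y: "y \<in> relwords" "butlast ?w = x @ y @ z"
      by (auto simp: zerow_def sublist_def)
    have wl: "?w = x @ y @ (z @ [last ?w])"
      using append_butlast_last_id[OF ne] y(2) by simp
    have path: "lp ?w \<in> paths Q"
      using closed_path[OF closed_rotations[OF p w(1)]] .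
    let ?u = "tail Q (hd ?w)"
    have "cas (awlast ?u x) y (awlast (awlast ?u x) y)"
      using path wl by (simp add: lp_def paths_iff) (metis cas_append_iff)
    then have "awlast ?u x = tail Q (hd y)"
      using relwords_length[OF y(1)] by (cases y) auto
    then have "occurrence Q (awlast ?u (x @ y), z @ [last ?w]) (lp y) (?u, x) (lp ?w)"
      using path wl by (simp add: occurrence_iff lp_def)
    then have eq: "lp y = \<xi>" "(?u, x) = \<beta>"
      using no relwords_lp[OF y(1)] unfolding no_other_zero_relation_def w(2) by blast+
    have "y = snd \<xi>" "x = snd \<beta>"
      using arg_cong[OF eq(1), of snd] arg_cong[OF eq(2), of snd] by simp_all
    then show False
      using wl by simp
  qed
  moreover have "zerow ?w"
    using zerow_relword[OF \<xi>'] by (simp add: zerow_append)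
  ultimately have "e \<in> ends p"
    using e re by (simp add: ends_def e_def)
  with re show ?thesis
    by blast
qed

text \<open>The word \<open>rotate1 e\<close> is zero but becomes nonzero when its last arrow is
  dropped, so each of its relations is a suffix, and there is only one such suffix. Cutting it off
  gives \<beta>, whose word is part of \<open>tl e\<close> and hence nonzero.\<close>

lemma ends_unique_pairs:
  assumes p: "cyclic_word p" and e: "e \<in> ends p"
  shows "\<exists>\<xi> \<beta>. (\<xi>, \<beta>) \<in> unique_pairs p \<and> rotate1 e = snd \<beta> @ snd \<xi>"
proof -
  let ?w = "rotate1 e"
  have ep: "e \<in> rotations p" and nz: "\<not> zerow (tl e)" and z: "zerow ?w"
    using e by (auto simp: ends_def)
  have c: "cyclic_word ?w"
    using closed_rotations[OF p] rotations_rotate1[OF ep] by blast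
  have path: "lp ?w \<in> paths Q"
    using closed_path[OF c] .
  have "e \<noteq> []"
    using closed_rotations[OF p ep] by (auto simp: cyclic_word_def)
  then have bl: "butlast ?w = tl e"
    by (cases e) auto
  obtain x y s where y: "y \<in> relwords" "?w = x @ y @ s"
    using z by (auto simp: zerow_def sublist_def)
  then have s: "s = []"
    using zerow_last[of ?w x y s] bl nz by simp
  have w: "?w = x @ y"
    using y s by simp
  let ?u = "tail Q (hd ?w)"
  have yne: "y \<noteq> []"
    using relwords_length[OF y(1)] by auto
  have "tl e = x @ butlast y"
    using bl w yne by (simp add: butlast_append)
  then have nx: "\<not> zerow x"
    using nz zerow_append by metis
  have cw: "cas ?u (x @ y) ?u" "set (x @ y) \<subseteq> arcs Q" "?u \<in> verts Q"
    using c path w by (auto simp: cyclic_word_def lp_def paths_iff)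
  have ux: "awlast ?u x = tail Q (hd y)"
    using cw(1) yne by (cases y) auto
  have uy: "awlast (tail Q (hd y)) y = ?u"
    using cw(1) ux awlast_if_cas by auto
  have xB: "(?u, x) \<in> basis_paths Q Z"
    using cw nx by (auto simp: basis_path_word paths_iff)
  have "pcomp (lp y) (?u, x) = lp ?w"
    using w by (simp add: lp_def pcomp_def)
  moreover have "no_other_zero_relation Q Z (lp y) (?u, x)"
    unfolding no_other_zero_relation_def
  proof (intro allI impI)
    fix \<delta> \<zeta> \<epsilon> assume \<zeta>: "\<zeta> \<in> Z" and "occurrence Q \<delta> \<zeta> \<epsilon> (pcomp (lp y) (?u, x))"
    then have o: "occurrence Q \<delta> \<zeta> \<epsilon> (?u, ?w)"
      using w by (simp add: lp_def pcomp_def)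
    then have w': "?w = snd \<epsilon> @ snd \<zeta> @ snd \<delta>" "fst \<epsilon> = ?u"
      by (auto simp: occurrence_iff)
    have \<zeta>': "snd \<zeta> \<in> relwords" "\<zeta> = lp (snd \<zeta>)"
      using \<zeta> by (auto simp: Z_iff)
    have "snd \<delta> = []"
      using zerow_last[OF w'(1) \<zeta>'(1)] bl nz by simp
    then have "x @ y = snd \<epsilon> @ snd \<zeta>"
      using w' w by simp
    then have "x = snd \<epsilon>" "y = snd \<zeta>"
      using relword_suffix_unique[OF _ y(1) \<zeta>'(1)] by auto
    then show "\<zeta> = lp y \<and> \<epsilon> = (?u, x)"
      using \<zeta>' w' by (cases \<epsilon>) auto
  qed
  ultimately have "(lp y, (?u, x)) \<in> unique_pairs p"
    using relwords_lp[OF y(1)] xB ux uy rotations_rotate1[OF ep]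
    by (auto simp: unique_pairs_def odot_at_def odot_def ptarget_def psource_def lp_def)
  then show ?thesis
    using w by (intro exI[of _ "lp y"] exI[of _ "(?u, x)"]) simp
qed

lemma unique_pairs_inj:
  assumes "(\<xi>, \<beta>) \<in> unique_pairs p" "(\<xi>', \<beta>') \<in> unique_pairs p" "snd \<beta> @ snd \<xi> = snd \<beta>' @ snd \<xi>'"
  shows "\<xi> = \<xi>' \<and> \<beta> = \<beta>'"
proof -
  have Z: "\<xi> \<in> Z" "\<xi>' \<in> Z" and lp: "pcomp \<xi> \<beta> \<in> range lp" "pcomp \<xi>' \<beta>' \<in> range lp"
    using assms by (auto simp: unique_pairs_def odot_at_def odot_def)
  have "fst \<beta> = fst \<beta>'"
    using lp assms(3) by (auto simp: pcomp_def lp_def)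
  moreover have "snd \<beta> = snd \<beta>' \<and> snd \<xi> = snd \<xi>'"
    using relword_suffix_unique[OF assms(3)] Z by (simp add: Z_iff)
  ultimately show ?thesis
    using Z by (metis Z_iff prod.expand)
qed

lemma unique_pair_iff:
  assumes "cyclic_word p"
  shows "(\<exists>!pr. pr \<in> odot_at Q Z (basis_paths Q Z) (lp ` rotations p) \<and>
             (case pr of (\<xi>, \<beta>) \<Rightarrow> no_other_zero_relation Q Z \<xi> \<beta>)) \<longleftrightarrow> (\<exists>!e. e \<in> ends p)"
proof -
  have inj: "e = e'" if "rotate1 e = rotate1 e'" "e \<in> ends p" "e' \<in> ends p" for e e'
    using bij_betw_imp_inj_on[OF rotate1_bij[of p]] that by (auto simp: ends_def inj_on_def)
  have "(\<exists>!pr. pr \<in> odot_at Q Z (basis_paths Q Z) (lp ` rotations p) \<and>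
             (case pr of (\<xi>, \<beta>) \<Rightarrow> no_other_zero_relation Q Z \<xi> \<beta>)) \<longleftrightarrow> (\<exists>!pr. pr \<in> unique_pairs p)"
    by (auto simp: unique_pairs_def)
  also have "\<dots> \<longleftrightarrow> (\<exists>!e. e \<in> ends p)"
  proof
    assume "\<exists>!pr. pr \<in> unique_pairs p"
    then obtain \<xi> \<beta> where u: "(\<xi>, \<beta>) \<in> unique_pairs p" "\<And>pr. pr \<in> unique_pairs p \<Longrightarrow> pr = (\<xi>, \<beta>)"
      by (metis surj_pair)
    obtain e where e: "e \<in> ends p" "rotate1 e = snd \<beta> @ snd \<xi>"
      using unique_pairs_ends[OF assms u(1)] by blast
    show "\<exists>!e. e \<in> ends p"
    proof (rule ex1I[of _ e])
      fix e' assume e': "e' \<in> ends p"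
      then obtain \<xi>' \<beta>' where "(\<xi>', \<beta>') \<in> unique_pairs p" "rotate1 e' = snd \<beta>' @ snd \<xi>'"
        using ends_unique_pairs[OF assms] by blast
      then have "rotate1 e' = rotate1 e"
        using u(2)[of "(\<xi>', \<beta>')"] e(2) by simp
      then show "e' = e"
        using inj e(1) e' by blast
    qed (rule e)
  next
    assume "\<exists>!e. e \<in> ends p"
    then obtain e where e: "e \<in> ends p" "\<And>e'. e' \<in> ends p \<Longrightarrow> e' = e"
      by blast
    obtain \<xi> \<beta> where u: "(\<xi>, \<beta>) \<in> unique_pairs p" "rotate1 e = snd \<beta> @ snd \<xi>"
      using ends_unique_pairs[OF assms e(1)] by blast
    show "\<exists>!pr. pr \<in> unique_pairs p"
    proof (rule ex1I[of _ "(\<xi>, \<beta>)"])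
      fix pr assume pr: "pr \<in> unique_pairs p"
      obtain \<xi>' \<beta>' where pr': "pr = (\<xi>', \<beta>')"
        by (cases pr)
      then obtain e' where "e' \<in> ends p" "rotate1 e' = snd \<beta>' @ snd \<xi>'"
        using unique_pairs_ends[OF assms] pr by blast
      then have "snd \<beta>' @ snd \<xi>' = snd \<beta> @ snd \<xi>"
        using e(2) u(2) by metis
      then show "pr = (\<xi>, \<beta>)"
        using unique_pairs_inj[of \<xi>' \<beta>' p \<xi> \<beta>] pr pr' u(1) by simp
    qed (rule u)
  qed
  finally show ?thesis .
qed

text \<open>Without a last edge, a surviving edge is always followed by another one through a
  nonzero vertex. Rotating on reaches the whole orbit, including the zero word
  \<open>r\<close>.\<close>

lemma ends_nonempty:
  assumes "e \<in> rotations p" "\<not> zerow (tl e)" "r \<in> rotations p" "zerow r" "p \<noteq> []"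
  shows "ends p \<noteq> {}"
proof
  assume none: "ends p = {}"
  have *: "\<not> zerow (tl (rotate i e)) \<and> \<not> zerow (rotate1 (rotate i e))" for i
  proof (induction i)
    case 0
    then show ?case
      using none assms by (auto simp: ends_def)
  next
    case (Suc i)
    let ?r = "rotate1 (rotate i e)"
    have t: "\<not> zerow (tl ?r)"
      using Suc zerow_mono[of "tl ?r" ?r] by (auto simp: sublist_tl)
    moreover have "?r \<in> rotations p"
      using rotations_rotate1[OF rotations_rotate[OF assms(1)]] .
    ultimately have "\<not> zerow (rotate1 ?r)"
      using none by (auto simp: ends_def)
    with t show ?case
      by simp
  qed
  have "r \<in> rotations e"
    using assms rotations_sym rotations_trans by blast
  then obtain i where "r = rotate i e"
    by (auto simp: rotations_def)
  \<comment> \<open>A full extra turn makes the exponent positive, so that \<open>r\<close> is the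
    endpoint of an edge even when \<open>i\<close> is 0.\<close>
  also have "\<dots> = rotate (i + length e) e"
    using rotate_conv_mod[of "i + length e" e] rotate_conv_mod[of i e] by simp
  also have "\<dots> = rotate1 (rotate (i + length e - 1) e)"
    using rotations_length[OF assms(1)] assms(5) by (cases "i + length e") auto
  finally show False
    using * assms(4) by metis
qed

text \<open>A vertex circuit contains no word with an arrow, so only orbits of cyclic words matter
  in the uniqueness clause. Its second premise is met as follows: a zero cycle together with a
  surviving edge yields a last edge, and that edge yields a pair in (Z \<odot> B)_C.\<close>

lemma condition_iff:
  "((\<forall>C\<in>circuits Q. \<not> trivial_circuit Q C \<longrightarrow> (\<exists>\<gamma>\<in>C. zero_path Q Z \<gamma>)) \<and>
    (\<forall>C\<in>circuits Q.
       odot_at Q (arrow_paths Q) (basis_paths Q Z) C \<noteq> {} \<and>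
       odot_at Q Z (basis_paths Q Z) C \<noteq> {} \<longrightarrow>
       (\<exists>!p. p \<in> odot_at Q Z (basis_paths Q Z) C \<and>
             (case p of (\<xi>, \<beta>) \<Rightarrow> no_other_zero_relation Q Z \<xi> \<beta>)))) \<longleftrightarrow>
   (\<forall>p. cyclic_word p \<longrightarrow> (\<exists>r\<in>rotations p. zerow r) \<and>
      ((\<exists>e\<in>rotations p. \<not> zerow (tl e)) \<longrightarrow> (\<exists>!e. e \<in> ends p)))" (is "?L1 \<and> ?L2 \<longleftrightarrow> ?R")
proof -
  have nt: "\<not> trivial_circuit Q (lp ` rotations p)" if "cyclic_word p" for p
    using that rotations_self[of p] by (auto simp: trivial_circuit_def lp_def cyclic_word_def)
  have tr: "odot_at Q (arrow_paths Q) (basis_paths Q Z) {(v, [])} = {}" for v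
    by (auto simp: odot_at_def arrow_paths_def odot_def pcomp_def)
  have zp: "(\<exists>\<gamma>\<in>lp ` rotations p. zero_path Q Z \<gamma>) \<longleftrightarrow> (\<exists>r\<in>rotations p. zerow r)" if "cyclic_word p" for p
    using closed_path[OF closed_rotations[OF that]] by (auto simp: zero_path_word lp_def)
  have circ: "lp ` rotations p \<in> circuits Q" if "cyclic_word p" for p
    using that circuits_iff by blast
  have L1: "?L1 \<longleftrightarrow> (\<forall>p. cyclic_word p \<longrightarrow> (\<exists>r\<in>rotations p. zerow r))"
  proof
    assume ?L1
    then show "\<forall>p. cyclic_word p \<longrightarrow> (\<exists>r\<in>rotations p. zerow r)"
      using circ nt zp by blast
  next
    assume R: "\<forall>p. cyclic_word p \<longrightarrow> (\<exists>r\<in>rotations p. zerow r)"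
    show ?L1
    proof (intro ballI impI)
      fix C assume "C \<in> circuits Q" "\<not> trivial_circuit Q C"
      then obtain p where "cyclic_word p" "C = lp ` rotations p"
        unfolding circuits_iff trivial_circuit_def by blast
      then show "\<exists>\<gamma>\<in>C. zero_path Q Z \<gamma>"
        using R zp by simp
    qed
  qed
  have ZB: "odot_at Q Z (basis_paths Q Z) (lp ` rotations p) \<noteq> {}"
    if p: "cyclic_word p" and "\<exists>e\<in>rotations p. \<not> zerow (tl e)" "\<exists>r\<in>rotations p. zerow r" for p
  proof -
    have "ends p \<noteq> {}"
      using that ends_nonempty by (auto simp: cyclic_word_def)
    then obtain \<xi> \<beta> where "(\<xi>, \<beta>) \<in> unique_pairs p"
      using ends_unique_pairs[OF p] by blast
    then show ?thesis
      by (auto simp: unique_pairs_def)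
  qed
  show ?thesis
  proof
    assume L: "?L1 \<and> ?L2"
    show ?R
    proof (intro allI impI conjI)
      fix p assume p: "cyclic_word p"
      show z: "\<exists>r\<in>rotations p. zerow r"
        using L L1 p by blast
      assume e: "\<exists>e\<in>rotations p. \<not> zerow (tl e)"
      then have "odot_at Q (arrow_paths Q) (basis_paths Q Z) (lp ` rotations p) \<noteq> {}"
        using odot_arrow_iff[OF p] by blast
      with L circ[OF p] ZB[OF p e z] show "\<exists>!e. e \<in> ends p"
        unfolding unique_pair_iff[OF p, symmetric] by blast
    qed
  next
    assume R: ?R
    then have ?L1
      using L1 by blast
    moreover have ?L2
    proof (intro ballI impI)
      fix C assume "C \<in> circuits Q"
        and ne: "odot_at Q (arrow_paths Q) (basis_paths Q Z) C \<noteq> {} \<and> odot_at Q Z (basis_paths Q Z) C \<noteq> {}"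
      then obtain p where p: "cyclic_word p" "C = lp ` rotations p"
        using tr unfolding circuits_iff by blast
      then have "\<exists>e\<in>rotations p. \<not> zerow (tl e)"
        using ne odot_arrow_iff by blast
      then show "\<exists>!p. p \<in> odot_at Q Z (basis_paths Q Z) C \<and>
             (case p of (\<xi>, \<beta>) \<Rightarrow> no_other_zero_relation Q Z \<xi> \<beta>)"
        unfolding p(2) unique_pair_iff[OF p(1)] using R p(1) by blast
    qed
    ultimately show "?L1 \<and> ?L2" ..
  qed
qed

section \<open>Chains modulo boundaries\<close>

interpretation A: central_pair "MA :: (('v, 'a) qpath \<Rightarrow>\<^sub>0 'k::field) set ring" "base_field Q Z"
  by (rule central_pair_MA)

abbreviation ok :: "(('v, 'a) qpath \<Rightarrow>\<^sub>0 'k::field) \<Rightarrow> bool" where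
  "ok f \<equiv> Poly_Mapping.keys f \<subseteq> paths Q"

lemma ok_add: "ok f \<Longrightarrow> ok g \<Longrightarrow> ok (f + g)"
  using Poly_Mapping.keys_add[of f g] by blast

lemma ok_single: "\<gamma> \<in> paths Q \<Longrightarrow> ok (sg \<gamma> c)"
  by simp

abbreviation BD :: "((('v, 'a) qpath \<Rightarrow>\<^sub>0 'k::field) set list \<Rightarrow>\<^sub>0 int) set" where
  "BD \<equiv> bar_boundaries MA (base_field Q Z) (Suc 0)"

definition eqv ::
  "((('v, 'a) qpath \<Rightarrow>\<^sub>0 'k::field) set list \<Rightarrow>\<^sub>0 int) \<Rightarrow> ((('v, 'a) qpath \<Rightarrow>\<^sub>0 'k) set list \<Rightarrow>\<^sub>0 int) \<Rightarrow> bool"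
where
  "eqv x y \<longleftrightarrow> x - y \<in> BD"

lemma eqv_refl [simp]: "eqv x x"
  by (simp add: eqv_def A.bnd_zero)

lemma eqv_sym: "eqv x y \<Longrightarrow> eqv y x"
  unfolding eqv_def by (drule A.bnd_uminus) simp

lemma eqv_trans [trans]: "eqv x y \<Longrightarrow> eqv y z \<Longrightarrow> eqv x z"
  unfolding eqv_def by (drule (1) A.bnd_add) simp

lemma eqv_add: "eqv x y \<Longrightarrow> eqv x' y' \<Longrightarrow> eqv (x + x') (y + y')"
  unfolding eqv_def by (drule (1) A.bnd_add) (simp add: algebra_simps)

lemma eqv_diff: "eqv x y \<Longrightarrow> eqv x' y' \<Longrightarrow> eqv (x - x') (y - y')"
  unfolding eqv_def by (drule (1) A.bnd_diff) (simp add: algebra_simps)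

lemma eqv_sum: "(\<And>i. i \<in> I \<Longrightarrow> eqv (f i) (g i)) \<Longrightarrow> eqv (\<Sum>i\<in>I. f i) (\<Sum>i\<in>I. g i)"
  unfolding eqv_def using A.bnd_sum[of I "\<lambda>i. f i - g i"] by (simp add: sum_subtractf)

lemma eqv_sum_0: "(\<And>i. i \<in> I \<Longrightarrow> eqv (f i) 0) \<Longrightarrow> eqv (\<Sum>i\<in>I. f i) 0"
  using eqv_sum[of I f "\<lambda>_. 0"] by simp

lemma eqv_double: "eqv x (x + x) \<Longrightarrow> eqv x 0"
  unfolding eqv_def by (drule A.bnd_uminus) simp

section \<open>Calculus of chains modulo boundaries\<close>

definition ch ::
  "(('v, 'a) qpath \<Rightarrow>\<^sub>0 'k::field) \<Rightarrow> (('v, 'a) qpath \<Rightarrow>\<^sub>0 'k) \<Rightarrow> ((('v, 'a) qpath \<Rightarrow>\<^sub>0 'k) set list \<Rightarrow>\<^sub>0 int)"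
where
  "ch f g = A.chain (cls f) (cls g)"

lemma ch_add_left: "ok f \<Longrightarrow> ok f' \<Longrightarrow> ok g \<Longrightarrow> eqv (ch (f + f') g) (ch f g + ch f' g)"
  using A.chain_add_left[of "cls f" "cls f'" "cls g"]
  by (simp add: eqv_def ch_def cls_add cls_closed diff_diff_eq)

lemma ch_add_right: "ok f \<Longrightarrow> ok g \<Longrightarrow> ok g' \<Longrightarrow> eqv (ch f (g + g')) (ch f g + ch f g')"
  using A.chain_add_right[of "cls f" "cls g" "cls g'"]
  by (simp add: eqv_def ch_def cls_add cls_closed diff_diff_eq)

lemma ch_leibniz:
  "ok f \<Longrightarrow> ok g \<Longrightarrow> ok h \<Longrightarrow> eqv (ch f (pmul g h)) (ch (pmul h f) g + ch (pmul f g) h)"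
  using A.chain_leibniz[of "cls f" "cls g" "cls h"]
  by (simp add: eqv_def ch_def cls_mult cls_closed diff_diff_eq)

lemma ch_scalar:
  "ok f \<Longrightarrow> ok g \<Longrightarrow> eqv (ch (pmul (scalar Q c) f) g) (ch f (pmul (scalar Q c) g))"
  using A.chain_balanced[of "cls (scalar Q c)" "cls f" "cls g"]
  by (simp add: eqv_def ch_def cls_mult cls_closed scalar_closed base_field_eq)

lemma ch_J_left:
  assumes "f \<in> J" "ok g"
  shows "eqv (ch f g) 0"
proof -
  have "cls f = cls 0"
    using assms(1) by (simp add: cls_eq_iff)
  then have "ch f g = ch 0 g"
    by (simp add: ch_def)
  moreover have "eqv (ch 0 g) 0"
    using ch_add_left[of 0 0 g] assms by (intro eqv_double) simp
  ultimately show ?thesis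
    by simp
qed

lemma ch_J_right:
  assumes "g \<in> J" "ok f"
  shows "eqv (ch f g) 0"
proof -
  have "cls g = cls 0"
    using assms(1) by (simp add: cls_eq_iff)
  then have "ch f g = ch f 0"
    by (simp add: ch_def)
  moreover have "eqv (ch f 0) 0"
    using ch_add_right[of f 0 0] assms by (intro eqv_double) simp
  ultimately show ?thesis
    by simp
qed

text \<open>All scalars are gathered in the first entry, as \<open>ch_cp\<close> permits. The
  coefficient has to stay inside the generator because the chain group only has integer
  multiples.\<close>

definition cp ::
  "('v, 'a) qpath \<Rightarrow> ('v, 'a) qpath \<Rightarrow> 'k::field \<Rightarrow> ((('v, 'a) qpath \<Rightarrow>\<^sub>0 'k) set list \<Rightarrow>\<^sub>0 int)"
where
  "cp \<alpha> \<beta> a = ch (sg \<alpha> a) (sg \<beta> 1)"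

lemma cp_add:
  "\<alpha> \<in> paths Q \<Longrightarrow> \<beta> \<in> paths Q \<Longrightarrow> eqv (cp \<alpha> \<beta> (a + b)) (cp \<alpha> \<beta> a + cp \<alpha> \<beta> b)"
  using ch_add_left[of "sg \<alpha> a" "sg \<alpha> b" "sg \<beta> 1"] by (simp add: cp_def single_add)

lemma cp_zero:
  assumes "\<alpha> \<in> paths Q" "\<beta> \<in> paths Q" "zero_path Q Z \<alpha> \<or> zero_path Q Z \<beta>"
  shows "eqv (cp \<alpha> \<beta> a) 0"
  unfolding cp_def using assms(3)
proof
  assume "zero_path Q Z \<alpha>"
  then show "eqv (ch (sg \<alpha> a) (sg \<beta> 1)) 0"
    by (rule ch_J_left[OF J_single ok_single[OF assms(2)]])
next
  assume "zero_path Q Z \<beta>"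
  then show "eqv (ch (sg \<alpha> a) (sg \<beta> 1)) 0"
    by (rule ch_J_right[OF J_single ok_single[OF assms(1)]])
qed

lemma ch_cp:
  assumes "\<alpha> \<in> paths Q" "\<beta> \<in> paths Q"
  shows "eqv (ch (sg \<alpha> a) (sg \<beta> b)) (cp \<alpha> \<beta> (b * a))"
  using ch_scalar[of "sg \<alpha> a" "sg \<beta> 1" b] assms by (simp add: cp_def scalar_single eqv_sym)

lemma cp_leibniz:
  fixes a :: "'k::field"
  assumes "\<alpha> \<in> paths Q" "\<beta> \<in> paths Q" "\<beta>' \<in> paths Q"
  shows "eqv (if composable Q \<beta> \<beta>' then cp \<alpha> (pcomp \<beta> \<beta>') a else 0)
     ((if composable Q \<beta>' \<alpha> then cp (pcomp \<beta>' \<alpha>) \<beta> a else 0) +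
      (if composable Q \<alpha> \<beta> then cp (pcomp \<alpha> \<beta>) \<beta>' a else 0))"
proof -
  have 1: "eqv (if composable Q \<beta> \<beta>' then cp \<alpha> (pcomp \<beta> \<beta>') a else 0) (ch (sg \<alpha> a) (pmul (sg \<beta> 1) (sg \<beta>' 1)))"
    using assms eqv_sym[OF ch_J_right[OF J_zero, of "sg \<alpha> a"]] by (simp add: pmul_single cp_def)
  have 2: "eqv (ch (pmul (sg \<beta>' 1) (sg \<alpha> a)) (sg \<beta> 1)) (if composable Q \<beta>' \<alpha> then cp (pcomp \<beta>' \<alpha>) \<beta> a else 0)"
    using assms ch_J_left[OF J_zero, of "sg \<beta> (1 :: 'k)"] by (simp add: pmul_single cp_def)
  have 3: "eqv (ch (pmul (sg \<alpha> a) (sg \<beta> 1)) (sg \<beta>' 1)) (if composable Q \<alpha> \<beta> then cp (pcomp \<alpha> \<beta>) \<beta>' a else 0)"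
    using assms ch_J_left[OF J_zero, of "sg \<beta>' (1 :: 'k)"] by (simp add: pmul_single cp_def)
  note 1
  also have "eqv (ch (sg \<alpha> a) (pmul (sg \<beta> 1) (sg \<beta>' 1)))
      (ch (pmul (sg \<beta>' 1) (sg \<alpha> a)) (sg \<beta> 1) + ch (pmul (sg \<alpha> a) (sg \<beta> 1)) (sg \<beta>' 1))"
    using assms by (intro ch_leibniz) auto
  also note eqv_add[OF 2 3]
  finally show ?thesis .
qed

text \<open>A derivation kills a commuting idempotent: writing the vertex as its own square, the
  Leibniz rule makes the chain congruent to its double.\<close>

lemma cp_vertex:
  assumes "\<alpha> \<in> paths Q" "psource \<alpha> = v" "ptarget Q \<alpha> = v"
  shows "eqv (cp \<alpha> (v, []) a) 0"
proof -
  have "v \<in> verts Q"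
    using psource_verts[OF assms(1)] assms(2) by simp
  then show ?thesis
    using cp_leibniz[of \<alpha> "(v, [])" "(v, [])" a] assms
    by (intro eqv_double) (simp add: vertex_path composable_vertex pcomp_vertex psource_def ptarget_def)
qed

text \<open>The chain of the edge \<open>r\<close> with a coefficient. Its differential is the
  difference of the vertices \<open>lp r\<close> and \<open>lp (rotate1 r)\<close>.\<close>

definition wd :: "'a list \<Rightarrow> 'k::field \<Rightarrow> ((('v, 'a) qpath \<Rightarrow>\<^sub>0 'k) set list \<Rightarrow>\<^sub>0 int)" where
  "wd r = cp (tp r) (ap r)"

lemma wd_add: "cyclic_word r \<Longrightarrow> eqv (wd r (a + b)) (wd r a + wd r b)"
  unfolding wd_def by (intro cp_add tp_path ap_path)

lemma wd_zero:
  assumes "cyclic_word r" "zerow (tl r)"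
  shows "eqv (wd r a) 0"
proof -
  have "zero_path Q Z (tp r)"
    using tp_path[OF assms(1)] assms(2) by (simp add: tp_def zero_path_word)
  then show ?thesis
    unfolding wd_def using tp_path[OF assms(1)] ap_path[OF assms(1)] by (intro cp_zero) auto
qed

text \<open>The Leibniz rule applied arrow by arrow: each arrow of the second entry is split off in
  turn, and everything else on the cycle is collected in the first entry. Index \<open>i\<close> is
  the cut at the i-th arrow traversed.\<close>

lemma cp_expand:
  assumes "\<alpha> \<in> paths Q" "(u, l) \<in> paths Q" "composable Q \<alpha> (u, l)" "composable Q (u, l) \<alpha>"
  shows "eqv (cp \<alpha> (u, l) a) (\<Sum>i<length l. wd (rotate i (l @ snd \<alpha>)) a)"
  using assms
proof (induction l arbitrary: \<alpha> u)
  case Nil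
  then show ?case
    using cp_vertex[of \<alpha> u a] by (simp add: composable_vertex)
next
  case (Cons x l)
  let ?x = "(u, [x])" and ?l = "(head Q x, l)"
  have x: "u = tail Q x" "x \<in> arcs Q" "?l \<in> paths Q" "?x \<in> paths Q"
    using Cons.prems(2) by (auto simp: paths_iff)
  have c: "composable Q ?l ?x" "composable Q ?x \<alpha>" "composable Q \<alpha> ?l"
    using Cons.prems(3,4) x(1) by (auto simp: composable_def ptarget_def psource_def)
  have p: "pcomp ?l ?x = (u, x # l)"
    by (simp add: pcomp_def)
  let ?\<alpha> = "pcomp ?x \<alpha>"
  have "eqv (cp ?\<alpha> ?l a) (\<Sum>i<length l. wd (rotate i (l @ snd ?\<alpha>)) a)"
  proof (rule Cons.IH)
    show "?\<alpha> \<in> paths Q"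
      using pcomp_paths Cons.prems(1) x c by blast
    show "composable Q ?\<alpha> ?l"
      using c(3) by (simp add: composable_def)
    show "composable Q ?l ?\<alpha>"
      using c(1) ptarget_pcomp[OF c(2)] by (simp add: composable_def)
  qed (rule x)
  also have "(\<Sum>i<length l. wd (rotate i (l @ snd ?\<alpha>)) a) = (\<Sum>i<length l. wd (rotate (Suc i) ((x # l) @ snd \<alpha>)) a)"
    by (simp add: pcomp_def rotate1_rotate_swap)
  finally have 1: "eqv (cp ?\<alpha> ?l a) (\<Sum>i<length l. wd (rotate (Suc i) ((x # l) @ snd \<alpha>)) a)" .
  have 2: "cp (pcomp \<alpha> ?l) ?x a = wd (rotate 0 ((x # l) @ snd \<alpha>)) a"
    by (simp add: wd_def tp_def ap_def pcomp_def x(1))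
  have "eqv (cp \<alpha> (u, x # l) a) (cp ?\<alpha> ?l a + cp (pcomp \<alpha> ?l) ?x a)"
    using cp_leibniz[OF Cons.prems(1) x(3,4), of a] c by (simp add: p)
  also have "eqv \<dots> ((\<Sum>i<length l. wd (rotate (Suc i) ((x # l) @ snd \<alpha>)) a) + wd (rotate 0 ((x # l) @ snd \<alpha>)) a)"
    unfolding 2 by (intro eqv_add 1 eqv_refl)
  also have "\<dots> = (\<Sum>i<length (x # l). wd (rotate i ((x # l) @ snd \<alpha>)) a)"
    unfolding length_Cons sum.lessThan_Suc_shift by (simp add: add.commute)
  finally show ?case .
qed

text \<open>
  Chains are taken relative to \<open>k\<close> and not to the semisimple part of the algebra, so besides the
  pairs of $(Q_1 \odot B)$ the normal form keeps one chain for every path that is not a cycle.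
\<close>

definition tm :: "('v, 'a) qpath \<Rightarrow> 'k::field \<Rightarrow> ((('v, 'a) qpath \<Rightarrow>\<^sub>0 'k) set list \<Rightarrow>\<^sub>0 int)" where
  "tm \<gamma> = (if cyclic_word (snd \<gamma>) \<and> \<gamma> = lp (snd \<gamma>) then wd (snd \<gamma>) else cp \<gamma> (psource \<gamma>, []))"

lemma tm_lp: "cyclic_word r \<Longrightarrow> tm (lp r) = wd r"
  by (simp add: tm_def)

lemma tm_add: "\<gamma> \<in> paths Q \<Longrightarrow> eqv (tm \<gamma> (a + b)) (tm \<gamma> a + tm \<gamma> b)"
  by (simp add: tm_def wd_add cp_add vertex_path psource_verts)

lemma tm_0: "\<gamma> \<in> paths Q \<Longrightarrow> eqv (tm \<gamma> 0) 0"
  using tm_add[of \<gamma> 0 0] by (intro eqv_double) simp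

lemma tm_diff: "\<gamma> \<in> paths Q \<Longrightarrow> eqv (tm \<gamma> (a - b)) (tm \<gamma> a - tm \<gamma> b)"
  using eqv_diff[OF eqv_sym[OF tm_add[of \<gamma> "a - b" b]] eqv_refl[of "tm \<gamma> b"]] by simp

definition nf :: "(('v, 'a) qpath \<Rightarrow>\<^sub>0 'k::field) \<Rightarrow> ((('v, 'a) qpath \<Rightarrow>\<^sub>0 'k) set list \<Rightarrow>\<^sub>0 int)" where
  "nf c = (\<Sum>\<gamma>\<in>Poly_Mapping.keys c. tm \<gamma> (Poly_Mapping.lookup c \<gamma>))"

text \<open>Outside the support the summands \<open>tm \<gamma> 0\<close> are boundaries but not
  zero in the free group, so the index set can be enlarged only up to congruence.\<close>

lemma nf_superset:
  assumes "finite S" "Poly_Mapping.keys c \<subseteq> S" "S \<subseteq> paths Q"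
  shows "eqv (nf c) (\<Sum>\<gamma>\<in>S. tm \<gamma> (Poly_Mapping.lookup c \<gamma>))"
proof -
  have "eqv (\<Sum>\<gamma>\<in>S - Poly_Mapping.keys c. tm \<gamma> (Poly_Mapping.lookup c \<gamma>)) 0"
    using assms by (intro eqv_sum_0) (auto simp: in_keys_iff intro: tm_0)
  from eqv_add[OF this eqv_refl[of "nf c"]]
  have "eqv (\<Sum>\<gamma>\<in>S. tm \<gamma> (Poly_Mapping.lookup c \<gamma>)) (nf c)"
    using sum.subset_diff[OF assms(2,1), of "\<lambda>\<gamma>. tm \<gamma> (Poly_Mapping.lookup c \<gamma>)"] by (simp add: nf_def)
  then show ?thesis
    by (rule eqv_sym)
qed

lemma nf_diff:
  assumes "ok c" "ok d"
  shows "eqv (nf (c - d)) (nf c - nf d)"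
proof -
  let ?S = "Poly_Mapping.keys c \<union> Poly_Mapping.keys d"
  have S: "finite ?S" "?S \<subseteq> paths Q" "Poly_Mapping.keys (c - d) \<subseteq> ?S"
    using assms keys_diff[of c d] by auto
  have "eqv (nf (c - d)) (\<Sum>\<gamma>\<in>?S. tm \<gamma> (Poly_Mapping.lookup (c - d) \<gamma>))"
    using S by (intro nf_superset)
  also have "eqv \<dots> (\<Sum>\<gamma>\<in>?S. tm \<gamma> (Poly_Mapping.lookup c \<gamma>) - tm \<gamma> (Poly_Mapping.lookup d \<gamma>))"
    using S by (intro eqv_sum) (auto simp: lookup_minus intro: tm_diff)
  also have "\<dots> = (\<Sum>\<gamma>\<in>?S. tm \<gamma> (Poly_Mapping.lookup c \<gamma>)) - (\<Sum>\<gamma>\<in>?S. tm \<gamma> (Poly_Mapping.lookup d \<gamma>))"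
    by (simp add: sum_subtractf)
  also have "eqv \<dots> (nf c - nf d)"
    using S by (intro eqv_diff eqv_sym[OF nf_superset]) auto
  finally show ?thesis .
qed

section \<open>Every chain is congruent to a normal form\<close>

definition reach :: "((('v, 'a) qpath \<Rightarrow>\<^sub>0 'k::field) set list \<Rightarrow>\<^sub>0 int) \<Rightarrow> bool" where
  "reach z \<longleftrightarrow> (\<exists>c. ok c \<and> eqv z (nf c))"

lemma reach_eqv: "eqv z z' \<Longrightarrow> reach z' \<Longrightarrow> reach z"
  unfolding reach_def using eqv_trans by blast

lemma reach_0: "reach 0"
  unfolding reach_def by (intro exI[of _ 0]) (simp add: nf_def)

lemma reach_diff:
  assumes "reach z" "reach z'"
  shows "reach (z - z')"
proof -
  obtain c d where "ok c" "eqv z (nf c)" "ok d" "eqv z' (nf d)"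
    using assms by (auto simp: reach_def)
  moreover from this have "eqv (z - z') (nf (c - d))"
    using eqv_trans[OF eqv_diff eqv_sym[OF nf_diff]] by blast
  moreover have "ok (c - d)"
    using calculation keys_diff[of c d] by blast
  ultimately show ?thesis
    unfolding reach_def by blast
qed

lemma reach_add: "reach z \<Longrightarrow> reach z' \<Longrightarrow> reach (z + z')"
  using reach_diff[of z "0 - z'"] reach_diff[OF reach_0, of z'] by simp

lemma reach_sum: "(\<And>i. i \<in> I \<Longrightarrow> reach (f i)) \<Longrightarrow> reach (\<Sum>i\<in>I. f i)"
  by (induction I rule: infinite_finite_induct) (auto intro: reach_0 reach_add)

lemma reach_tm:
  assumes "\<gamma> \<in> paths Q"
  shows "reach (tm \<gamma> a)"
proof -
  have "eqv (tm \<gamma> a) (nf (sg \<gamma> a))"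
    using assms tm_0[OF assms] by (cases "a = 0") (simp_all add: nf_def)
  then show ?thesis
    using assms unfolding reach_def by (intro exI[of _ "sg \<gamma> a"]) simp
qed

lemma cycle_closed: "\<gamma> \<in> paths Q \<Longrightarrow> snd \<gamma> \<noteq> [] \<Longrightarrow> ptarget Q \<gamma> = psource \<gamma> \<Longrightarrow> cyclic_word (snd \<gamma>) \<and> \<gamma> = lp (snd \<gamma>)"
  using cycles_iff[of \<gamma>] by (simp add: cycles_def)

lemma closed_target: "cyclic_word r \<Longrightarrow> ptarget Q (lp r) = psource (lp r)"
  using cycles_iff[of "lp r"] by (simp add: cycles_def)

lemma noncycle_tm: "ptarget Q \<gamma> \<noteq> psource \<gamma> \<Longrightarrow> tm \<gamma> a = cp \<gamma> (psource \<gamma>, []) a"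
  using closed_target by (metis tm_def)

lemma reach_cp:
  assumes \<alpha>: "\<alpha> \<in> paths Q" and \<beta>: "\<beta> \<in> paths Q"
  shows "reach (cp \<alpha> \<beta> a)"
proof -
  let ?s = "(psource \<beta>, [])" and ?t = "(ptarget Q \<beta>, [])"
  have st: "?s \<in> paths Q" "?t \<in> paths Q"
    using \<beta> by (simp_all add: vertex_path psource_verts ptarget_verts)
  have comp: "composable Q \<beta> ?s" "composable Q ?t \<beta>" "pcomp \<beta> ?s = \<beta>" "pcomp ?t \<beta> = \<beta>"
    by (simp_all add: composable_vertex pcomp_vertex)
  consider "composable Q \<alpha> \<beta>" "composable Q \<beta> \<alpha>" | "\<not> composable Q \<alpha> \<beta>"
    | "composable Q \<alpha> \<beta>" "\<not> composable Q \<beta> \<alpha>"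
    by blast
  then show ?thesis
  proof cases
    case 1
    have "reach (wd (rotate i (snd \<beta> @ snd \<alpha>)) a)" if "i < length (snd \<beta>)" for i
    proof -
      have "pcomp \<alpha> \<beta> \<in> paths Q" "ptarget Q (pcomp \<alpha> \<beta>) = psource (pcomp \<alpha> \<beta>)" "snd (pcomp \<alpha> \<beta>) \<noteq> []"
        using pcomp_paths[OF \<alpha> \<beta> 1(1)] ptarget_pcomp[OF 1(1)] 1(2) that
        by (auto simp: composable_def pcomp_def psource_def)
      then have "cyclic_word (snd (pcomp \<alpha> \<beta>))"
        using cycle_closed by blast
      then have "cyclic_word (rotate i (snd \<beta> @ snd \<alpha>))"
        by (simp add: closed_rotate pcomp_def)
      then show ?thesis
        using reach_tm[OF closed_path] by (simp flip: tm_lp)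
    qed
    then have "reach (\<Sum>i<length (snd \<beta>). wd (rotate i (snd \<beta> @ snd \<alpha>)) a)"
      by (intro reach_sum) simp
    then show ?thesis
      using cp_expand[of \<alpha> "fst \<beta>" "snd \<beta>" a] \<alpha> \<beta> 1 by (elim reach_eqv[rotated]) simp_all
  next
    \<comment> \<open>Writing \<beta> as its terminal vertex times \<beta>, the Leibniz rule removes
      \<beta> from the second entry: one term dies since \<alpha> does not compose with that vertex,
      and the other has a vertex as second entry.\<close>
    case 2
    then have "\<not> composable Q \<alpha> ?t"
      by (simp add: composable_def psource_def ptarget_def)
    then have e: "eqv (cp \<alpha> \<beta> a) (if composable Q \<beta> \<alpha> then cp (pcomp \<beta> \<alpha>) ?t a else 0)"
      using cp_leibniz[OF \<alpha> st(2) \<beta>, of a] 2 comp by simp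
    show ?thesis
    proof (cases "composable Q \<beta> \<alpha>")
      case True
      let ?\<gamma> = "pcomp \<beta> \<alpha>"
      have \<gamma>: "?\<gamma> \<in> paths Q" "ptarget Q ?\<gamma> = ptarget Q \<beta>" "psource ?\<gamma> = psource \<alpha>"
        using pcomp_paths[OF \<beta> \<alpha> True] ptarget_pcomp[OF True] by simp_all
      have ne: "psource \<alpha> \<noteq> ptarget Q \<beta>"
        using 2 by (simp add: composable_def)
      let ?a = "(psource \<alpha>, [])"
      have a: "?a \<in> paths Q"
        using \<alpha> by (simp add: vertex_path psource_verts)
      \<comment> \<open>The product of two different vertices is zero, so the Leibniz rule relates
        the chains of a non-closed path with its two end vertices. It trades the terminal vertex for
        the source, the one chosen in \<open>tm\<close>.\<close>
      have "eqv 0 (cp ?\<gamma> ?a a + cp ?\<gamma> ?t a)"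
        using cp_leibniz[OF \<gamma>(1) a st(2), of a] ne \<gamma>
        by (simp add: composable_vertex pcomp_vertex psource_def ptarget_def)
      from eqv_diff[OF this eqv_refl[of "cp ?\<gamma> ?a a"]]
      have "eqv (cp ?\<gamma> ?t a) (0 - cp ?\<gamma> ?a a)"
        using eqv_sym by simp
      moreover have "reach (cp ?\<gamma> ?a a)"
        using reach_tm[OF \<gamma>(1), of a] noncycle_tm[of ?\<gamma> a] ne \<gamma> by simp
      ultimately have "reach (cp ?\<gamma> ?t a)"
        using reach_eqv reach_diff[OF reach_0] by blast
      with e True show ?thesis
        using reach_eqv by simp
    next
      case False
      with e show ?thesis
        using reach_eqv reach_0 by simp
    qed
  next
    \<comment> \<open>The mirror image with \<beta> times its source vertex; here the vertex left in
      the second entry is already the source.\<close>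
    case 3
    then have "\<not> composable Q ?s \<alpha>"
      by (simp add: composable_def psource_def)
    then have e: "eqv (cp \<alpha> \<beta> a) (cp (pcomp \<alpha> \<beta>) ?s a)"
      using cp_leibniz[OF \<alpha> \<beta> st(1), of a] 3 comp by simp
    let ?\<gamma> = "pcomp \<alpha> \<beta>"
    have \<gamma>: "?\<gamma> \<in> paths Q" "ptarget Q ?\<gamma> = ptarget Q \<alpha>" "psource ?\<gamma> = psource \<beta>"
      using pcomp_paths[OF \<alpha> \<beta> 3(1)] ptarget_pcomp[OF 3(1)] by simp_all
    have "reach (cp ?\<gamma> ?s a)"
      using reach_tm[OF \<gamma>(1), of a] noncycle_tm[of ?\<gamma> a] 3(2) \<gamma> by (simp add: composable_def)
    with e show ?thesis
      using reach_eqv by blast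
  qed
qed

lemma reach_ch:
  assumes "ok f" "ok g"
  shows "reach (ch f g)"
  using assms(1)
proof (induction f rule: poly_mapping_single_induct)
  case zero
  show ?case
    using ch_J_left[OF J_zero assms(2)] reach_0 reach_eqv by blast
next
  case (single \<alpha> a)
  show ?case
    using assms(2)
  proof (induction g rule: poly_mapping_single_induct)
    case zero
    show ?case
      using ch_J_right[OF J_zero ok_single[OF single]] reach_0 reach_eqv by blast
  next
    case (single \<beta> b)
    then show ?case
      using ch_cp[OF \<open>\<alpha> \<in> paths Q\<close>] reach_cp[OF \<open>\<alpha> \<in> paths Q\<close>] reach_eqv by blast
  next
    case (add g h)
    then show ?case
      using ch_add_right[OF ok_single[OF single]] reach_add reach_eqv by blast
  qed
next
  case (add f h)
  then show ?case
    using ch_add_left[OF _ _ assms(2)] reach_add reach_eqv by blast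
qed

lemma reach_all:
  assumes "z \<in> carrier (bar_free (MA :: (('v, 'a) qpath \<Rightarrow>\<^sub>0 'k::field) set ring) (Suc 0))"
  shows "reach z"
proof -
  have "Poly_Mapping.keys z \<subseteq> bar_generators (MA :: (('v, 'a) qpath \<Rightarrow>\<^sub>0 'k::field) set ring) (Suc 0)"
    using assms by (simp add: carrier_free_Abelian_group_iff)
  then show ?thesis
  proof (induction z rule: frag_induction)
    case (one xs)
    then obtain x y z w where xs: "xs = [x, y, z, w]" "x \<in> carrier MA" "y \<in> carrier MA" "z \<in> carrier MA"
      "w \<in> carrier (MA :: (('v, 'a) qpath \<Rightarrow>\<^sub>0 'k) set ring)"
      by (rule A.bar_generators_1)
    let ?x = "w \<otimes>\<^bsub>MA\<^esub> x \<otimes>\<^bsub>MA\<^esub> y"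
    have x: "?x \<in> carrier MA"
      using xs by simp
    have "eqv (frag_of xs) (A.chain ?x z)"
      using A.generator_chain[OF xs(2-5)] by (simp add: eqv_def xs(1))
    moreover have "A.chain ?x z = ch (rep ?x) (rep z)"
      using rep[OF x] rep[OF xs(4)] by (simp add: ch_def)
    ultimately show ?case
      using reach_ch[OF rep(1)[OF x] rep(1)[OF xs(4)]] reach_eqv by simp
  qed (auto intro: reach_0 reach_diff)
qed

section \<open>Cocycles\<close>

text \<open>Meaningful for a nonzero path \<open>v\<close> only: two representatives differ by an
  element supported on zero paths. Its coboundary \<open>trace v\<close> reads off the incidence of
  edges at the vertex \<open>v\<close>.\<close>

definition coef :: "('v, 'a) qpath \<Rightarrow> (('v, 'a) qpath \<Rightarrow>\<^sub>0 'k::field) set \<Rightarrow> 'k" where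
  "coef v X = Poly_Mapping.lookup (rep X) v"

lemma coef_cls:
  assumes "\<not> zero_path Q Z v" "ok f"
  shows "coef v (cls f) = Poly_Mapping.lookup f v"
proof -
  have "v \<notin> Poly_Mapping.keys (rep (cls f) - f)"
    using rep_cls[OF assms(2)] assms(1) by (auto simp: J_def)
  then show ?thesis
    by (simp add: coef_def not_in_keys_iff_lookup_eq_zero lookup_minus)
qed

abbreviation trace ::
  "('v, 'a) qpath \<Rightarrow> (('v, 'a) qpath \<Rightarrow>\<^sub>0 'k::field) set \<Rightarrow> (('v, 'a) qpath \<Rightarrow>\<^sub>0 'k) set \<Rightarrow> 'k"
where
  "trace v \<equiv> \<lambda>x y. coef v (x \<otimes>\<^bsub>MA\<^esub> y) - coef v (y \<otimes>\<^bsub>MA\<^esub> x)"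

lemma coef_add:
  assumes "\<not> zero_path Q Z v" "x \<in> carrier MA" "y \<in> carrier MA"
  shows "coef v (x \<oplus>\<^bsub>MA\<^esub> y) = coef v x + coef v y"
proof -
  obtain f g where "x = cls f" "ok f" "y = cls g" "ok g"
    using assms by (metis MA_carrierE)
  then show ?thesis
    using assms(1) by (simp add: coef_cls lookup_add ok_add flip: cls_add)
qed

lemma cochain_cp:
  assumes "\<not> zero_path Q Z v" "\<alpha> \<in> paths Q" "\<beta> \<in> paths Q"
  shows "A.cochain (trace v) (cp \<alpha> \<beta> a) =
    (if composable Q \<alpha> \<beta> \<and> pcomp \<alpha> \<beta> = v then a else 0) -
    (if composable Q \<beta> \<alpha> \<and> pcomp \<beta> \<alpha> = v then a else 0)"
proof -
  have "A.cochain (trace v) (cp \<alpha> \<beta> a) =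
    coef v (cls (pmul (sg \<alpha> a) (sg \<beta> 1))) - coef v (cls (pmul (sg \<beta> 1) (sg \<alpha> a)))"
    using assms by (simp add: cp_def ch_def A.cochain_chain cls_closed cls_mult)
  also have "\<dots> = Poly_Mapping.lookup (pmul (sg \<alpha> a) (sg \<beta> 1)) v - Poly_Mapping.lookup (pmul (sg \<beta> 1) (sg \<alpha> a)) v"
    using assms by (simp add: coef_cls pmul_closed)
  finally show ?thesis
    by (simp add: pmul_single lookup_single when_def)
qed

lemma cochain_nf:
  assumes z: "z \<in> bar_cycles (MA :: (('v, 'a) qpath \<Rightarrow>\<^sub>0 'k::field) set ring) (base_field Q Z) (Suc 0)"
    and c: "eqv z (nf c)" and v: "\<not> zero_path Q Z v"
  shows "(\<Sum>\<gamma>\<in>Poly_Mapping.keys c. A.cochain (trace v) (tm \<gamma> (Poly_Mapping.lookup c \<gamma>))) = 0"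
proof -
  have "A.cochain (trace v) z = 0"
    using A.cochain_cycle[OF coef_add[OF v] z] .
  moreover have "A.cochain (trace v) (z - nf c) = 0"
    using A.trace_cocycle[OF coef_add[OF v]] c by (simp add: eqv_def)
  ultimately have "A.cochain (trace v) (nf c) = 0"
    by (simp add: A.cochain_def frag_eval_diff)
  then show ?thesis
    by (simp add: A.cochain_def nf_def frag_eval_sum)
qed

lemma keys_sum_select:
  "(\<Sum>\<gamma>\<in>Poly_Mapping.keys c. if \<gamma> = v then Poly_Mapping.lookup c \<gamma> else 0) = Poly_Mapping.lookup c v"
  by (simp add: in_keys_iff)

text \<open>Testing at a nonzero path \<open>v\<close> that is not closed sees only the term of
  \<open>v\<close>: a closed path contributes closed products or nothing, and another non-closed
  path composes with its source vertex on one side only, giving itself.\<close>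

lemma nf_noncycle:
  assumes z: "z \<in> bar_cycles (MA :: (('v, 'a) qpath \<Rightarrow>\<^sub>0 'k::field) set ring) (base_field Q Z) (Suc 0)"
    and c: "eqv z (nf c)" "ok c" and v: "v \<in> paths Q" "\<not> zero_path Q Z v" "ptarget Q v \<noteq> psource v"
  shows "Poly_Mapping.lookup c v = 0"
proof -
  have T: "A.cochain (trace v) (tm \<gamma> a) = (if \<gamma> = v then a else 0)" if \<gamma>: "\<gamma> \<in> paths Q" for \<gamma> and a :: 'k
  proof (cases "cyclic_word (snd \<gamma>) \<and> \<gamma> = lp (snd \<gamma>)")
    case True
    then have cl: "cyclic_word (snd \<gamma>)" and eq: "tm \<gamma> a = wd (snd \<gamma>) a"
      by (simp_all add: tm_def)
    have "v \<noteq> lp r" if "cyclic_word r" for r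
      using closed_target[OF that] v(3) by auto
    then have "v \<noteq> lp (snd \<gamma>)" "v \<noteq> lp (rotate1 (snd \<gamma>))" "v \<noteq> \<gamma>"
      using cl closed_rotate1 True by metis+
    then show ?thesis
      unfolding eq wd_def cochain_cp[OF v(2) tp_path[OF cl] ap_path[OF cl]]
      using tp_ap[OF cl] ap_tp[OF cl] by auto
  next
    case False
    have eq: "tm \<gamma> a = cp \<gamma> (psource \<gamma>, []) a"
      unfolding tm_def by (simp only: False if_False)
    have s: "(psource \<gamma>, []) \<in> paths Q"
      using \<gamma> by (simp add: vertex_path psource_verts)
    show ?thesis
      unfolding eq cochain_cp[OF v(2) \<gamma> s] using v(3)
      by (auto simp: composable_vertex pcomp_vertex)
  qed
  have "(\<Sum>\<gamma>\<in>Poly_Mapping.keys c. if \<gamma> = v then Poly_Mapping.lookup c \<gamma> else 0) =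
      (\<Sum>\<gamma>\<in>Poly_Mapping.keys c. A.cochain (trace v) (tm \<gamma> (Poly_Mapping.lookup c \<gamma>)))"
    using c(2) by (intro sum.cong[OF refl] T[symmetric]) blast
  also have "\<dots> = 0"
    using cochain_nf[OF z c(1) v(2)] .
  finally show ?thesis
    by (simp only: keys_sum_select)
qed

text \<open>Conservation at a vertex. Among all terms only two edges meet the vertex
  \<open>lp (rotate1 r)\<close>: \<open>r\<close> arrives there and \<open>rotate1 r\<close> leaves
  it. As that vertex is nonzero, it gives a valid test.\<close>

lemma nf_cycle:
  assumes z: "z \<in> bar_cycles (MA :: (('v, 'a) qpath \<Rightarrow>\<^sub>0 'k::field) set ring) (base_field Q Z) (Suc 0)"
    and c: "eqv z (nf c)" "ok c" and r: "cyclic_word r" "\<not> zerow (rotate1 r)"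
  shows "Poly_Mapping.lookup c (lp (rotate1 r)) = Poly_Mapping.lookup c (lp r)"
proof -
  let ?v = "lp (rotate1 r)"
  have clv: "cyclic_word (rotate1 r)"
    using r closed_rotate1 by blast
  have v: "\<not> zero_path Q Z ?v"
    using r by (simp add: lp_def zero_path_word)
  have T: "A.cochain (trace ?v) (tm \<gamma> a) = (if \<gamma> = ?v then a else 0) - (if \<gamma> = lp r then a else 0)"
    if \<gamma>: "\<gamma> \<in> paths Q" for \<gamma> and a :: 'k
  proof (cases "cyclic_word (snd \<gamma>) \<and> \<gamma> = lp (snd \<gamma>)")
    case True
    define s where "s = snd \<gamma>"
    have s: "cyclic_word s" "\<gamma> = lp s" and eq: "tm \<gamma> a = wd s a"
      using True by (simp_all add: tm_def s_def)
    have "rotate1 s = rotate1 r \<longleftrightarrow> s = r"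
    proof
      assume e: "rotate1 s = rotate1 r"
      then have "rotate1 r \<in> rotations s"
        using rotations_rotate1[OF rotations_self[of s]] by simp
      then have "r \<in> rotations s"
        using rotations_trans rotations_sym[OF rotations_rotate1[OF rotations_self[of r]]] by blast
      with e show "s = r"
        using rotate1_bij[of s] rotations_self[of s] by (auto simp: bij_betw_def inj_on_def)
    qed simp
    then show ?thesis
      unfolding eq wd_def cochain_cp[OF v tp_path[OF s(1)] ap_path[OF s(1)]]
      using tp_ap[OF s(1)] ap_tp[OF s(1)] by (simp add: s(2))
  next
    case False
    have eq: "tm \<gamma> a = cp \<gamma> (psource \<gamma>, []) a"
      unfolding tm_def by (simp only: False if_False)
    have s: "(psource \<gamma>, []) \<in> paths Q"
      using \<gamma> by (simp add: vertex_path psource_verts)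
    have "\<gamma> \<noteq> ?v" "\<gamma> \<noteq> lp r"
      using False r clv by auto
    then show ?thesis
      unfolding eq cochain_cp[OF v \<gamma> s] by (auto simp: composable_vertex pcomp_vertex)
  qed
  have "(\<Sum>\<gamma>\<in>Poly_Mapping.keys c. (if \<gamma> = ?v then Poly_Mapping.lookup c \<gamma> else 0) -
      (if \<gamma> = lp r then Poly_Mapping.lookup c \<gamma> else 0)) =
      (\<Sum>\<gamma>\<in>Poly_Mapping.keys c. A.cochain (trace ?v) (tm \<gamma> (Poly_Mapping.lookup c \<gamma>)))"
    using c(2) by (intro sum.cong[OF refl] T[symmetric]) blast
  also have "\<dots> = 0"
    using cochain_nf[OF z c(1) v] .
  finally show ?thesis
    by (simp only: sum_subtractf keys_sum_select) simp
qed

section \<open>Vanishing of the first Hochschild homology\<close>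

lemma wd_of_nat:
  assumes "cyclic_word r"
  shows "eqv (wd r (of_nat n * a)) (\<Sum>i<n. wd r a)"
proof (induction n)
  case 0
  have "eqv (wd r 0) 0"
    using wd_add[OF assms, of 0 0] by (intro eqv_double) simp
  then show ?case
    by simp
next
  case (Suc n)
  have "wd r (of_nat (Suc n) * a) = wd r (of_nat n * a + a)"
    by (simp add: algebra_simps)
  also have "eqv \<dots> (wd r (of_nat n * a) + wd r a)"
    using wd_add[OF assms] .
  also have "eqv \<dots> ((\<Sum>i<n. wd r a) + wd r a)"
    by (intro eqv_add Suc eqv_refl)
  finally show ?case
    by simp
qed

text \<open>Cutting the cycle at an arrow outside \<open>y\<close> leaves \<open>y\<close> intact in
  the remainder, so such an edge has zero remainder.\<close>

lemma tl_rotate_relword: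
  assumes "length y \<le> i" "i < length (y @ w)" "zerow y"
  shows "zerow (tl (rotate i (y @ w)))"
proof -
  have "rotate i (y @ w) = drop i (y @ w) @ take i (y @ w)"
    using assms(2) by (simp add: rotate_drop_take)
  moreover have "drop i (y @ w) \<noteq> []"
    using assms(2) by (metis drop_eq_Nil linorder_not_le)
  ultimately have "tl (rotate i (y @ w)) = tl (drop i (y @ w)) @ y @ take (i - length y) w"
    using assms(1) by simp
  then show ?thesis
    using assms(3) by (simp add: zerow_append)
qed

text \<open>Start the cycle at a relation \<open>y\<close>. The cuts inside \<open>y\<close> add up
  to the chain with \<open>y\<close> as second entry, which is zero in the algebra; the other cuts
  have zero remainder. So the sum over all positions is a boundary, and double counting carries this
  over to the orbit.\<close>

lemma orbit_sum_const:
  fixes a :: "'k::field_char_0"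
  assumes p: "cyclic_word p" and r: "r \<in> rotations p" "zerow r"
  shows "eqv (\<Sum>s\<in>rotations p. wd s a) 0"
proof -
  obtain x y w where y: "y \<in> relwords" "r = x @ y @ w"
    using r(2) by (auto simp: zerow_def sublist_def)
  define q where "q = y @ w @ x"
  have "q = rotate (length x) r"
    by (simp add: q_def y(2) rotate_append)
  then have q: "q \<in> rotations p"
    using rotations_rotate[OF r(1)] by simp
  have cq: "cyclic_word q"
    using closed_rotations[OF p q] .
  \<comment> \<open>Double counting replaces the orbit sum by its \<open>?n\<close>-fold multiple;
    dividing the coefficient by \<open>?n\<close> in advance compensates for it. This is where
    characteristic zero enters.\<close>
  let ?n = "length p" and ?b = "a / of_nat (length p)"
  have n: "?n \<noteq> 0"
    using p by (simp add: cyclic_word_def)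
  have yne: "y \<noteq> []"
    using relwords_length[OF y(1)] by auto
  have path: "eqv (\<Sum>i<?n. wd (rotate i q) ?b) 0"
  proof -
    let ?u = "tail Q (hd y)"
    have hq: "tail Q (hd q) = ?u"
      using yne by (simp add: q_def)
    have cas: "cas ?u (y @ w @ x) ?u" "set (y @ w @ x) \<subseteq> arcs Q" "?u \<in> verts Q"
      unfolding hq[symmetric] q_def[symmetric] using cq closed_path[OF cq]
      by (simp_all add: cyclic_word_def lp_def paths_iff)
    let ?\<beta> = "(?u, y)" and ?\<alpha> = "(awlast ?u y, w @ x)"
    have av: "awlast ?u y \<in> verts Q"
      using cas by (intro awlast_in_verts) auto
    have ca: "cas (awlast ?u y) (w @ x) ?u"
      using cas(1) by (metis cas_append_iff)
    have P: "?\<beta> \<in> paths Q" "?\<alpha> \<in> paths Q"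
      using cas av ca awlast_if_cas[OF ca] by (auto simp: paths_iff)
    have C: "composable Q ?\<alpha> ?\<beta>" "composable Q ?\<beta> ?\<alpha>"
      using awlast_if_cas[OF ca] by (simp_all add: composable_def ptarget_def psource_def)
    have len: "?n = length y + length (w @ x)"
      using rotations_length[OF q] by (simp add: q_def)
    have "eqv (\<Sum>i<?n. wd (rotate i q) ?b) (\<Sum>i<?n. if i < length y then wd (rotate i q) ?b else 0)"
    proof (rule eqv_sum)
      fix i assume i: "i \<in> {..<?n}"
      show "eqv (wd (rotate i q) ?b) (if i < length y then wd (rotate i q) ?b else 0)"
      proof (cases "i < length y")
        case False
        then have "zerow (tl (rotate i q))"
          unfolding q_def using i len zerow_relword[OF y(1)] by (intro tl_rotate_relword) simp_all
        then show ?thesis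
          using False wd_zero[OF closed_rotate[OF cq]] by simp
      qed simp
    qed
    also have "(\<Sum>i<?n. if i < length y then wd (rotate i q) ?b else 0) = (\<Sum>i<length y. wd (rotate i q) ?b)"
      using len by (intro sum.mono_neutral_cong_right) auto
    also have "eqv \<dots> (cp ?\<alpha> ?\<beta> ?b)"
      using eqv_sym[OF cp_expand[OF P(2,1) C, of ?b]] by (simp add: q_def)
    also have "eqv \<dots> 0"
      using P zerow_relword[OF y(1)] by (intro cp_zero) (auto simp: zero_path_word)
    finally show ?thesis .
  qed
  have "eqv (\<Sum>s\<in>rotations p. wd s a) (\<Sum>s\<in>rotations p. \<Sum>i<?n. wd s ?b)"
  proof (rule eqv_sum)
    fix s assume "s \<in> rotations p"
    then show "eqv (wd s a) (\<Sum>i<?n. wd s ?b)"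
      using wd_of_nat[OF closed_rotations[OF p], of s ?n ?b] n by simp
  qed
  also have "(\<Sum>s\<in>rotations p. \<Sum>i<?n. wd s ?b) = (\<Sum>s\<in>rotations p. \<Sum>i<?n. wd (rotate i q) ?b)"
    using sum_rotations[OF q, of "\<lambda>s. wd s ?b"] sum.swap[of "\<lambda>s i. wd s ?b" "{..<?n}" "rotations p"] by simp
  also have "eqv \<dots> 0"
    by (rule eqv_sum_0) (rule path)
  finally show ?thesis .
qed

text \<open>With a single last edge the surviving edges form one path in the graph, so a conserved
  weight is constant on them. On edges with zero remainder the weight may be changed freely, which
  leaves the constant case.\<close>

lemma orbit_sum:
  fixes f :: "'a list \<Rightarrow> 'k::field_char_0"
  assumes p: "cyclic_word p" and r: "r \<in> rotations p" "zerow r"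
    and uniq: "(\<exists>e\<in>rotations p. \<not> zerow (tl e)) \<Longrightarrow> (\<exists>!e. e \<in> ends p)"
    and f: "\<And>s. s \<in> rotations p \<Longrightarrow> \<not> zerow (rotate1 s) \<Longrightarrow> f (rotate1 s) = f s"
  shows "eqv (\<Sum>s\<in>rotations p. wd s (f s)) 0"
proof (cases "\<exists>e\<in>rotations p. \<not> zerow (tl e)")
  case False
  then show ?thesis
    using closed_rotations[OF p] by (intro eqv_sum_0 wd_zero) auto
next
  case True
  then obtain e where e: "e \<in> ends p" "\<And>e'. e' \<in> ends p \<Longrightarrow> e' = e"
    using uniq by blast
  \<comment> \<open>Walking from \<open>s\<close> towards \<open>e\<close> keeps the weight while
    the vertices crossed are nonzero. A surviving edge leading to a zero vertex is a last edge, and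
    hence \<open>e\<close> itself.\<close>
  have const: "f s = f e" if "rotate i s = e" "s \<in> rotations p" "\<not> zerow (tl s)" for i s
    using that
  proof (induction i arbitrary: s)
    case (Suc i)
    show ?case
    proof (cases "zerow (rotate1 s)")
      case True
      then have "s \<in> ends p"
        using Suc.prems by (simp add: ends_def)
      then show ?thesis
        using e(2) by blast
    next
      case False
      then have "\<not> zerow (tl (rotate1 s))"
        using zerow_mono[of "tl (rotate1 s)" "rotate1 s"] by (auto simp: sublist_tl)
      then have "f (rotate1 s) = f e"
        using Suc.prems by (intro Suc.IH rotations_rotate1) (simp_all add: rotate1_rotate_swap)
      then show ?thesis
        using f[OF Suc.prems(2) False] by simp
    qed
  qed simp
  have "eqv (\<Sum>s\<in>rotations p. wd s (f s)) (\<Sum>s\<in>rotations p. wd s (f e))"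
  proof (rule eqv_sum)
    fix s assume s: "s \<in> rotations p"
    show "eqv (wd s (f s)) (wd s (f e))"
    proof (cases "zerow (tl s)")
      case True
      then show ?thesis
        using wd_zero[OF closed_rotations[OF p s]] eqv_trans eqv_sym by blast
    next
      case False
      have "e \<in> rotations s"
        using e(1) by (auto simp: ends_def intro: rotations_trans[OF rotations_sym[OF s]])
      then show ?thesis
        using const[OF _ s False] by (auto simp: rotations_def)
    qed
  qed
  also have "eqv \<dots> 0"
    using orbit_sum_const[OF p r] .
  finally show ?thesis .
qed

lemma cycles_boundaries:
  assumes cond: "\<And>p. cyclic_word p \<Longrightarrow> (\<exists>r\<in>rotations p. zerow r) \<and>
      ((\<exists>e\<in>rotations p. \<not> zerow (tl e)) \<longrightarrow> (\<exists>!e. e \<in> ends p))"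
    and z: "z \<in> bar_cycles (MA :: (('v, 'a) qpath \<Rightarrow>\<^sub>0 'k::field_char_0) set ring) (base_field Q Z) (Suc 0)"
  shows "z \<in> BD"
proof -
  have "z \<in> carrier (bar_free (MA :: (('v, 'a) qpath \<Rightarrow>\<^sub>0 'k) set ring) (Suc 0))"
    using z unfolding bar_cycles_def by blast
  then obtain c :: "('v, 'a) qpath \<Rightarrow>\<^sub>0 'k" where c: "ok c" "eqv z (nf c)"
    using reach_all unfolding reach_def by blast
  define f where "f r = Poly_Mapping.lookup c (lp r)" for r
  \<comment> \<open>\<open>L\<close> holds the cyclic words in the support of the normal form;
    \<open>R\<close> completes it to full orbits, as the orbit sums run over all rotations,
    including those with coefficient zero.\<close>
  define L where "L = {r. cyclic_word r \<and> lp r \<in> Poly_Mapping.keys c}"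
  define R where "R = (\<Union>r\<in>L. rotations r)"
  have "lp ` L \<subseteq> Poly_Mapping.keys c"
    by (auto simp: L_def)
  then have "finite L"
    by (rule inj_on_finite[rotated]) (auto simp: inj_on_def)
  then have finR: "finite R"
    by (simp add: R_def rotations_finite)
  have clR: "cyclic_word r" if "r \<in> R" for r
    using that closed_rotations by (auto simp: R_def L_def)
  have LR: "r \<in> L \<Longrightarrow> r \<in> R" for r
    using rotations_self by (auto simp: R_def)
  let ?S = "Poly_Mapping.keys c \<union> lp ` R"
  have S: "finite ?S" "?S \<subseteq> paths Q"
    using finR c(1) clR closed_path by auto
  have "eqv z (nf c)" by (rule c)
  also have "eqv \<dots> (\<Sum>\<gamma>\<in>?S. tm \<gamma> (Poly_Mapping.lookup c \<gamma>))"
    using S by (intro nf_superset) auto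
  also have "\<dots> = (\<Sum>\<gamma>\<in>?S - lp ` R. tm \<gamma> (Poly_Mapping.lookup c \<gamma>)) + (\<Sum>\<gamma>\<in>lp ` R. tm \<gamma> (Poly_Mapping.lookup c \<gamma>))"
    using S by (intro sum.subset_diff) auto
  also have "eqv \<dots> (0 + 0)"
  proof (intro eqv_add)
    show "eqv (\<Sum>\<gamma>\<in>?S - lp ` R. tm \<gamma> (Poly_Mapping.lookup c \<gamma>)) 0"
    proof (rule eqv_sum_0)
      fix \<gamma> assume \<gamma>: "\<gamma> \<in> ?S - lp ` R"
      then have p: "\<gamma> \<in> paths Q" and k: "\<gamma> \<in> Poly_Mapping.keys c"
        using S by auto
      have n: "\<not> (cyclic_word (snd \<gamma>) \<and> \<gamma> = lp (snd \<gamma>))"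
        using \<gamma> k LR[of "snd \<gamma>"] by (auto simp: L_def simp del: prod.collapse)
      then have tm: "tm \<gamma> = cp \<gamma> (psource \<gamma>, [])"
        unfolding tm_def by (rule if_not_P)
      have s: "(psource \<gamma>, []) \<in> paths Q"
        using p by (simp add: vertex_path psource_verts)
      \<comment> \<open>In the first case \<gamma> is a closed path without a cyclic word, that is,
        a vertex; a nonzero path that is not closed has coefficient zero; a zero path gives a zero
        class.\<close>
      consider "ptarget Q \<gamma> = psource \<gamma>" | "ptarget Q \<gamma> \<noteq> psource \<gamma>" "\<not> zero_path Q Z \<gamma>" | "zero_path Q Z \<gamma>"
        by blast
      then show "eqv (tm \<gamma> (Poly_Mapping.lookup c \<gamma>)) 0"
      proof cases
        case 1
        then show ?thesis
          unfolding tm using p by (intro cp_vertex) simp_all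
      next
        case 2
        then show ?thesis
          using nf_noncycle[OF z c(2,1) p] tm_0[OF p] by simp
      next
        case 3
        then show ?thesis
          unfolding tm using p s by (intro cp_zero) simp_all
      qed
    qed
    have "(\<Sum>\<gamma>\<in>lp ` R. tm \<gamma> (Poly_Mapping.lookup c \<gamma>)) = (\<Sum>r\<in>R. wd r (f r))"
      by (subst sum.reindex) (auto simp: inj_on_def tm_lp clR f_def)
    also have "\<dots> = (\<Sum>r\<in>\<Union> (rotations ` L). wd r (f r))"
      by (simp add: R_def)
    also have "\<dots> = (\<Sum>V\<in>rotations ` L. \<Sum>r\<in>V. wd r (f r))"
    proof (rule sum.Union_disjoint[simplified comp_def])
      show "\<forall>A\<in>rotations ` L. finite A"
        by (simp add: rotations_finite)
      show "\<forall>A\<in>rotations ` L. \<forall>B\<in>rotations ` L. A \<noteq> B \<longrightarrow> A \<inter> B = {}"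
        using rotations_eq by blast
    qed
    also have "eqv \<dots> 0"
    proof (rule eqv_sum_0)
      fix V assume "V \<in> rotations ` L"
      then obtain p where p: "cyclic_word p" "V = rotations p"
        by (auto simp: L_def)
      obtain r where "r \<in> rotations p" "zerow r"
        using cond[OF p(1)] by blast
      then show "eqv (\<Sum>r\<in>V. wd r (f r)) 0"
        unfolding p(2) using p(1) cond[OF p(1)] nf_cycle[OF z c(2,1)] closed_rotations[OF p(1)]
        by (intro orbit_sum) (auto simp: f_def)
    qed
    finally show "eqv (\<Sum>\<gamma>\<in>lp ` R. tm \<gamma> (Poly_Mapping.lookup c \<gamma>)) 0" .
  qed
  finally show ?thesis
    by (simp add: eqv_def)
qed

section \<open>Non-vanishing\<close>

definition psi ::
  "(('v, 'a) qpath \<Rightarrow> ('v, 'a) qpath \<Rightarrow> 'k::field) \<Rightarrow> (('v, 'a) qpath \<Rightarrow>\<^sub>0 'k) \<Rightarrow> (('v, 'a) qpath \<Rightarrow>\<^sub>0 'k) \<Rightarrow> 'k"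
where
  "psi S = bilin (\<lambda>\<alpha> \<beta> a b. a * b * S \<alpha> \<beta>)"

lemma
  fixes f g h :: "('v, 'a) qpath \<Rightarrow>\<^sub>0 'k::field"
  shows psi_add_left: "psi S (f + g) h = psi S f h + psi S g h"
    and psi_add_right: "psi S f (g + h) = psi S f g + psi S f h"
    and psi_zero: "psi S 0 h = 0" "psi S h 0 = 0"
    and psi_single: "psi S (sg \<alpha> a) (sg \<beta> b) = a * b * S \<alpha> \<beta>"
  unfolding psi_def
  by (simp_all add: bilin_add_left bilin_add_right bilin_zero bilin_single distrib_left distrib_right)

lemma psi_scalar:
  assumes "ok f" "ok g"
  shows "psi S (pmul (scalar Q c) f) g = psi S f (pmul (scalar Q c) g)"
  using assms(1)
proof (induction f rule: poly_mapping_single_induct)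
  case (single \<alpha> a)
  show ?case
    using assms(2)
  proof (induction g rule: poly_mapping_single_induct)
    case (single \<beta> b)
    then show ?case
      using \<open>\<alpha> \<in> paths Q\<close> by (simp add: scalar_single psi_single)
  qed (simp_all add: pmul_zero_right pmul_add_right psi_zero psi_add_right)
qed (simp_all add: pmul_zero_right pmul_add_right psi_zero psi_add_left)

section \<open>Cocycles of the monomial algebra from functions on pairs of paths\<close>

context
  fixes S :: "('v, 'a) qpath \<Rightarrow> ('v, 'a) qpath \<Rightarrow> 'k::field"
  assumes S_zero: "\<And>\<alpha> \<beta>. \<lbrakk>\<alpha> \<in> paths Q; \<beta> \<in> paths Q; zero_path Q Z \<alpha> \<or> zero_path Q Z \<beta>\<rbrakk> \<Longrightarrow> S \<alpha> \<beta> = 0"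
    and S_cocycle: "\<And>\<alpha> \<beta> \<gamma>. \<lbrakk>\<alpha> \<in> paths Q; \<beta> \<in> paths Q; \<gamma> \<in> paths Q\<rbrakk> \<Longrightarrow>
      (if composable Q \<beta> \<gamma> then S \<alpha> (pcomp \<beta> \<gamma>) else 0) =
      (if composable Q \<gamma> \<alpha> then S (pcomp \<gamma> \<alpha>) \<beta> else 0) + (if composable Q \<alpha> \<beta> then S (pcomp \<alpha> \<beta>) \<gamma> else 0)"
begin

lemma psi_J:
  assumes "f \<in> J" "ok g"
  shows "psi S f g = 0" "psi S g f = 0"
proof -
  have "Poly_Mapping.keys f \<subseteq> {\<gamma>. zero_path Q Z \<gamma>}"
    using assms(1) by (simp add: J_def)
  then have "psi S f g = 0 \<and> psi S g f = 0"
  proof (induction f rule: poly_mapping_single_induct)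
    case (single \<alpha> a)
    then have \<alpha>: "zero_path Q Z \<alpha>" "\<alpha> \<in> paths Q"
      by (auto simp: zero_path_def)
    show ?case
      using assms(2)
    proof (induction g rule: poly_mapping_single_induct)
      case (single \<beta> b)
      then show ?case
        using \<alpha> by (simp add: psi_single S_zero)
    qed (simp_all add: psi_zero psi_add_left psi_add_right)
  qed (simp_all add: psi_zero psi_add_left psi_add_right)
  then show "psi S f g = 0" "psi S g f = 0"
    by auto
qed

definition Psi :: "(('v, 'a) qpath \<Rightarrow>\<^sub>0 'k) set \<Rightarrow> (('v, 'a) qpath \<Rightarrow>\<^sub>0 'k) set \<Rightarrow> 'k" where
  "Psi X Y = psi S (rep X) (rep Y)"

text \<open>Changing a representative adds an element supported on zero paths, and the pairing
  vanishes on those in either argument.\<close>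

lemma Psi_cls:
  assumes "ok f" "ok g"
  shows "Psi (cls f) (cls g) = psi S f g"
proof -
  let ?f = "rep (cls f) - f" and ?g = "rep (cls g) - g"
  have J: "?f \<in> J" "?g \<in> J"
    using assms rep_cls by auto
  have "Psi (cls f) (cls g) = psi S (f + ?f) (g + ?g)"
    by (simp add: Psi_def)
  also have "\<dots> = psi S f g"
    using J_paths[OF J(2)] psi_J(1)[OF J(1)] psi_J(2)[OF J(2)] assms
    by (simp only: psi_add_left psi_add_right) simp
  finally show ?thesis .
qed

lemma psi_cocycle:
  assumes "ok f" "ok g" "ok h"
  shows "psi S f (pmul g h) = psi S (pmul h f) g + psi S (pmul f g) h"
  using assms(1)
proof (induction f rule: poly_mapping_single_induct)
  case (single \<alpha> a)
  show ?case
    using assms(2)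
  proof (induction g rule: poly_mapping_single_induct)
    case (single \<beta> b)
    show ?case
      using assms(3)
    proof (induction h rule: poly_mapping_single_induct)
      case (single \<gamma> c)
      have "psi S (sg \<alpha> a) (pmul (sg \<beta> b) (sg \<gamma> c)) = a * b * c * (if composable Q \<beta> \<gamma> then S \<alpha> (pcomp \<beta> \<gamma>) else 0)"
        by (simp add: pmul_single psi_zero psi_single)
      also have "\<dots> = a * b * c * (if composable Q \<gamma> \<alpha> then S (pcomp \<gamma> \<alpha>) \<beta> else 0) +
          a * b * c * (if composable Q \<alpha> \<beta> then S (pcomp \<alpha> \<beta>) \<gamma> else 0)"
        using S_cocycle[OF \<open>\<alpha> \<in> paths Q\<close> \<open>\<beta> \<in> paths Q\<close> \<open>\<gamma> \<in> paths Q\<close>] by (simp only: distrib_left)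
      also have "\<dots> = psi S (pmul (sg \<gamma> c) (sg \<alpha> a)) (sg \<beta> b) + psi S (pmul (sg \<alpha> a) (sg \<beta> b)) (sg \<gamma> c)"
        by (simp add: pmul_single psi_zero psi_single)
      finally show ?case .
    qed (simp_all add: pmul_zero_right pmul_zero_left pmul_add_left pmul_add_right psi_zero psi_add_left psi_add_right)
  qed (simp_all add: pmul_zero_right pmul_zero_left pmul_add_left pmul_add_right psi_zero psi_add_left psi_add_right)
qed (simp_all add: pmul_zero_right pmul_zero_left pmul_add_left pmul_add_right psi_zero psi_add_left psi_add_right)

lemma Psi_bnd:
  assumes "z \<in> (BD :: ((('v, 'a) qpath \<Rightarrow>\<^sub>0 'k) set list \<Rightarrow>\<^sub>0 int) set)"
  shows "A.cochain Psi z = 0"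
proof (rule A.cochain_bnd[OF _ _ _ _ assms])
  fix x x' y :: "(('v, 'a) qpath \<Rightarrow>\<^sub>0 'k) set"
  assume "x \<in> carrier MA" "x' \<in> carrier MA" "y \<in> carrier MA"
  then obtain f f' g where *: "x = cls f" "ok f" "x' = cls f'" "ok f'" "y = cls g" "ok g"
    by (metis MA_carrierE)
  show "Psi (x \<oplus>\<^bsub>MA\<^esub> x') y = Psi x y + Psi x' y"
    using * ok_add[OF *(2,4)] by (simp add: Psi_cls psi_add_left flip: cls_add)
  show "Psi y (x \<oplus>\<^bsub>MA\<^esub> x') = Psi y x + Psi y x'"
    using * ok_add[OF *(2,4)] by (simp add: Psi_cls psi_add_right flip: cls_add)
  show "Psi x (x' \<otimes>\<^bsub>MA\<^esub> y) = Psi (y \<otimes>\<^bsub>MA\<^esub> x) x' + Psi (x \<otimes>\<^bsub>MA\<^esub> x') y"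
    using * by (simp add: Psi_cls psi_cocycle pmul_closed flip: cls_mult)
next
  fix c x y :: "(('v, 'a) qpath \<Rightarrow>\<^sub>0 'k) set"
  assume "c \<in> base_field Q Z" "x \<in> carrier MA" "y \<in> carrier MA"
  moreover from this obtain a where "c = cls (scalar Q a)"
    by (auto simp: base_field_eq)
  moreover obtain f g where "x = cls f" "ok f" "y = cls g" "ok g"
    using calculation by (metis MA_carrierE)
  ultimately show "Psi (c \<otimes>\<^bsub>MA\<^esub> x) y = Psi x (c \<otimes>\<^bsub>MA\<^esub> y)"
    by (simp add: Psi_cls psi_scalar pmul_closed scalar_closed flip: cls_mult)
qed

end

text \<open>
  As a function of \<open>\<beta>\<close> this is the derivation of the path algebra into its dual that is given by
  \<open>F\<close> on the arrows.
\<close>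

definition rsum :: "('a list \<Rightarrow> 'k::field) \<Rightarrow> ('v, 'a) qpath \<Rightarrow> ('v, 'a) qpath \<Rightarrow> 'k" where
  "rsum F \<alpha> \<beta> = (if composable Q \<alpha> \<beta> \<and> composable Q \<beta> \<alpha>
     then \<Sum>i<length (snd \<beta>). F (rotate i (snd \<beta> @ snd \<alpha>)) else 0)"

lemma sum_lessThan_add:
  "(\<Sum>i<m + (n :: nat). (g i :: 'b::comm_monoid_add)) = (\<Sum>i<m. g i) + (\<Sum>i<n. g (m + i))"
  by (induction n) (simp_all add: add.assoc)

text \<open>If the three paths close up to a cycle, all terms are sums of \<open>F\<close> over cuts
  of one cyclic word: the cuts in \<beta>\<gamma> are those in \<gamma> followed by those in
  \<beta>. If some pair fails to compose, every term is zero.\<close>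

lemma rsum_cocycle:
  "(if composable Q \<beta> \<gamma> then rsum F \<alpha> (pcomp \<beta> \<gamma>) else 0) =
   (if composable Q \<gamma> \<alpha> then rsum F (pcomp \<gamma> \<alpha>) \<beta> else 0) + (if composable Q \<alpha> \<beta> then rsum F (pcomp \<alpha> \<beta>) \<gamma> else 0)"
proof (cases "composable Q \<alpha> \<beta> \<and> composable Q \<beta> \<gamma> \<and> composable Q \<gamma> \<alpha>")
  case True
  then have c: "composable Q \<alpha> \<beta>" "composable Q \<beta> \<gamma>" "composable Q \<gamma> \<alpha>"
    by auto
  let ?a = "snd \<alpha>" and ?b = "snd \<beta>" and ?c = "snd \<gamma>"
  have "rsum F \<alpha> (pcomp \<beta> \<gamma>) = (\<Sum>i<length ?c + length ?b. F (rotate i (?c @ ?b @ ?a)))"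
    using c by (simp add: rsum_def composable_pcomp_right) (simp add: pcomp_def)
  also have "\<dots> = (\<Sum>i<length ?c. F (rotate i (?c @ ?b @ ?a))) + (\<Sum>i<length ?b. F (rotate (length ?c + i) (?c @ ?b @ ?a)))"
    by (rule sum_lessThan_add)
  also have "(\<Sum>i<length ?b. F (rotate (length ?c + i) (?c @ ?b @ ?a))) = (\<Sum>i<length ?b. F (rotate i (?b @ ?a @ ?c)))"
  proof -
    have "rotate (length ?c + i) (?c @ ?b @ ?a) = rotate i (?b @ ?a @ ?c)" for i
      using rotate_append[of ?c "?b @ ?a"] by (simp add: add.commute flip: rotate_rotate)
    then show ?thesis
      by simp
  qed
  also have "\<dots> = rsum F (pcomp \<gamma> \<alpha>) \<beta>"
    using c by (simp add: rsum_def composable_pcomp_right) (simp add: pcomp_def)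
  also have "(\<Sum>i<length ?c. F (rotate i (?c @ ?b @ ?a))) = rsum F (pcomp \<alpha> \<beta>) \<gamma>"
    using c by (simp add: rsum_def composable_pcomp_right) (simp add: pcomp_def)
  finally show ?thesis
    using c by (simp add: add.commute)
next
  case False
  then show ?thesis
    by (auto simp: rsum_def composable_pcomp_right)
qed

text \<open>If \<alpha> is zero, each cut in \<beta> leaves \<alpha> inside the remainder, where
  \<open>F\<close> vanishes. If \<beta> contains a relation, the cuts outside it vanish for the same
  reason, and those inside it cancel by \<open>rel\<close>.\<close>

lemma rsum_zero:
  fixes F :: "'a list \<Rightarrow> 'k::field"
  assumes F: "\<And>r. F r \<noteq> 0 \<Longrightarrow> \<not> zerow (tl r)"
    and rel: "\<And>y w. y \<in> relwords \<Longrightarrow> (\<Sum>i<length y. F (rotate i (y @ w))) = 0"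
    and z: "zero_path Q Z \<alpha> \<or> zero_path Q Z \<beta>"
  shows "rsum F \<alpha> \<beta> = 0"
proof -
  have F0: "zerow (tl r) \<Longrightarrow> F r = 0" for r
    using F by blast
  let ?a = "snd \<alpha>" and ?b = "snd \<beta>"
  have "zerow ?a \<or> zerow ?b"
    using z zero_path_word[of "fst \<alpha>" ?a] zero_path_word[of "fst \<beta>" ?b] by auto
  then have "(\<Sum>i<length ?b. F (rotate i (?b @ ?a))) = 0"
  proof
    assume a: "zerow ?a"
    show ?thesis
    proof (intro sum.neutral ballI F0)
      fix i assume "i \<in> {..<length ?b}"
      then have i: "i < length ?b"
        by simp
      then have "rotate i (?b @ ?a) = drop i ?b @ ?a @ take i ?b" "drop i ?b \<noteq> []"
        by (simp_all add: rotate_drop_take)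
      then show "zerow (tl (rotate i (?b @ ?a)))"
        using a by (simp add: zerow_append)
    qed
  next
    assume "zerow ?b"
    then obtain x y w where y: "y \<in> relwords" "?b = x @ y @ w"
      by (auto simp: zerow_def sublist_def)
    have zy: "zerow y"
      using zerow_relword[OF y(1)] .
    let ?g = "\<lambda>i. F (rotate i (x @ y @ w @ ?a))"
    have "(\<Sum>i<length ?b. F (rotate i (?b @ ?a))) = (\<Sum>i<length x. ?g i) + (\<Sum>i<length y + length w. ?g (length x + i))"
      by (simp add: y(2) sum_lessThan_add)
    also have "(\<Sum>i<length x. ?g i) = 0"
    proof (intro sum.neutral ballI F0)
      fix i assume "i \<in> {..<length x}"
      then have i: "i < length x"
        by simp
      then have "rotate i (x @ y @ w @ ?a) = drop i x @ y @ w @ ?a @ take i x" "drop i x \<noteq> []"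
        by (simp_all add: rotate_drop_take)
      then show "zerow (tl (rotate i (x @ y @ w @ ?a)))"
        using zy by (simp add: zerow_append)
    qed
    also have "(\<Sum>i<length y + length w. ?g (length x + i)) = (\<Sum>i<length y + length w. F (rotate i (y @ w @ ?a @ x)))"
    proof -
      have "rotate (length x + i) (x @ y @ w @ ?a) = rotate i (y @ w @ ?a @ x)" for i
        using rotate_append[of x "y @ w @ ?a"] by (simp add: add.commute flip: rotate_rotate)
      then show ?thesis
        by simp
    qed
    also have "\<dots> = (\<Sum>i<length y. F (rotate i (y @ w @ ?a @ x))) +
        (\<Sum>i<length w. F (rotate (length y + i) (y @ w @ ?a @ x)))"
      by (rule sum_lessThan_add)
    also have "(\<Sum>i<length w. F (rotate (length y + i) (y @ w @ ?a @ x))) = 0"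
      using zy by (intro sum.neutral ballI F0 tl_rotate_relword) auto
    finally show ?thesis
      using rel[OF y(1)] by simp
  qed
  then show ?thesis
    by (simp add: rsum_def)
qed

text \<open>\<open>K\<close> is a union of components, so the sum of its edges is a cycle.
  \<open>F\<close> is a weight whose derivation descends to the algebra: a relation on the circuit
  requires total weight zero, and \<open>sumF\<close> provides this when a zero cycle exists. The
  value of this cocycle on the cycle is the weight of \<open>K\<close>.\<close>

lemma cycle_not_boundary:
  fixes F :: "'a list \<Rightarrow> 'k::field_char_0"
  assumes p: "cyclic_word p" and K: "K \<subseteq> rotations p"
    and Kcl: "\<And>u. u \<in> rotations p \<Longrightarrow> \<not> zerow (rotate1 u) \<Longrightarrow> rotate1 u \<in> K \<longleftrightarrow> u \<in> K"
    and F: "\<And>r. F r \<noteq> 0 \<Longrightarrow> r \<in> rotations p \<and> \<not> zerow (tl r)"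
    and sumF: "(\<exists>r\<in>rotations p. zerow r) \<Longrightarrow> (\<Sum>r\<in>rotations p. F r) = 0"
    and sumK: "(\<Sum>r\<in>K. F r) \<noteq> 0"
  shows "\<not> bar_cycles (MA :: (('v, 'a) qpath \<Rightarrow>\<^sub>0 'k) set ring) (base_field Q Z) (Suc 0) \<subseteq> BD"
proof
  assume sub: "bar_cycles (MA :: (('v, 'a) qpath \<Rightarrow>\<^sub>0 'k) set ring) (base_field Q Z) (Suc 0) \<subseteq> BD"
  have cl: "cyclic_word e" if "e \<in> K" for e
    using closed_rotations[OF p] K that by blast
  have finK: "finite K"
    using K rotations_finite finite_subset by blast
  define x where "x e = cls (sg (tp e) (1 :: 'k))" for e
  define y where "y e = cls (sg (ap e) (1 :: 'k))" for e
  define h where "h e = A.point (cls (sg (lp e) (1 :: 'k)))" for e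
  have xy: "x e \<in> carrier MA \<and> y e \<in> carrier MA" if "e \<in> K" for e
    using tp_path[OF cl[OF that]] ap_path[OF cl[OF that]] by (simp add: x_def y_def cls_closed)
  have prod: "x e \<otimes>\<^bsub>MA\<^esub> y e = cls (sg (lp e) 1)" "y e \<otimes>\<^bsub>MA\<^esub> x e = cls (sg (lp (rotate1 e)) 1)" if "e \<in> K" for e
    using tp_path[OF cl[OF that]] ap_path[OF cl[OF that]] tp_ap[OF cl[OF that]] ap_tp[OF cl[OF that]]
    by (simp_all add: x_def y_def pmul_single flip: cls_mult)
  \<comment> \<open>Vertex classes with the zero vertices deleted already in the free group, so that
    the telescoping below is an equality and not just a congruence.\<close>
  define h' where "h' e = (if zerow e then 0 else h e)" for e
  have hh: "h e - h' e \<in> A.rel0" if e: "cyclic_word e" for e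
  proof (cases "zerow e")
    case True
    then have "zero_path Q Z (lp e)"
      using closed_path[OF e] by (simp add: lp_def zero_path_word)
    then have "cls (sg (lp e) (1 :: 'k)) = cls 0"
      by (simp add: cls_eq_iff J_single)
    then show ?thesis
      using True A.point_zero by (simp add: h_def h'_def cls_zero)
  next
    case False
    then show ?thesis
      using generate_free_zero[OF A.bar_relators_carrier] by (simp add: h'_def)
  qed
  \<comment> \<open>By \<open>Kcl\<close>, \<open>rotate1\<close> maps the edges of \<open>K\<close>
    with nonzero endpoint bijectively onto those with nonzero starting vertex.\<close>
  have tel: "(\<Sum>e\<in>K. h' (rotate1 e)) = (\<Sum>e\<in>K. h' e)"
  proof -
    let ?K1 = "{e \<in> K. \<not> zerow (rotate1 e)}" and ?K0 = "{e \<in> K. \<not> zerow e}"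
    have "rotate1 ` ?K1 = ?K0"
    proof
      show "rotate1 ` ?K1 \<subseteq> ?K0"
        using K Kcl by blast
      show "?K0 \<subseteq> rotate1 ` ?K1"
      proof
        fix v assume v: "v \<in> ?K0"
        then have "v \<in> rotate1 ` rotations p"
          using K rotate1_bij[of p] by (auto simp: bij_betw_def)
        then obtain u where "u \<in> rotations p" "v = rotate1 u"
          by blast
        then show "v \<in> rotate1 ` ?K1"
          using Kcl v by blast
      qed
    qed
    moreover have "inj_on rotate1 ?K1"
      using rotate1_bij[of p] K by (auto simp: bij_betw_def inj_on_def)
    ultimately have "(\<Sum>e\<in>?K1. h (rotate1 e)) = (\<Sum>e\<in>?K0. h e)"
      using sum.reindex[of rotate1 ?K1 h] by simp
    moreover have "(\<Sum>e\<in>K. h' (rotate1 e)) = (\<Sum>e\<in>?K1. h (rotate1 e))"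
      using finK by (intro sum.mono_neutral_cong_right) (auto simp: h'_def)
    moreover have "(\<Sum>e\<in>K. h' e) = (\<Sum>e\<in>?K0. h e)"
      using finK by (intro sum.mono_neutral_cong_right) (auto simp: h'_def)
    ultimately show ?thesis
      by simp
  qed
  have "(\<Sum>e\<in>K. (h e - h' e) - (h (rotate1 e) - h' (rotate1 e))) \<in> A.rel0"
    using cl closed_rotate1
    by (intro generate_free_sum[OF A.bar_relators_carrier] generate_free_diff[OF A.bar_relators_carrier] hh) auto
  also have "(\<Sum>e\<in>K. (h e - h' e) - (h (rotate1 e) - h' (rotate1 e))) = (\<Sum>e\<in>K. h e - h (rotate1 e))"
    using tel by (simp add: sum_subtractf)
  also have "\<dots> = (\<Sum>e\<in>K. A.point (x e \<otimes>\<^bsub>MA\<^esub> y e) - A.point (y e \<otimes>\<^bsub>MA\<^esub> x e))"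
    by (intro sum.cong) (auto simp: prod h_def)
  finally have "(\<Sum>e\<in>K. A.chain (x e) (y e)) \<in> bar_cycles MA (base_field Q Z) (Suc 0)"
    using finK xy by (intro A.chain_sum_cycle) auto
  then have bd: "(\<Sum>e\<in>K. A.chain (x e) (y e)) \<in> BD"
    using sub by blast
  \<comment> \<open>The sum over the cuts inside \<open>y\<close> equals the sum over all positions.
    Multiplied by the number of rotations, this is a multiple of the total weight, and that number
    is invertible.\<close>
  have rel: "(\<Sum>i<length y. F (rotate i (y @ w))) = 0" if y: "y \<in> relwords" for y w
  proof (cases "y @ w \<in> rotations p")
    case False
    have "F (rotate i (y @ w)) = 0" for i
    proof (rule ccontr)
      assume "F (rotate i (y @ w)) \<noteq> 0"
      then have "rotate i (y @ w) \<in> rotations p"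
        using F by blast
      moreover have "y @ w \<in> rotations (rotate i (y @ w))"
        using rotations_sym[OF rotations_rotate[OF rotations_self]] .
      ultimately show False
        using False rotations_trans by blast
    qed
    then show ?thesis
      by simp
  next
    case True
    have z: "zerow (y @ w)"
      using zerow_relword[OF y] by (simp add: zerow_append)
    have n: "length p = length y + length w"
      using rotations_length[OF True] by simp
    have "(\<Sum>i<length w. F (rotate (length y + i) (y @ w))) = 0"
      using tl_rotate_relword[of y _ w] zerow_relword[OF y] F by (intro sum.neutral) force
    then have "(\<Sum>i<length y. F (rotate i (y @ w))) = (\<Sum>i<length p. F (rotate i (y @ w)))"
      by (simp add: n sum_lessThan_add)
    moreover have "(\<Sum>r\<in>rotations p. F r) = 0"
      using sumF True z by blast
    then have "of_nat (card (rotations p)) * (\<Sum>i<length p. F (rotate i (y @ w))) = (0 :: 'k)"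
      using sum_rotations[OF True, of F] by simp
    moreover have "card (rotations p) \<noteq> 0"
      using rotations_finite rotations_self by (auto simp: card_eq_0_iff)
    ultimately show ?thesis
      by simp
  qed
  have F': "\<not> zerow (tl r)" if "F r \<noteq> 0" for r
    using F that by blast
  have S0: "rsum F \<alpha> \<beta> = 0" if "zero_path Q Z \<alpha> \<or> zero_path Q Z \<beta>" for \<alpha> \<beta>
    using rsum_zero[of F, OF F' rel that] .
  have "A.cochain (Psi (rsum F)) (\<Sum>e\<in>K. A.chain (x e) (y e)) = 0"
    using bd by (intro Psi_bnd S0 rsum_cocycle)
  moreover have "A.cochain (Psi (rsum F)) (\<Sum>e\<in>K. A.chain (x e) (y e)) = (\<Sum>e\<in>K. F e)"
  proof -
    have "A.cochain (Psi (rsum F)) (A.chain (x e) (y e)) = F e" if e: "e \<in> K" for e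
    proof -
      have ne: "e \<noteq> []"
        using cl[OF e] by (simp add: cyclic_word_def)
      have "Psi (rsum F) (x e) (y e) = psi (rsum F) (sg (tp e) 1) (sg (ap e) 1)"
        unfolding x_def y_def using tp_path[OF cl[OF e]] ap_path[OF cl[OF e]]
        by (intro Psi_cls S0 rsum_cocycle) auto
      also have "\<dots> = F ([hd e] @ tl e)"
        using tp_ap(1)[OF cl[OF e]] ap_tp(1)[OF cl[OF e]] by (simp add: psi_single rsum_def) (simp add: ap_def tp_def)
      finally show ?thesis
        using A.cochain_chain[of "x e" "Psi (rsum F)" "y e"] xy[OF e] ne by simp
    qed
    then show ?thesis
      by (simp add: A.cochain_def frag_eval_sum)
  qed
  ultimately show False
    using sumK by simp
qed

text \<open>Two choices of component and weight: without zero cycles, the whole orbit with weight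
  one; with two different last edges, the component of one of them and the difference of their
  indicator functions, whose total is zero.\<close>

lemma boundaries_condition:
  assumes sub: "bar_cycles (MA :: (('v, 'a) qpath \<Rightarrow>\<^sub>0 'k::field_char_0) set ring) (base_field Q Z) (Suc 0) \<subseteq> BD"
    and p: "cyclic_word p"
  shows "(\<exists>r\<in>rotations p. zerow r) \<and> ((\<exists>e\<in>rotations p. \<not> zerow (tl e)) \<longrightarrow> (\<exists>!e. e \<in> ends p))"
proof
  show z: "\<exists>r\<in>rotations p. zerow r"
  proof (rule ccontr)
    assume none: "\<not> (\<exists>r\<in>rotations p. zerow r)"
    let ?F = "\<lambda>r. if r \<in> rotations p then 1 else 0 :: 'k"
    have "\<not> bar_cycles (MA :: (('v, 'a) qpath \<Rightarrow>\<^sub>0 'k) set ring) (base_field Q Z) (Suc 0) \<subseteq> BD"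
    proof (rule cycle_not_boundary[OF p, of "rotations p" ?F])
      fix r assume "?F r \<noteq> 0"
      then have "r \<in> rotations p"
        by (auto split: if_splits)
      then show "r \<in> rotations p \<and> \<not> zerow (tl r)"
        using none zerow_mono[of "tl r" r] by (auto simp: sublist_tl)
    next
      have "card (rotations p) \<noteq> 0"
        using rotations_finite rotations_self by (auto simp: card_eq_0_iff)
      then show "(\<Sum>r\<in>rotations p. ?F r) \<noteq> 0"
        by simp
    qed (use none rotations_rotate1 in auto)
    with sub show False
      by blast
  qed
  show "(\<exists>e\<in>rotations p. \<not> zerow (tl e)) \<longrightarrow> (\<exists>!e. e \<in> ends p)"
  proof
    assume "\<exists>e\<in>rotations p. \<not> zerow (tl e)"
    then have "ends p \<noteq> {}"
      using z ends_nonempty p by (auto simp: cyclic_word_def)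
    then obtain e1 where e1: "e1 \<in> ends p"
      by blast
    show "\<exists>!e. e \<in> ends p"
    proof (rule ex1I[of _ e1])
      fix e2 assume e2: "e2 \<in> ends p"
      show "e2 = e1"
      proof (rule ccontr)
        assume ne: "e2 \<noteq> e1"
        \<comment> \<open>One step passes through a nonzero vertex. A step is determined by its
          starting edge, so the component of \<open>e1\<close> consists of the edges that flow into
          \<open>e1\<close>.\<close>
        define step where "step = {(u, rotate1 u) | u. u \<in> rotations p \<and> \<not> zerow (rotate1 u)}"
        define K where "K = {u \<in> rotations p. (u, e1) \<in> step\<^sup>*}"
        let ?F = "\<lambda>r. if r = e1 then 1 else if r = e2 then - 1 else 0 :: 'k"
        \<comment> \<open>No step starts at a last edge, so \<open>e2\<close> could reach
          \<open>e1\<close> only by being equal to it.\<close>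
        have e2K: "e2 \<notin> K"
        proof
          assume "e2 \<in> K"
          then have "(e2, e1) \<in> step\<^sup>*"
            by (simp add: K_def)
          then show False
            using ne e2 by (cases rule: converse_rtranclE) (auto simp: step_def ends_def)
        qed
        have e1K: "e1 \<in> K" "e1 \<in> rotations p" "e2 \<in> rotations p"
          using e1 e2 by (auto simp: K_def ends_def)
        have "\<not> bar_cycles (MA :: (('v, 'a) qpath \<Rightarrow>\<^sub>0 'k) set ring) (base_field Q Z) (Suc 0) \<subseteq> BD"
        proof (rule cycle_not_boundary[OF p, of K ?F])
          show "K \<subseteq> rotations p"
            by (auto simp: K_def)
        next
          fix u assume u: "u \<in> rotations p" "\<not> zerow (rotate1 u)"
          then have st: "(u, rotate1 u) \<in> step"
            by (auto simp: step_def)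
          show "rotate1 u \<in> K \<longleftrightarrow> u \<in> K"
          proof
            assume "rotate1 u \<in> K"
            then show "u \<in> K"
              using st u by (auto simp: K_def intro: converse_rtrancl_into_rtrancl)
          next
            assume "u \<in> K"
            then have "(u, e1) \<in> step\<^sup>*"
              by (simp add: K_def)
            \<comment> \<open>Here \<open>u\<close> differs from \<open>e1\<close>, since the vertex
              after \<open>u\<close> is nonzero; the walk from \<open>u\<close> to \<open>e1\<close>
              therefore begins with the only possible step.\<close>
            then have "(rotate1 u, e1) \<in> step\<^sup>*"
              using u e1 by (cases rule: converse_rtranclE) (auto simp: step_def ends_def)
            then show "rotate1 u \<in> K"
              using rotations_rotate1[OF u(1)] by (simp add: K_def)
          qed
        next
          fix r assume "?F r \<noteq> 0"
          then show "r \<in> rotations p \<and> \<not> zerow (tl r)"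
            using e1 e2 by (auto simp: ends_def split: if_splits)
        next
          have "(\<Sum>r\<in>rotations p. ?F r) = (\<Sum>r\<in>{e1, e2}. ?F r)"
            using e1K rotations_finite by (intro sum.mono_neutral_right) auto
          then show "(\<Sum>r\<in>rotations p. ?F r) = 0"
            using ne by simp
        next
          have "(\<Sum>r\<in>K. ?F r) = (\<Sum>r\<in>{e1}. ?F r)"
            using e1K e2K finite_subset[OF _ rotations_finite, of K p]
            by (intro sum.mono_neutral_right) (auto simp: K_def)
          then show "(\<Sum>r\<in>K. ?F r) \<noteq> 0"
            by simp
        qed
        with sub show False
          by blast
      qed
    qed (rule e1)
  qed
qed

end

theorem corollary2p17:
  fixes Q :: "('v, 'a) pre_digraph"
    and Z :: "('v, 'a) qpath set"
    and A :: "(('v, 'a) qpath \<Rightarrow>\<^sub>0 'k::field_char_0) set ring"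
  assumes "fin_digraph Q" and "connected Q"
    and "monomial_relations Q Z"
    and A_def: "A = monomial_algebra Q Z"
    and "ring.finite_dimension A (base_field Q Z) (carrier A)"
  shows "trivial_group (hochschild_homology 1 A (base_field Q Z)) \<longleftrightarrow>
    (\<forall>C\<in>circuits Q. \<not> trivial_circuit Q C \<longrightarrow> (\<exists>\<gamma>\<in>C. zero_path Q Z \<gamma>)) \<and>
    (\<forall>C\<in>circuits Q.
       odot_at Q (arrow_paths Q) (basis_paths Q Z) C \<noteq> {} \<and>
       odot_at Q Z (basis_paths Q Z) C \<noteq> {} \<longrightarrow>
       (\<exists>!p. p \<in> odot_at Q Z (basis_paths Q Z) C \<and>
             (case p of (\<xi>, \<beta>) \<Rightarrow> no_other_zero_relation Q Z \<xi> \<beta>)))"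
proof -
  interpret monomial_quiver Q Z
    using assms(1,3) by (intro monomial_quiver.intro monomial_quiver_axioms.intro)
  interpret A: central_pair "MA :: (('v, 'a) qpath \<Rightarrow>\<^sub>0 'k) set ring" "base_field Q Z"
    by (rule central_pair_MA)
  show ?thesis
    unfolding condition_iff A_def One_nat_def A.trivial_hochschild_iff
    using cycles_boundaries boundaries_condition by blast
qed

end
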